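(* Let $g\in M^1(\mathbb{R})$, let $a,b>0$ with $ab=\frac{p}{q}$ where $p,q\in\mathbb{N}$, $\gcd(p,q)=1$, and assume $g$ is a stable generator for $V_{1/b}(g)$. For $x,t\in\mathbb{R}$ let $\Phi_g(x,t)$ be the $q\times p$ matrix with entries $$\Phi_{sn}(x,t)=\sum_{k\in\mathbb{Z}} g\!\left(x+aqk+as-\tfrac{n}{b}\right)e^{2\pi i k t},\qquad s=0,\dots,q-1,\ n=0,\dots,p-1.$$ Then $\mathcal{G}(g,a,b)=\{e^{2\pi i b j\cdot}g(\cdot-al):l,j\in\mathbb{Z}\}$ is a frame for $L^2(\mathbb{R})$ if and only if $\Phi_g(x,t)$ has linearly independent columns for all $x,t\in\mathbb{R}$.
   Context: $M^1(\mathbb{R})$ is the Feichtinger algebra: $g\in M^1(\mathbb{R})$ if $\int\int|V_fg(x,w)|\,dx\,dw<\infty$ for some nonzero Schwartz function $f$, where $V_fg(x,w)=\int g(t)f(x-t)e^{2\pi i wt}dt$. For $h>0$, $V_h(g)=\{\sum_k d_k g(\cdot-hk):(d_k)\in\ell^2(\mathbb{Z})\}$, and $g$ is a stable generator for $V_h(g)$ if $\{g(\cdot-hk):k\in\mathbb{Z}\}$ is a Riesz basis of $V_h(g)$. A frame for $L^2(\mathbb{R})$ is a family $\{f_j\}$ with $A\|f\|^2\le\sum_j|\langle f,f_j\rangle|^2\le B\|f\|^2$ for some $0<A\le B$ and all $f$. *)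

theory Defs
  imports "HOL-Analysis.Analysis"
begin

fun nth_deriv :: "nat \<Rightarrow> (real \<Rightarrow> complex) \<Rightarrow> real \<Rightarrow> complex" where
  "nth_deriv 0 f = f"
| "nth_deriv (Suc n) f = (\<lambda>x. vector_derivative (nth_deriv n f) (at x))"

definition schwartz :: "(real \<Rightarrow> complex) \<Rightarrow> bool" where
  "schwartz f \<longleftrightarrow>
     (\<forall>n x. nth_deriv n f differentiable (at x)) \<and>
     (\<forall>m n. \<exists>C. \<forall>x. \<bar>x\<bar> ^ m * cmod (nth_deriv n f x) \<le> C)"

definition L2 :: "(real \<Rightarrow> complex) \<Rightarrow> bool" where
  "L2 f \<longleftrightarrow> f \<in> borel_measurable lborel \<and> integrable lborel (\<lambda>x. (cmod (f x))\<^sup>2)"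

definition l2_inner :: "(real \<Rightarrow> complex) \<Rightarrow> (real \<Rightarrow> complex) \<Rightarrow> complex" where
  "l2_inner f h = (LINT x|lborel. f x * cnj (h x))"

definition l2_norm2 :: "(real \<Rightarrow> complex) \<Rightarrow> real" where
  "l2_norm2 f = (LINT x|lborel. (cmod (f x))\<^sup>2)"

definition stft :: "(real \<Rightarrow> complex) \<Rightarrow> (real \<Rightarrow> complex) \<Rightarrow> real \<Rightarrow> real \<Rightarrow> complex" where
  "stft f g x w = (LINT t|lborel. g t * f (x - t) * cis (2 * pi * w * t))"

definition M1 :: "(real \<Rightarrow> complex) \<Rightarrow> bool" where
  "M1 g \<longleftrightarrow> L2 g \<and>
     (\<exists>f. schwartz f \<and> f \<noteq> (\<lambda>_. 0) \<and>
          integrable lborel (\<lambda>z::real \<times> real. stft f g (fst z) (snd z)))"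

definition is_frame :: "('i \<Rightarrow> real \<Rightarrow> complex) \<Rightarrow> bool" where
  "is_frame F \<longleftrightarrow> (\<forall>i. L2 (F i)) \<and>
     (\<exists>A B. 0 < A \<and> A \<le> B \<and>
        (\<forall>f. L2 f \<longrightarrow>
           (\<lambda>i. (cmod (l2_inner f (F i)))\<^sup>2) summable_on UNIV \<and>
           A * l2_norm2 f \<le> (\<Sum>\<^sub>\<infinity>i. (cmod (l2_inner f (F i)))\<^sup>2) \<and>
           (\<Sum>\<^sub>\<infinity>i. (cmod (l2_inner f (F i)))\<^sup>2) \<le> B * l2_norm2 f))"

definition gabor :: "(real \<Rightarrow> complex) \<Rightarrow> real \<Rightarrow> real \<Rightarrow> int \<times> int \<Rightarrow> real \<Rightarrow> complex" where
  "gabor g a b = (\<lambda>(l, j) t. cis (2 * pi * b * of_int j * t) * g (t - a * of_int l))"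

text \<open>g is a stable generator for V_h(g): the translates g(. - h k) form a Riesz basis of
  V_h(g), i.e. they satisfy the Riesz bounds (checked on finitely supported coefficients).\<close>
definition stable_generator :: "(real \<Rightarrow> complex) \<Rightarrow> real \<Rightarrow> bool" where
  "stable_generator g h \<longleftrightarrow>
     (\<exists>A B. 0 < A \<and> A \<le> B \<and>
        (\<forall>(K::int set) (d::int \<Rightarrow> complex). finite K \<longrightarrow>
           A * (\<Sum>k\<in>K. (cmod (d k))\<^sup>2) \<le> l2_norm2 (\<lambda>t. \<Sum>k\<in>K. d k * g (t - h * of_int k)) \<and>
           l2_norm2 (\<lambda>t. \<Sum>k\<in>K. d k * g (t - h * of_int k)) \<le> B * (\<Sum>k\<in>K. (cmod (d k))\<^sup>2)))"

definition Phi :: "(real \<Rightarrow> complex) \<Rightarrow> real \<Rightarrow> real \<Rightarrow> nat \<Rightarrow> real \<Rightarrow> real \<Rightarrow> nat \<Rightarrow> nat \<Rightarrow> complex" where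
  "Phi g a b q x t s n =
     (\<Sum>\<^sub>\<infinity>k::int. g (x + a * real q * of_int k + a * real s - real n / b) * cis (2 * pi * of_int k * t))"

definition lin_indep_columns :: "nat \<Rightarrow> nat \<Rightarrow> (nat \<Rightarrow> nat \<Rightarrow> complex) \<Rightarrow> bool" where
  "lin_indep_columns q p M \<longleftrightarrow>
     (\<forall>c::nat \<Rightarrow> complex. (\<forall>s<q. (\<Sum>n<p. M s n * c n) = 0) \<longrightarrow> (\<forall>n<p. c n = 0))"

end

theory Submission
  imports Defs "HOL-Probability.Characteristic_Functions" "HOL-Probability.Sinc_Integral"
begin

text \<open>
  Fourier inversion bounds \<open>\<bar>g t\<bar> \<bar>f (x - t)\<bar>\<close> by the integral of \<open>\<bar>V x w\<bar>\<close> over \<open>w\<close>, so the local suprema of a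
  continuous \<open>g\<close> in the Feichtinger algebra are summable along every lattice. For a continuous
  compactly supported \<open>f\<close>, Parseval on a period of length \<open>1 / b\<close> turns the frame sum into an
  integral over \<open>x\<close> of \<open>\<Sum>l. \<bar>\<Sum>n. f (x - n / b) cnj (g (x - n / b - a l))\<bar>\<^sup>2\<close>. Because \<open>ab\<close> is rational, this
  fiber sum is block Toeplitz, and a second use of Parseval identifies its symbol with \<open>\<Phi>\<close>.

  If \<open>\<Phi>\<close> is injective everywhere, compactness gives uniform bounds for the symbol, hence frame
  bounds on a dense subspace and so on \<open>L\<^sup>2\<close>. Conversely, functions concentrated near a fiber \<open>x\<close>
  with coefficients concentrated near a frequency \<open>t\<close> carry the lower frame bound over to \<open>\<Phi> x t\<close>,
  by continuity of the symbol.
\<close>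

section \<open>Trigonometric approximation and Parseval\<close>

text \<open>The claim concerns single values of \<open>Phi\<close>, which almost-everywhere
  identities between L2 functions cannot see. Locally uniform absolute summability over lattices is
  what repairs this: it makes \<open>Phi\<close>, the fiber sums and the symbol continuous, so that
  an inequality between integrals can be brought down to a point, and injectivity at each point can
  be made uniform. Compact support makes every periodization a locally finite sum, so Parseval is
  needed only for continuous periodic functions. Rationality enters as \<open>p / b = a q\<close>:
  raising the fiber index by \<open>p\<close> and raising the translation index by \<open>q\<close>
  displace the argument of \<open>g\<close> equally. At each frequency this leaves \<open>p\<close>
  unknown trigonometric polynomials and \<open>q\<close> equations, the columns and rows of
  \<open>Phi\<close>. Coefficient families are finite, so the available weights in frequency are
  squared moduli of trigonometric polynomials; concentrating such a weight near one frequency is why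
  uniform trigonometric approximation is needed a second time, after Parseval.\<close>

definition wave :: "real \<Rightarrow> int \<Rightarrow> real \<Rightarrow> complex" where
  "wave T j t = cis (2 * pi * of_int j * t / T)"

lemma wave_0 [simp]: "wave T 0 t = 1"
  by (simp add: wave_def)

lemma wave_mult: "wave T j t * wave T k t = wave T (j + k) t"
  by (simp add: wave_def cis_mult algebra_simps add_divide_distrib)

lemma cnj_wave: "cnj (wave T j t) = wave T (- j) t"
  by (simp add: wave_def cis_cnj)

lemma norm_wave [simp]: "cmod (wave T j t) = 1"
  by (simp add: wave_def)

lemma continuous_on_wave [continuous_intros]:
  "continuous_on S f \<Longrightarrow> continuous_on S (\<lambda>x. wave T j (f x))"
  unfolding wave_def cis_conv_exp divide_inverse by (intro continuous_intros)

lemma cis_2pi_int: "cis (2 * pi * of_int k) = 1"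
  by (metis cis_multiple_2pi Ints_of_int)

lemma wave_periodic:
  assumes "T \<noteq> 0"
  shows "wave T j (t + T * of_int k) = wave T j t"
proof -
  have "2 * pi * of_int j * (t + T * of_int k) / T = 2 * pi * of_int j * t / T + 2 * pi * of_int (j * k)"
    using assms by (simp add: field_simps)
  then show ?thesis
    by (metis cis_2pi_int cis_mult mult.right_neutral wave_def)
qed

lemma has_integral_wave:
  assumes T: "T > 0"
  shows "(wave T j has_integral (if j = 0 then of_real T else 0)) {w..w + T}"
proof (cases "j = 0")
  case True
  have "((\<lambda>x. 1 :: complex) has_integral measure lborel {w..w + T} *\<^sub>R 1) {w..w + T}"
    by (rule has_integral_const_real)
  with True T show ?thesis
    by (simp add: wave_def[abs_def] scaleR_conv_of_real)
next
  case False
  define c :: complex where "c = \<i> * of_real (2 * pi * of_int j / T)"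
  have c: "c \<noteq> 0" using False T by (simp add: c_def)
  have E: "wave T j t = exp (c * of_real t)" for t
    by (simp add: wave_def cis_conv_exp c_def field_simps)
  have "((\<lambda>t. exp (c * of_real t)) has_integral (exp (c * of_real (w + T)) / c - exp (c * of_real w) / c)) {w..w + T}"
  proof (rule fundamental_theorem_of_calculus)
    show "w \<le> w + T" using T by simp
    fix x
    have "((\<lambda>z. exp (c * z) / c) has_field_derivative exp (c * of_real x)) (at (of_real x))"
      using c by (auto intro!: derivative_eq_intros)
    then show "((\<lambda>t. exp (c * complex_of_real t) / c) has_vector_derivative exp (c * of_real x)) (at x within {w..w + T})"
      by (rule has_vector_derivative_real_field)
  qed
  moreover have "exp (c * of_real (w + T)) = exp (c * of_real w)"
    using wave_periodic[of T j w 1] T unfolding E by simp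
  ultimately show ?thesis
    using False by (simp add: E[abs_def])
qed

definition trig_poly :: "real \<Rightarrow> (real \<Rightarrow> complex) \<Rightarrow> bool" where
  "trig_poly T F \<longleftrightarrow> (\<exists>J a. finite J \<and> F = (\<lambda>t. \<Sum>j\<in>J. a j * wave T j t))"

lemma trig_poly_monom: "trig_poly T (\<lambda>t. c * wave T j t)"
  unfolding trig_poly_def by (rule exI[of _ "{j}"], rule exI[of _ "\<lambda>_. c"]) auto

lemma trig_poly_const: "trig_poly T (\<lambda>t. c)"
  using trig_poly_monom[of T c 0] by simp

lemma trig_poly_add:
  assumes "trig_poly T F" "trig_poly T G"
  shows "trig_poly T (\<lambda>t. F t + G t)"
proof -
  obtain J a K b where *: "finite J" "F = (\<lambda>t. \<Sum>j\<in>J. a j * wave T j t)"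
    "finite K" "G = (\<lambda>t. \<Sum>j\<in>K. b j * wave T j t)"
    using assms by (auto simp: trig_poly_def)
  define d where "d j = (if j \<in> J then a j else 0) + (if j \<in> K then b j else 0)" for j
  have "F t = (\<Sum>j\<in>J\<union>K. (if j \<in> J then a j else 0) * wave T j t)" for t
    using * by (auto intro!: sum.mono_neutral_cong_left)
  moreover have "G t = (\<Sum>j\<in>J\<union>K. (if j \<in> K then b j else 0) * wave T j t)" for t
    using * by (auto intro!: sum.mono_neutral_cong_left)
  ultimately have "(\<lambda>t. F t + G t) = (\<lambda>t. \<Sum>j\<in>J\<union>K. d j * wave T j t)"
    by (auto simp: d_def sum.distrib distrib_right)
  with * show ?thesis unfolding trig_poly_def by (metis finite_UnI)
qed

lemma trig_poly_sum:
  "(\<And>i. i \<in> I \<Longrightarrow> trig_poly T (F i)) \<Longrightarrow> trig_poly T (\<lambda>t. \<Sum>i\<in>I. F i t)"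
  by (induction I rule: infinite_finite_induct) (auto intro: trig_poly_add trig_poly_const)

lemma trig_poly_mult:
  assumes "trig_poly T F" "trig_poly T G"
  shows "trig_poly T (\<lambda>t. F t * G t)"
proof -
  obtain J a K b where *: "F = (\<lambda>t. \<Sum>j\<in>J. a j * wave T j t)" "G = (\<lambda>t. \<Sum>j\<in>K. b j * wave T j t)"
    using assms by (auto simp: trig_poly_def)
  have "(\<lambda>t. F t * G t) = (\<lambda>t. \<Sum>j\<in>J. \<Sum>k\<in>K. (a j * b k) * wave T (j + k) t)"
    by (simp add: * sum_product mult_ac flip: wave_mult)
  then show ?thesis
    by (simp only:) (intro trig_poly_sum trig_poly_monom)
qed

text \<open>Only the linear case has content: a real-linear functional takes the value
  \<open>cos s * f 1 + sin s * f \<i>\<close> at \<open>cis s\<close>, and Euler's formulas turn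
  this into a combination of the waves of index 1 and -1. Constants, sums and products are covered
  by the closure rules.\<close>

lemma trig_poly_real_polynomial:
  assumes "real_polynomial_function f"
  shows "trig_poly T (\<lambda>t. complex_of_real (f (cis (2 * pi * t / T))))"
  using assms
proof (induction rule: real_polynomial_function.induct)
  case (linear f)
  interpret bounded_linear f by fact
  have "complex_of_real (f (cis s)) = of_real (f 1) * ((cis s + cis (-s)) / 2) + of_real (f \<i>) * ((cis s - cis (-s)) * (-\<i> / 2))" for s
  proof -
    have "cis s = cos s *\<^sub>R 1 + sin s *\<^sub>R \<i>"
      by (auto simp: complex_eq_iff)
    then have "f (cis s) = cos s * f 1 + sin s * f \<i>"
      by (simp only: add scaleR) simp
    moreover have "(cis s + cis (-s)) / 2 = of_real (cos s)" "(cis s - cis (-s)) * (-\<i> / 2) = of_real (sin s)"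
      by (auto simp: complex_eq_iff)
    ultimately show ?thesis by simp
  qed
  then have "(\<lambda>t. complex_of_real (f (cis (2 * pi * t / T)))) = 
     (\<lambda>t. (of_real (f 1) / 2 - \<i> * of_real (f \<i>) / 2) * wave T 1 t + (of_real (f 1) / 2 + \<i> * of_real (f \<i>) / 2) * wave T (-1) t)"
    by (simp only:) (simp add: wave_def field_simps)
  then show ?case by (simp add: trig_poly_add trig_poly_monom)
qed (auto intro: trig_poly_const trig_poly_add trig_poly_mult)

lemma periodic_int:
  fixes F :: "real \<Rightarrow> 'a"
  assumes per: "\<And>t. F (t + T) = F t"
  shows "F (t + T * of_int k) = F t"
proof (induction k rule: int_induct[of _ 0])
  case base then show ?case by simp
next
  case (step1 i)
  then show ?case using per[of "t + T * of_int i"] by (simp add: algebra_simps)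
next
  case (step2 i)
  then show ?case using per[of "t + T * of_int (i - 1)"] by (simp add: algebra_simps)
qed

text \<open>Polynomials in the two real coordinates of the plane become trigonometric polynomials on
  the unit circle, so Stone-Weierstrass on the circle suffices, applied to the real and imaginary
  parts with error \<open>e/2\<close> each.\<close>

lemma trig_approximation:
  fixes F :: "real \<Rightarrow> complex"
  assumes T: "T > 0" and F: "continuous_on UNIV F" and per: "\<And>t. F (t + T) = F t" and e: "e > 0"
  obtains P where "trig_poly T P" "\<And>t. cmod (F t - P t) < e"
proof -
  text \<open>Read as a function on the unit circle, \<open>F\<close> is continuous: \<open>Arg\<close> and \<open>Arg2pi\<close> have their
    branch cuts on opposite half-lines.\<close>
  define G where "G z = F (T * Arg2pi z / (2 * pi))" for z
  have Arg2pi_cis: "Arg2pi (cis s) = s + 2 * pi * of_int (- \<lfloor>s / (2 * pi)\<rfloor>)" for s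
  proof (rule Arg2pi_unique[of 1])
    show "complex_of_real 1 * exp (\<i> * complex_of_real (s + 2 * pi * of_int (- \<lfloor>s / (2 * pi)\<rfloor>))) = cis s"
      by (metis cis_2pi_int cis_conv_exp cis_mult mult.right_neutral mult.left_neutral of_real_1)
    have "of_int \<lfloor>s / (2 * pi)\<rfloor> \<le> s / (2 * pi)" "s / (2 * pi) < of_int \<lfloor>s / (2 * pi)\<rfloor> + 1"
      by linarith+
    then have "of_int \<lfloor>s / (2 * pi)\<rfloor> * (2 * pi) \<le> s" "s < (of_int \<lfloor>s / (2 * pi)\<rfloor> + 1) * (2 * pi)"
      by (simp_all only: pos_le_divide_eq pos_divide_less_eq pi_gt_zero zero_less_mult_iff zero_less_numeral simp_thms)
    then show "0 \<le> s + 2 * pi * of_int (- \<lfloor>s / (2 * pi)\<rfloor>)" "s + 2 * pi * of_int (- \<lfloor>s / (2 * pi)\<rfloor>) < 2 * pi"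
      by (simp_all add: algebra_simps)
  qed simp
  have Gcis: "G (cis (2 * pi * t / T)) = F t" for t
  proof -
    have "G (cis (2 * pi * t / T)) = F (T * (2 * pi * t / T + 2 * pi * of_int (- \<lfloor>2 * pi * t / T / (2 * pi)\<rfloor>)) / (2 * pi))"
      by (simp only: G_def Arg2pi_cis)
    also have "T * (2 * pi * t / T + 2 * pi * of_int (- \<lfloor>2 * pi * t / T / (2 * pi)\<rfloor>)) / (2 * pi) = t + T * of_int (- \<lfloor>2 * pi * t / T / (2 * pi)\<rfloor>)"
      using T by (simp add: field_simps)
    also have "F \<dots> = F t" using periodic_int[of F T] per by blast
    finally show ?thesis .
  qed
  have GArg: "G z = F (T * Arg z / (2 * pi))" if "z \<in> sphere 0 1" for z
  proof -
    have "z = cis (Arg z)"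
      using that by (subst Complex.cis_Arg) (auto simp: sgn_eq)
    then show ?thesis using Gcis[of "T * Arg z / (2 * pi)"] T by simp
  qed
  have contG: "continuous_on (sphere 0 1) G"
    unfolding continuous_on_eq_continuous_within
  proof
    fix z :: complex assume z: "z \<in> sphere 0 1"
    have cF: "continuous (at x) F" for x
      using F by (simp add: continuous_on_eq_continuous_at)
    show "continuous (at z within sphere 0 1) G"
    proof (cases "z \<in> \<real>\<^sub>\<le>\<^sub>0")
      case False
      have "(Arg \<longlongrightarrow> Arg z) (at z within sphere 0 1)"
        using continuous_within_Arg[OF False] continuous_within by blast
      then have "((\<lambda>z. F (T * Arg z / (2 * pi))) \<longlongrightarrow> F (T * Arg z / (2 * pi))) (at z within sphere 0 1)"
        by (intro isCont_tendsto_compose[OF cF] tendsto_intros) (use False in auto)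
      then have "continuous (at z within sphere 0 1) (\<lambda>z. F (T * Arg z / (2 * pi)))"
        by (simp add: continuous_within)
      then show ?thesis
        by (rule continuous_transform_within[where \<delta> = 1]) (use z GArg in auto)
    next
      case True
      then have "z \<notin> \<real>\<^sub>\<ge>\<^sub>0"
        using z by (auto simp: complex_nonpos_Reals_iff complex_nonneg_Reals_iff cmod_def)
      then have "(Arg2pi \<longlongrightarrow> Arg2pi z) (at z within sphere 0 1)"
        using continuous_at_imp_continuous_within[OF continuous_at_Arg2pi] continuous_within by blast
      then have "((\<lambda>z. F (T * Arg2pi z / (2 * pi))) \<longlongrightarrow> F (T * Arg2pi z / (2 * pi))) (at z within sphere 0 1)"
        by (intro isCont_tendsto_compose[OF cF] tendsto_intros) auto
      then show ?thesis by (simp add: G_def[abs_def] continuous_within)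
    qed
  qed
  have "continuous_on (sphere 0 1) (\<lambda>z. Re (G z))" "continuous_on (sphere 0 1) (\<lambda>z. Im (G z))"
    using contG by (auto intro: continuous_intros)
  then obtain p q where pq: "real_polynomial_function p" "\<And>z. z \<in> sphere 0 1 \<Longrightarrow> \<bar>Re (G z) - p z\<bar> < e/2"
     "real_polynomial_function q" "\<And>z. z \<in> sphere 0 1 \<Longrightarrow> \<bar>Im (G z) - q z\<bar> < e/2"
    using Stone_Weierstrass_real_polynomial_function[of "sphere 0 1"] e
    by (metis compact_sphere half_gt_zero)
  define P where "P t = complex_of_real (p (cis (2 * pi * t / T))) + \<i> * complex_of_real (q (cis (2 * pi * t / T)))" for t
  have "trig_poly T P" unfolding P_def
    by (intro trig_poly_add trig_poly_mult trig_poly_const trig_poly_real_polynomial pq)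
  moreover have "cmod (F t - P t) < e" for t
  proof -
    have "cmod (F t - P t) \<le> \<bar>Re (F t - P t)\<bar> + \<bar>Im (F t - P t)\<bar>" by (rule cmod_le)
    also have "\<dots> < e/2 + e/2"
      using pq(2)[of "cis (2 * pi * t / T)"] pq(4)[of "cis (2 * pi * t / T)"]
      by (intro add_strict_mono) (auto simp: P_def Gcis)
    finally show ?thesis by simp
  qed
  ultimately show ?thesis using that by blast
qed

text \<open>Expanding the square, using orthogonality of the waves (each of square norm
  \<open>T\<close>) and completing the square in the coefficients. Since the coefficients
  \<open>a\<close> are arbitrary, the identity yields both Bessel's inequality and the
  best-approximation property of the Fourier coefficients.\<close>

lemma integral_norm_diff_trig:
  fixes F :: "real \<Rightarrow> complex" and T w :: real
  assumes T: "T > 0" and F: "continuous_on {w..w + T} F" and J: "finite J"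
  defines "c \<equiv> \<lambda>j. integral {w..w + T} (\<lambda>t. F t * cnj (wave T j t))"
  shows "integral {w..w + T} (\<lambda>t. (cmod (F t - (\<Sum>j\<in>J. a j * wave T j t)))\<^sup>2) =
    integral {w..w + T} (\<lambda>t. (cmod (F t))\<^sup>2) - (\<Sum>j\<in>J. (cmod (c j))\<^sup>2) / T
      + T * (\<Sum>j\<in>J. (cmod (a j - c j / T))\<^sup>2)"
proof -
  let ?S = "{w..w + T}"
  define I where "I = integral ?S (\<lambda>t. (cmod (F t))\<^sup>2)"
  have c: "((\<lambda>t. F t * cnj (wave T j t)) has_integral c j) ?S" for j
    unfolding c_def by (intro integrable_integral integrable_continuous_real continuous_intros F)
  have c': "((\<lambda>t. cnj (F t) * wave T j t) has_integral cnj (c j)) ?S" for j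
    using has_integral_cnj[THEN iffD2, OF c[of j]] by (simp add: comp_def)
  have I0: "((\<lambda>t. (cmod (F t))\<^sup>2) has_integral I) ?S"
    unfolding I_def by (intro integrable_integral integrable_continuous_real continuous_intros F)
  then have I: "((\<lambda>t. F t * cnj (F t)) has_integral of_real I) ?S"
    using has_integral_linear[OF _ bounded_linear_of_real, of "\<lambda>t. (cmod (F t))\<^sup>2" I ?S]
    by (simp add: complex_norm_square[symmetric] comp_def)
  have orth: "((\<lambda>t. wave T j t * wave T (-k) t) has_integral (if j = k then of_real T else 0)) ?S" for j k
    using has_integral_wave[OF T, of "j - k" w] by (simp add: wave_mult)
  have "((\<lambda>t. F t * cnj (F t) - (\<Sum>j\<in>J. cnj (a j) * (F t * cnj (wave T j t))) - (\<Sum>j\<in>J. a j * (cnj (F t) * wave T j t))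
     + (\<Sum>j\<in>J. \<Sum>k\<in>J. a j * cnj (a k) * (wave T j t * wave T (-k) t))) has_integral
     (of_real I - (\<Sum>j\<in>J. cnj (a j) * c j) - (\<Sum>j\<in>J. a j * cnj (c j)) + 
        (\<Sum>j\<in>J. \<Sum>k\<in>J. a j * cnj (a k) * (if j = k then of_real T else 0)))) ?S" (is "(?f has_integral ?v) _")
    by (intro has_integral_add has_integral_diff has_integral_sum has_integral_mult_right J I c c' orth)
  also have "?f = (\<lambda>t. of_real ((cmod (F t - (\<Sum>j\<in>J. a j * wave T j t)))\<^sup>2))"
  proof
    fix t
    let ?P = "\<Sum>j\<in>J. a j * wave T j t"
    have "(\<Sum>j\<in>J. \<Sum>k\<in>J. a j * cnj (a k) * (wave T j t * wave T (-k) t)) = ?P * cnj ?P"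
      by (simp add: sum_product cnj_wave mult_ac)
    moreover have "(\<Sum>j\<in>J. cnj (a j) * (F t * cnj (wave T j t))) = F t * cnj ?P"
      by (simp add: sum_distrib_left mult_ac)
    moreover have "(\<Sum>j\<in>J. a j * (cnj (F t) * wave T j t)) = cnj (F t) * ?P"
      by (simp add: sum_distrib_left mult_ac)
    moreover have "x * cnj x - x * y - cnj x * z + z * y = (x - z) * (cnj x - y)" for x y z
      by (simp add: algebra_simps)
    ultimately show "?f t = of_real ((cmod (F t - ?P))\<^sup>2)"
      unfolding complex_norm_square complex_cnj_diff by (simp only:)
  qed
  also have "?v = of_real I - (\<Sum>j\<in>J. cnj (a j) * c j) - (\<Sum>j\<in>J. a j * cnj (c j)) + (\<Sum>j\<in>J. a j * cnj (a j) * T)"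
    using J by (simp add: if_distrib sum.delta cong: if_cong)
  also have "\<dots> = of_real (I - (\<Sum>j\<in>J. (cmod (c j))\<^sup>2) / T + T * (\<Sum>j\<in>J. (cmod (a j - c j / T))\<^sup>2))"
  proof -
    have "- (cnj (a j) * c j) - a j * cnj (c j) + a j * cnj (a j) * T =
        of_real (T * (cmod (a j - c j / T))\<^sup>2 - (cmod (c j))\<^sup>2 / T)" for j
      unfolding of_real_diff of_real_mult of_real_divide complex_norm_square
      using T by (simp add: field_simps)
    then have "(\<Sum>j\<in>J. - (cnj (a j) * c j) - a j * cnj (c j) + a j * cnj (a j) * T) =
        of_real (\<Sum>j\<in>J. T * (cmod (a j - c j / T))\<^sup>2 - (cmod (c j))\<^sup>2 / T)"
      by simp
    then show ?thesis
      by (simp add: sum_distrib_left sum_divide_distrib sum_subtractf sum.distrib sum_negf algebra_simps)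
  qed
  finally have "((\<lambda>t. of_real ((cmod (F t - (\<Sum>j\<in>J. a j * wave T j t)))\<^sup>2) :: complex) has_integral
     of_real (I - (\<Sum>j\<in>J. (cmod (c j))\<^sup>2) / T + T * (\<Sum>j\<in>J. (cmod (a j - c j / T))\<^sup>2))) ?S" .
  from has_integral_linear[OF this bounded_linear_Re]
  show ?thesis by (simp add: comp_def I_def integral_unique)
qed

theorem parseval:
  fixes F :: "real \<Rightarrow> complex" and T w :: real
  assumes T: "T > 0" and F: "continuous_on UNIV F" and per: "\<And>t. F (t + T) = F t"
  shows "((\<lambda>j. (cmod (integral {w..w + T} (\<lambda>t. F t * cnj (wave T j t))))\<^sup>2) has_sum
     T * integral {w..w + T} (\<lambda>t. (cmod (F t))\<^sup>2)) UNIV"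
proof -
  let ?S = "{w..w + T}"
  define c where "c j = integral {w..w + T} (\<lambda>t. F t * cnj (wave T j t))" for j
  define I where "I = integral ?S (\<lambda>t. (cmod (F t))\<^sup>2)"
  have F': "continuous_on ?S F" using F continuous_on_subset by blast
  have bessel: "(\<Sum>j\<in>J. (cmod (c j))\<^sup>2) \<le> T * I" if "finite J" for J
  proof -
    \<comment> \<open>The choice \<open>a j = c j / T\<close> makes the last term of the identity
      vanish, which leaves exactly Bessel's inequality.\<close>
    have "0 \<le> integral ?S (\<lambda>t. (cmod (F t - (\<Sum>j\<in>J. (c j / T) * wave T j t)))\<^sup>2)"
    proof (rule integral_nonneg)
      have "T \<noteq> 0" using T by simp
      then show "(\<lambda>t. (cmod (F t - (\<Sum>j\<in>J. (c j / T) * wave T j t)))\<^sup>2) integrable_on ?S"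
        by (intro integrable_continuous_real continuous_intros F') auto
    qed simp
    also have "\<dots> = I - (\<Sum>j\<in>J. (cmod (c j))\<^sup>2) / T"
      by (subst integral_norm_diff_trig[OF T F' that]) (simp add: I_def c_def)
    finally show ?thesis using T by (simp add: field_simps)
  qed
  have "(\<lambda>j. (cmod (c j))\<^sup>2) summable_on UNIV"
    using bessel by (intro nonneg_bdd_above_summable_on) (auto simp: bdd_above_def)
  then have hs: "((\<lambda>j. (cmod (c j))\<^sup>2) has_sum (\<Sum>\<^sub>\<infinity>j. (cmod (c j))\<^sup>2)) UNIV"
    by simp
  have "(\<Sum>\<^sub>\<infinity>j. (cmod (c j))\<^sup>2) \<le> T * I"
    by (rule has_sum_le_finite_sums[OF hs]) (rule bessel)
  moreover have "T * I \<le> (\<Sum>\<^sub>\<infinity>j. (cmod (c j))\<^sup>2) + e" if e: "e > 0" for e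
  proof -
    \<comment> \<open>Chosen so that the final error \<open>T * (T * d\<^sup>2)\<close> is
      \<open>e\<close>.\<close>
    define d where "d = sqrt e / T"
    have d: "d > 0" using e T by (simp add: d_def)
    obtain P where P: "trig_poly T P" "\<And>t. cmod (F t - P t) < d"
      using trig_approximation[OF T F per d] by blast
    then obtain J a where J: "finite J" "P = (\<lambda>t. \<Sum>j\<in>J. a j * wave T j t)"
      by (auto simp: trig_poly_def)
    \<comment> \<open>Best approximation: passing from the Fourier coefficients to those of
      \<open>P\<close> can only increase the error, so the uniform bound for \<open>P\<close> also
      controls the Bessel defect.\<close>
    have "I - (\<Sum>j\<in>J. (cmod (c j))\<^sup>2) / T \<le> I - (\<Sum>j\<in>J. (cmod (c j))\<^sup>2) / T + T * (\<Sum>j\<in>J. (cmod (a j - c j / T))\<^sup>2)"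
      using T by (simp add: sum_nonneg)
    also have "\<dots> = integral ?S (\<lambda>t. (cmod (F t - P t))\<^sup>2)"
      unfolding J(2) by (subst integral_norm_diff_trig[OF T F' J(1)]) (simp add: I_def c_def)
    also have "\<dots> \<le> integral ?S (\<lambda>t. d\<^sup>2)"
    proof (rule integral_le)
      show "(\<lambda>t. (cmod (F t - P t))\<^sup>2) integrable_on ?S" unfolding J(2)
        by (intro integrable_continuous_real continuous_intros F')
      show "(cmod (F t - P t))\<^sup>2 \<le> d\<^sup>2" for t
        by (rule power_mono[OF less_imp_le[OF P(2)]]) simp
    qed (intro integrable_continuous_real continuous_intros)
    also have "\<dots> = T * d\<^sup>2" using T by simp
    finally have "T * I \<le> (\<Sum>j\<in>J. (cmod (c j))\<^sup>2) + T * (T * d\<^sup>2)"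
      using T by (simp add: field_simps)
    also have "T * (T * d\<^sup>2) = e" using T e by (simp add: d_def power_divide power2_eq_square)
    also have "(\<Sum>j\<in>J. (cmod (c j))\<^sup>2) \<le> (\<Sum>\<^sub>\<infinity>j. (cmod (c j))\<^sup>2)"
      by (rule finite_sum_le_has_sum[OF hs J(1)]) auto
    finally show ?thesis by simp
  qed
  ultimately have "(\<Sum>\<^sub>\<infinity>j. (cmod (c j))\<^sup>2) = T * I"
    by (meson antisym field_le_epsilon)
  with hs show ?thesis by (simp add: c_def I_def)
qed

section \<open>Periodization and Wiener amalgam bounds\<close>

lemma has_sum_sum_left:
  fixes f :: "'i \<Rightarrow> 'a \<Rightarrow> 'b::{topological_comm_monoid_add}"
  assumes "\<And>i. i \<in> I \<Longrightarrow> (f i has_sum s i) A"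
  shows "((\<lambda>x. \<Sum>i\<in>I. f i x) has_sum (\<Sum>i\<in>I. s i)) A"
  using assms by (induction I rule: infinite_finite_induct) (auto intro: has_sum_add)

lemma continuous_on_has_sum:
  fixes f :: "'i \<Rightarrow> 'b::topological_space \<Rightarrow> 'c::banach"
  assumes "\<And>i. continuous_on Y (f i)" "\<And>i x. x \<in> Y \<Longrightarrow> norm (f i x) \<le> M i"
    "M summable_on UNIV" "\<And>x. x \<in> Y \<Longrightarrow> ((\<lambda>i. f i x) has_sum S x) UNIV"
  shows "continuous_on Y S"
proof (rule uniform_limit_theorem)
  show "uniform_limit Y (\<lambda>X y. \<Sum>x\<in>X. f x y) S (finite_subsets_at_top UNIV)"
    by (rule Weierstrass_m_test_general') (use assms in auto)
qed (auto intro!: always_eventually continuous_intros assms)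

lemma has_sum_integral:
  fixes f :: "'i \<Rightarrow> real \<Rightarrow> 'c::banach"
  assumes "\<And>i. continuous_on {u..v} (f i)" "\<And>i x. x \<in> {u..v} \<Longrightarrow> norm (f i x) \<le> M i"
    "M summable_on UNIV" "\<And>x. x \<in> {u..v} \<Longrightarrow> ((\<lambda>i. f i x) has_sum S x) UNIV"
  shows "((\<lambda>i. integral {u..v} (f i)) has_sum integral {u..v} S) UNIV"
proof -
  have "uniform_limit {u..v} (\<lambda>X y. \<Sum>x\<in>X. f x y) S (finite_subsets_at_top UNIV)"
    by (rule Weierstrass_m_test_general') (use assms in auto)
  moreover have "continuous_on {u..v} (\<lambda>y. \<Sum>x\<in>X. f x y)" for X
    by (intro continuous_intros assms)
  ultimately obtain I J where
    *: "\<And>X. ((\<lambda>y. \<Sum>x\<in>X. f x y) has_integral I X) {u..v}" "(S has_integral J) {u..v}"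
    "(I \<longlongrightarrow> J) (finite_subsets_at_top UNIV)"
    by (rule uniform_limit_integral) auto
  have "I X = (\<Sum>i\<in>X. integral {u..v} (f i))" if "finite X" for X
  proof -
    have "I X = integral {u..v} (\<lambda>y. \<Sum>x\<in>X. f x y)"
      by (rule integral_unique[OF *(1), symmetric])
    also have "\<dots> = (\<Sum>i\<in>X. integral {u..v} (f i))"
      using that by (intro Henstock_Kurzweil_Integration.integral_sum integrable_continuous_real assms)
    finally show ?thesis .
  qed
  then have "eventually (\<lambda>X. I X = (\<Sum>i\<in>X. integral {u..v} (f i))) (finite_subsets_at_top UNIV)"
    by (auto simp: eventually_finite_subsets_at_top)
  with *(3) have "((\<lambda>X. \<Sum>i\<in>X. integral {u..v} (f i)) \<longlongrightarrow> J) (finite_subsets_at_top UNIV)"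
    by (simp add: tendsto_cong)
  then show ?thesis
    using *(2) by (simp add: has_sum_def integral_unique)
qed

text \<open>Parseval starting from the coefficients: absolute summability makes the series
  continuous and allows termwise integration, so orthogonality recovers \<open>d\<close> as the
  Fourier coefficients of \<open>G\<close>. The window start \<open>w\<close> stays free so that
  later integrals can be centred at a chosen frequency.\<close>

lemma parseval_abs_summable:
  fixes d :: "int \<Rightarrow> complex"
  assumes d: "(\<lambda>k. cmod (d k)) summable_on UNIV"
    and G: "\<And>t. ((\<lambda>k. d k * wave 1 k t) has_sum G t) UNIV"
  shows "((\<lambda>k. (cmod (d k))\<^sup>2) has_sum integral {w..w + 1} (\<lambda>t. (cmod (G t))\<^sup>2)) UNIV"
    and "continuous_on UNIV G"
proof -
  show cont: "continuous_on UNIV G"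
    by (rule continuous_on_has_sum[where f = "\<lambda>k t. d k * wave 1 k t", OF _ _ d G])
       (auto intro!: continuous_intros simp: norm_mult)
  have per: "G (t + 1) = G t" for t
    using G[of t] G[of "t + 1"] wave_periodic[of 1 _ t 1] has_sum_unique by fastforce
  have "integral {w..w + 1} (\<lambda>t. G t * cnj (wave 1 j t)) = d j" for j
  proof -
    have "((\<lambda>k. integral {w..w + 1} (\<lambda>t. d k * wave 1 k t * cnj (wave 1 j t))) has_sum
        integral {w..w + 1} (\<lambda>t. G t * cnj (wave 1 j t))) UNIV"
      by (rule has_sum_integral[OF _ _ d])
         (auto intro!: continuous_intros has_sum_cmult_left G simp: norm_mult)
    moreover have "integral {w..w + 1} (\<lambda>t. d k * wave 1 k t * cnj (wave 1 j t)) = (if k = j then d j else 0)" for k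
      using integral_unique[OF has_integral_mult_right[OF has_integral_wave[of 1 "k - j" w], of "d k"]]
      by (simp add: cnj_wave wave_mult mult.assoc del: integral_mult_right)
    ultimately have "((\<lambda>k. if k = j then d j else 0) has_sum
        integral {w..w + 1} (\<lambda>t. G t * cnj (wave 1 j t))) UNIV"
      by simp
    moreover have "((\<lambda>k. if k = j then d j else 0) has_sum d j) UNIV"
      by (rule has_sum_finite_neutralI[of "{j}"]) auto
    ultimately show ?thesis by (rule has_sum_unique)
  qed
  then show "((\<lambda>k. (cmod (d k))\<^sup>2) has_sum integral {w..w + 1} (\<lambda>t. (cmod (G t))\<^sup>2)) UNIV"
    using parseval[OF _ cont per, of w] by simp
qed

text \<open>Membership in the Wiener amalgam space of \<open>\<ell>\<^sup>1\<close> sums of local suprema.\<close>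
definition wiener :: "(real \<Rightarrow> complex) \<Rightarrow> bool" where
  "wiener g \<longleftrightarrow> (\<forall>\<alpha>>0. \<forall>R. \<exists>M::int \<Rightarrow> real. M summable_on UNIV \<and>
     (\<forall>k x. \<bar>x\<bar> \<le> R \<longrightarrow> cmod (g (x + \<alpha> * of_int k)) \<le> M k))"

text \<open>The cells of length \<alpha> tile the line, so the integrals of \<open>H\<close> over
  them sum to at most the whole integral. An interval of radius \<open>r\<close> around
  \<open>x + \<alpha> * k\<close> with \<open>x\<close> bounded by \<open>R\<close> meets a number
  of cells independent of \<open>k\<close>, so finitely many shifts of this summable sequence form a
  majorant.\<close>

lemma wienerI_integral:
  fixes H :: "real \<Rightarrow> real"
  assumes H: "integrable lborel H" "\<And>x. H x \<ge> 0"
    and g: "\<And>t. cmod (g t) \<le> (LINT s|lborel. indicator {t - r..t + r} s * H s)"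
  shows "wiener g"
  unfolding wiener_def
proof (intro allI impI)
  fix \<alpha> R :: real assume \<alpha>: "\<alpha> > 0"
  let ?i = "\<lambda>k::int. indicator {\<alpha> * of_int k..<\<alpha> * (of_int k + 1)} :: real \<Rightarrow> real"
  define v where "v k = (LINT s|lborel. ?i k s * H s)" for k
  have int: "integrable lborel (\<lambda>s. indicator A s * H s)" if "A \<in> sets borel" for A
    using integrable_mult_indicator[OF _ H(1), of A] that by simp
  have i: "?i k s = (if k = \<lfloor>s / \<alpha>\<rfloor> then 1 else 0)" for k s
  proof -
    have "s \<in> {\<alpha> * of_int k..<\<alpha> * (of_int k + 1)} \<longleftrightarrow> of_int k \<le> s / \<alpha> \<and> s / \<alpha> < of_int k + 1"
      using \<alpha> by (auto simp: field_simps)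
    also have "\<dots> \<longleftrightarrow> k = \<lfloor>s / \<alpha>\<rfloor>" by linarith
    finally show ?thesis by (simp add: indicator_def)
  qed
  have "(\<Sum>k\<in>K. v k) \<le> (LINT s|lborel. H s)" if "finite K" for K
  proof -
    have "(\<Sum>k\<in>K. v k) = (LINT s|lborel. (\<Sum>k\<in>K. ?i k s * H s))"
      unfolding v_def by (intro Bochner_Integration.integral_sum[symmetric] int) auto
    also have "\<dots> \<le> (LINT s|lborel. H s)"
    proof (intro integral_mono Bochner_Integration.integrable_sum int H)
      fix s
      have "(\<Sum>k\<in>K. ?i k s * H s) = (\<Sum>k\<in>K. if k = \<lfloor>s / \<alpha>\<rfloor> then H s else 0)"
        by (intro sum.cong) (auto simp: i)
      also have "\<dots> \<le> H s" using H(2)[of s] that by simp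
      finally show "(\<Sum>k\<in>K. ?i k s * H s) \<le> H s" .
    qed auto
    finally show ?thesis .
  qed
  moreover have v0: "v k \<ge> 0" for k unfolding v_def using H(2) by (intro integral_nonneg_AE) auto
  ultimately have v: "v summable_on UNIV"
    by (intro nonneg_bdd_above_summable_on) (auto simp: bdd_above_def)
  \<comment> \<open>The extra 1 pays for the rounding in the floor that names the cell of
    \<open>s\<close>.\<close>
  define I :: int where "I = \<lceil>(R + r) / \<alpha>\<rceil> + 1"
  define M where "M k = (\<Sum>i\<in>{-I..I}. v (k + i))" for k
  have "M summable_on UNIV"
  proof -
    have "((\<lambda>k. v (k + i)) has_sum infsum v UNIV) UNIV" for i
      by (subst has_sum_reindex_bij_witness[of _ "\<lambda>k. k - i" "\<lambda>k. k + i" UNIV v]) (use v in auto)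
    then show ?thesis unfolding M_def
      by (intro has_sum_imp_summable[OF has_sum_sum_left])
  qed
  moreover have "cmod (g (x + \<alpha> * of_int k)) \<le> M k" if x: "\<bar>x\<bar> \<le> R" for k x
  proof -
    let ?t = "x + \<alpha> * of_int k"
    have "cmod (g ?t) \<le> (LINT s|lborel. indicator {?t - r..?t + r} s * H s)" by (rule g)
    also have "\<dots> \<le> (LINT s|lborel. (\<Sum>i\<in>{-I..I}. ?i (k + i) s * H s))"
    proof (intro integral_mono Bochner_Integration.integrable_sum int)
      fix s
      show "indicator {?t - r..?t + r} s * H s \<le> (\<Sum>i\<in>{-I..I}. ?i (k + i) s * H s)"
      proof (cases "s \<in> {?t - r..?t + r}")
        case True
        have "\<bar>s - \<alpha> * of_int k\<bar> \<le> R + r" using True x by (auto simp: abs_le_iff)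
        then have "\<bar>s / \<alpha> - of_int k\<bar> \<le> (R + r) / \<alpha>"
          using \<alpha> by (simp add: field_simps abs_le_iff)
        then have *: "\<lfloor>s / \<alpha>\<rfloor> - k \<in> {-I..I}" unfolding I_def by (simp; linarith)
        have "indicator {?t - r..?t + r} s * H s = ?i (k + (\<lfloor>s / \<alpha>\<rfloor> - k)) s * H s"
          using True unfolding i by simp
        also have "\<dots> \<le> (\<Sum>i\<in>{-I..I}. ?i (k + i) s * H s)"
          by (rule member_le_sum[OF *]) (auto simp: H)
        finally show ?thesis .
      qed (auto intro!: sum_nonneg H mult_nonneg_nonneg)
    qed auto
    also have "\<dots> = M k"
      unfolding M_def v_def by (intro Bochner_Integration.integral_sum int) auto
    finally show ?thesis .
  qed
  ultimately show "\<exists>M. M summable_on UNIV \<and> (\<forall>k x. \<bar>x\<bar> \<le> R \<longrightarrow> cmod (g (x + \<alpha> * of_int k)) \<le> M k)"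
    by blast
qed

section \<open>Periodization of compactly supported functions\<close>

definition periodize :: "real \<Rightarrow> (real \<Rightarrow> 'a::euclidean_space) \<Rightarrow> real \<Rightarrow> 'a" where
  "periodize T h x = (\<Sum>\<^sub>\<infinity>n::int. h (x - T * of_int n))"

text \<open>\<open>J\<close> may be any finite superset of the relevant indices; hence one set
  serves a whole interval of points, and it can be enlarged to complete residue blocks
  later.\<close>

lemma periodize_eq_sum:
  assumes h: "\<And>y. R < \<bar>y\<bar> \<Longrightarrow> h y = 0" and J: "finite J" "\<And>n. \<bar>x - T * of_int n\<bar> \<le> R \<Longrightarrow> n \<in> J"
  shows "periodize T h x = (\<Sum>n\<in>J. h (x - T * of_int n))"
proof -
  have "periodize T h x = (\<Sum>\<^sub>\<infinity>n\<in>J. h (x - T * of_int n))"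
    unfolding periodize_def by (rule infsum_cong_neutral) (use h J in \<open>auto simp: not_less[symmetric]\<close>)
  with J show ?thesis by simp
qed

lemma ex_window:
  fixes T R u v :: real
  assumes T: "T > 0"
  obtains N :: nat where "N > 0" "\<And>x n. u \<le> x \<Longrightarrow> x \<le> v \<Longrightarrow> \<bar>x - T * of_int n\<bar> \<le> R \<Longrightarrow> n \<in> {- int N..<int N}"
proof -
  \<comment> \<open>The added 1 makes \<open>N\<close> positive and the upper end of the half-open
    index range strict.\<close>
  define N where "N = nat \<lceil>(\<bar>R\<bar> + \<bar>u\<bar> + \<bar>v\<bar>) / T\<rceil> + 1"
  have "n \<in> {- int N..<int N}" if "u \<le> x" "x \<le> v" "\<bar>x - T * of_int n\<bar> \<le> R" for x n
  proof -
    have "\<bar>T * of_int n\<bar> \<le> \<bar>R\<bar> + \<bar>u\<bar> + \<bar>v\<bar>" using that by linarith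
    then have "\<bar>of_int n :: real\<bar> \<le> (\<bar>R\<bar> + \<bar>u\<bar> + \<bar>v\<bar>) / T"
      using T by (simp add: abs_mult field_simps)
    then show ?thesis unfolding N_def by (simp; linarith)
  qed
  then show ?thesis by (intro that[of N]) (auto simp: N_def)
qed

lemma periodize_periodic: "periodize T h (x + T) = periodize T h x"
  unfolding periodize_def
  by (rule infsum_reindex_bij_witness[of _ "\<lambda>n. n + 1" "\<lambda>n. n - 1"]) (auto simp: algebra_simps)

lemma continuous_on_periodize:
  fixes h :: "real \<Rightarrow> 'a::euclidean_space"
  assumes T: "T > 0" and h: "continuous_on UNIV h" "\<And>y. R < \<bar>y\<bar> \<Longrightarrow> h y = 0"
  shows "continuous_on UNIV (periodize T h)"
proof -
  have "isCont (periodize T h) x" for x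
  proof -
    obtain N :: nat where N: "\<And>y n. x - 1 \<le> y \<Longrightarrow> y \<le> x + 1 \<Longrightarrow> \<bar>y - T * of_int n\<bar> \<le> R \<Longrightarrow> n \<in> {- int N..<int N}"
      using ex_window[OF T, of "x - 1" "x + 1" R] by metis
    have "continuous_on {x - 1<..<x + 1} (\<lambda>y. \<Sum>n\<in>{- int N..<int N}. h (y - T * of_int n))"
      by (intro continuous_intros continuous_on_compose2[OF h(1)]) auto
    also have "?this \<longleftrightarrow> continuous_on {x - 1<..<x + 1} (periodize T h)"
      by (intro continuous_on_cong refl periodize_eq_sum[OF h(2), symmetric] N) auto
    finally show ?thesis by (simp add: continuous_on_eq_continuous_at)
  qed
  then show ?thesis by (simp add: continuous_on_eq_continuous_at)
qed

lemma integral_compact_support: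
  fixes h :: "real \<Rightarrow> 'a::euclidean_space"
  assumes h: "continuous_on UNIV h" and s: "\<And>y. y \<notin> {u..v} \<Longrightarrow> h y = 0"
  shows "integrable lborel h" "(LINT x|lborel. h x) = integral {u..v} h"
proof -
  have "set_integrable lborel {u..v} h"
    by (intro borel_integrable_atLeastAtMost' continuous_on_subset[OF h]) auto
  moreover have "indicator {u..v} x *\<^sub>R h x = h x" for x using s by (auto simp: indicator_def)
  ultimately show "integrable lborel h" "(LINT x|lborel. h x) = integral {u..v} h"
    using set_borel_integral_eq_integral(2)[of "{u..v}" h]
    by (simp_all add: set_integrable_def set_lebesgue_integral_def)
qed

lemma integral_periodize:
  fixes h :: "real \<Rightarrow> 'a::euclidean_space"
  assumes T: "T > 0" and h: "continuous_on UNIV h" "\<And>y. R < \<bar>y\<bar> \<Longrightarrow> h y = 0"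
  shows "integral {w..w + T} (periodize T h) = (LINT x|lborel. h x)"
proof -
  obtain N :: nat where N: "N > 0" "\<And>y n. w \<le> y \<Longrightarrow> y \<le> w + T \<Longrightarrow> \<bar>y - T * of_int n\<bar> \<le> R \<Longrightarrow> n \<in> {- int N..<int N}"
    using ex_window[OF T] by metis
  have int: "h integrable_on {c..d}" for c d
    by (intro integrable_continuous_real continuous_on_subset[OF h(1)]) auto
  have shift: "integral {w..w + T} (\<lambda>x. h (x - T * of_int n)) = integral {w - T * of_int n..w + T - T * of_int n} h" for n
    using integral_shift_real_ivl[of "w - T * of_int n" "- T * of_int n" "w + T - T * of_int n" h] by simp
  \<comment> \<open>The half-open index range makes the translated windows tile one interval;
    raising \<open>K\<close> by one attaches a window at each end.\<close>
  have "(\<Sum>n\<in>{- int K..<int K}. integral {w - T * of_int n..w + T - T * of_int n} h)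
     = integral {w + T - T * real K..w + T + T * real K} h" for K
  proof (induction K)
    case 0 then show ?case by simp
  next
    case (Suc K)
    let ?f = "\<lambda>n::int. integral {w - T * of_int n..w + T - T * of_int n} h"
    have "{- int (Suc K)..<int (Suc K)} = insert (- int (Suc K)) (insert (int K) {- int K..<int K})"
      by auto
    then have "sum ?f {- int (Suc K)..<int (Suc K)} = ?f (- int (Suc K)) + (?f (int K) + sum ?f {- int K..<int K})"
      by simp
    also have "?f (int K) + sum ?f {- int K..<int K} = 
        integral {w - T * real K..w + T - T * real K} h + integral {w + T - T * real K..w + T + T * real K} h"
      unfolding Suc.IH by simp
    also have "\<dots> = integral {w - T * real K..w + T + T * real K} h"
      using T by (intro Henstock_Kurzweil_Integration.integral_combine int) auto
    also have "?f (- int (Suc K)) = integral {w + T + T * real K..w + T + T * real (Suc K)} h"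
      by (simp add: algebra_simps)
    also have "\<dots> + integral {w - T * real K..w + T + T * real K} h = integral {w - T * real K..w + T + T * real (Suc K)} h"
      using T by (subst add.commute, intro Henstock_Kurzweil_Integration.integral_combine int) (auto simp: algebra_simps)
    finally show ?case by (simp add: algebra_simps)
  qed
  from this[of N] have *: "(\<Sum>n\<in>{- int N..<int N}. integral {w..w + T} (\<lambda>x. h (x - T * of_int n)))
     = integral {w + T - T * real N..w + T + T * real N} h"
    unfolding shift .
  have "integral {w..w + T} (periodize T h) = integral {w..w + T} (\<lambda>x. \<Sum>n\<in>{- int N..<int N}. h (x - T * of_int n))"
    by (intro Henstock_Kurzweil_Integration.integral_cong periodize_eq_sum[OF h(2)] N) auto
  also have "\<dots> = (\<Sum>n\<in>{- int N..<int N}. integral {w..w + T} (\<lambda>x. h (x - T * of_int n)))"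
    by (intro Henstock_Kurzweil_Integration.integral_sum integrable_continuous_real continuous_on_compose2[OF h(1)] continuous_intros) auto
  also note *
  also have "integral {w + T - T * real N..w + T + T * real N} h = (LINT x|lborel. h x)"
  proof (rule integral_compact_support(2)[OF h(1), symmetric])
    fix y assume y: "y \<notin> {w + T - T * real N..w + T + T * real N}"
    show "h y = 0"
    proof (rule ccontr)
      assume "h y \<noteq> 0"
      then have R: "\<bar>y\<bar> \<le> R" using h(2) by force
      \<comment> \<open>The index that moves \<open>y\<close> into the window
        \<open>[w, w + T)\<close>. As \<open>y\<close> lies in the support, \<open>n\<close> is one
        of the indices caught by \<open>N\<close>, which puts \<open>y\<close> in the tiled
        interval.\<close>
      define n where "n = - \<lfloor>(y - w) / T\<rfloor>"
      have "of_int (- n) \<le> (y - w) / T" "(y - w) / T < of_int (- n) + 1"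
        unfolding n_def by (simp; linarith)+
      then have b: "- T * of_int n \<le> y - w" "y - w < T - T * of_int n"
        using T by (simp_all add: field_simps)
      then have "n \<in> {- int N..<int N}"
        using R by (intro N(2)[of "y + T * of_int n"]) auto
      then have "- real N \<le> of_int n" "of_int n \<le> real N - 1" by auto
      then have "T * of_int n \<le> T * (real N - 1)" "T * (- real N) \<le> T * of_int n"
        using T by (intro mult_left_mono; simp)+
      with b y show False by (auto simp: algebra_simps)
    qed
  qed
  finally show ?thesis .
qed

section \<open>Functions in the Feichtinger algebra\<close>

lemma integral_std_normal_cis:
  "(LINT y|lborel. std_normal_density y *\<^sub>R cis (y * u)) = complex_of_real (exp (- u\<^sup>2 / 2))"
proof -
  have "char std_normal_distribution u = (LINT y|lborel. std_normal_density y *\<^sub>R cis (y * u))"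
    unfolding char_def by (subst integral_density) (auto simp: cis_conv_exp mult.commute)
  then show ?thesis by (simp add: char_std_normal_distribution)
qed

lemma cis_measurable [measurable]: "cis \<in> borel_measurable borel"
  by (intro borel_measurable_continuous_onI) (auto simp: cis_conv_exp[abs_def] intro!: continuous_intros)

definition fourier :: "(real \<Rightarrow> complex) \<Rightarrow> real \<Rightarrow> complex" where
  "fourier \<phi> w = (LINT t|lborel. \<phi> t * cis (2 * pi * w * t))"

text \<open>Fourier inversion averaged against a Gaussian of width \<open>\<sigma>\<close>, which is its own transform; the
  bound does not degenerate as \<open>\<sigma>\<close> tends to 0.\<close>
lemma norm_gauss_average_le:
  fixes \<phi> :: "real \<Rightarrow> complex"
  assumes \<phi>: "integrable lborel \<phi>"
    and F: "integrable lborel (fourier \<phi>)"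
    and \<sigma>: "\<sigma> > 0"
  shows "cmod (LINT u|lborel. \<phi> (t + \<sigma> * u) * complex_of_real (exp (- u\<^sup>2 / 2))) \<le> sqrt (2 * pi) * (LINT w|lborel. cmod (fourier \<phi> w))"
proof -
  have [measurable]: "\<phi> \<in> borel_measurable borel" using \<phi> by auto
  let ?f = "\<lambda>(s, y). \<phi> s * (std_normal_density y *\<^sub>R cis (y * ((s - t) / \<sigma>)))"
  have int: "integrable (lborel \<Otimes>\<^sub>M lborel) ?f"
  proof (rule lborel_pair.Fubini_integrable)
    have "(\<lambda>x. LINT y|lborel. norm (?f (x, y))) = (\<lambda>x. cmod (\<phi> x))"
      by (simp add: norm_mult)
    then show "integrable lborel (\<lambda>x. LINT y|lborel. norm (?f (x, y)))"
      using \<phi> by simp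
    show "AE x in lborel. integrable lborel (\<lambda>y. ?f (x, y))"
    proof (rule AE_I2)
      fix x
      have "integrable lborel (\<lambda>y. std_normal_density y *\<^sub>R cis (y * ((x - t) / \<sigma>)))"
        by (rule Bochner_Integration.integrable_bound[OF integrable_normal_density[where \<mu> = 0 and \<sigma> = 1]]) auto
      then show "integrable lborel (\<lambda>y. ?f (x, y))"
        unfolding prod.case by (rule integrable_mult_right)
    qed
  qed measurable
  have "(LINT s|lborel. \<phi> s * complex_of_real (exp (- ((s - t) / \<sigma>)\<^sup>2 / 2))) = (LINT s|lborel. LINT y|lborel. ?f (s, y))"
    by (simp only: prod.case integral_mult_right_zero integral_std_normal_cis)
  also have "\<dots> = (LINT y|lborel. LINT s|lborel. ?f (s, y))"
    using lborel_pair.Fubini_integral[of "\<lambda>s y. ?f (s, y)"] int by simp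
  \<comment> \<open>Fubini with the roles exchanged: the inner integral over \<open>s\<close> is now
    the transform of \<phi>. Its argument is kept in the affine form \<open>0 + c * y\<close> in
    which the change of variables is stated.\<close>
  also have "\<dots> = (LINT y|lborel. std_normal_density y *\<^sub>R cis (- (y * t / \<sigma>)) * fourier \<phi> (0 + (1 / (2 * pi * \<sigma>)) * y))"
  proof (rule Bochner_Integration.integral_cong[OF refl])
    fix y
    have "?f (s, y) = (std_normal_density y *\<^sub>R cis (- (y * t / \<sigma>))) * (\<phi> s * cis (2 * pi * (0 + (1 / (2 * pi * \<sigma>)) * y) * s))" for s
    proof -
      have "y * ((s - t) / \<sigma>) = - (y * t / \<sigma>) + 2 * pi * (0 + (1 / (2 * pi * \<sigma>)) * y) * s"
        using \<sigma> by (simp add: field_simps)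
      then have "cis (y * ((s - t) / \<sigma>)) = cis (- (y * t / \<sigma>)) * cis (2 * pi * (0 + (1 / (2 * pi * \<sigma>)) * y) * s)"
        by (simp only: cis_mult)
      then show ?thesis by (simp add: scaleR_conv_of_real mult_ac)
    qed
    then have "(LINT s|lborel. ?f (s, y)) = (LINT s|lborel. (std_normal_density y *\<^sub>R cis (- (y * t / \<sigma>))) * (\<phi> s * cis (2 * pi * (0 + (1 / (2 * pi * \<sigma>)) * y) * s)))"
      by (simp only:)
    then show "(LINT s|lborel. ?f (s, y)) = std_normal_density y *\<^sub>R cis (- (y * t / \<sigma>)) * fourier \<phi> (0 + (1 / (2 * pi * \<sigma>)) * y)"
      by (simp only: integral_mult_right_zero fourier_def)
  qed
  finally have eq: "(LINT s|lborel. \<phi> s * complex_of_real (exp (- ((s - t) / \<sigma>)\<^sup>2 / 2))) = \<dots>" .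
  have intF: "integrable lborel (\<lambda>y. fourier \<phi> (0 + (1 / (2 * pi * \<sigma>)) * y))"
    by (rule lborel_integrable_real_affine[OF F]) (use \<sigma> in auto)
  have "cmod (LINT s|lborel. \<phi> s * complex_of_real (exp (- ((s - t) / \<sigma>)\<^sup>2 / 2))) \<le> (LINT y|lborel. (1 / sqrt (2 * pi)) * cmod (fourier \<phi> (0 + (1 / (2 * pi * \<sigma>)) * y)))"
    unfolding eq
  proof (rule order_trans[OF integral_norm_bound integral_mono_AE'])
    show "integrable lborel (\<lambda>y. (1 / sqrt (2 * pi)) * cmod (fourier \<phi> (0 + (1 / (2 * pi * \<sigma>)) * y)))"
      using intF by (intro integrable_mult_right integrable_norm)
    have "std_normal_density y \<le> 1 / sqrt (2 * pi)" for y
      by (simp add: std_normal_density_def divide_right_mono)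
    then show "AE y in lborel. norm (std_normal_density y *\<^sub>R cis (- (y * t / \<sigma>)) * fourier \<phi> (0 + (1 / (2 * pi * \<sigma>)) * y)) \<le> (1 / sqrt (2 * pi)) * cmod (fourier \<phi> (0 + (1 / (2 * pi * \<sigma>)) * y))"
      unfolding norm_mult norm_scaleR norm_cis by (intro AE_I2 mult_right_mono) auto
  qed auto
  also have "\<dots> = (1 / sqrt (2 * pi)) * (LINT y|lborel. cmod (fourier \<phi> (0 + (1 / (2 * pi * \<sigma>)) * y)))"
    by (rule integral_mult_right_zero)
  also have "(LINT y|lborel. cmod (fourier \<phi> (0 + (1 / (2 * pi * \<sigma>)) * y))) = 2 * pi * \<sigma> * (LINT w|lborel. cmod (fourier \<phi> w))"
    using \<sigma> lborel_integral_real_affine[of "1 / (2 * pi * \<sigma>)" "\<lambda>w. cmod (fourier \<phi> w)" 0] by simp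
  \<comment> \<open>The maximum of the normal density times the Jacobian
    \<open>2 * pi * \<sigma>\<close>. The remaining factor \<sigma> cancels against the Jacobian of
    the substitution on the left-hand side.\<close>
  also have "(1 / sqrt (2 * pi)) * (2 * pi * \<sigma> * (LINT w|lborel. cmod (fourier \<phi> w))) = \<sigma> * (sqrt (2 * pi) * (LINT w|lborel. cmod (fourier \<phi> w)))"
    by (simp add: field_simps real_div_sqrt flip: real_sqrt_mult)
  finally have "cmod (LINT s|lborel. \<phi> s * complex_of_real (exp (- ((s - t) / \<sigma>)\<^sup>2 / 2))) \<le> \<sigma> * (sqrt (2 * pi) * (LINT w|lborel. cmod (fourier \<phi> w)))" .
  moreover have "(LINT s|lborel. \<phi> s * complex_of_real (exp (- ((s - t) / \<sigma>)\<^sup>2 / 2))) = \<sigma> *\<^sub>R (LINT u|lborel. \<phi> (t + \<sigma> * u) * complex_of_real (exp (- u\<^sup>2 / 2)))"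
    using \<sigma> by (subst lborel_integral_real_affine[of \<sigma> _ t]) auto
  ultimately show ?thesis using \<sigma> by simp
qed

text \<open>Letting \<sigma> tend to 0 in the Gaussian average. Since \<phi> is integrable but not
  known to be bounded, dominated convergence applies only to the part \<open>a n\<close> with
  \<open>\<sigma> n * u\<close> in \<open>[-1, 1]\<close>, where continuity bounds \<phi>; the
  remainder \<open>b n\<close> is of order \<sigma> because \<phi> is integrable and the Gaussian is
  tiny there.\<close>

lemma norm_le_integral_fourier:
  fixes \<phi> :: "real \<Rightarrow> complex"
  assumes cont: "continuous_on UNIV \<phi>" and \<phi>: "integrable lborel \<phi>"
    and F: "integrable lborel (fourier \<phi>)"
  shows "cmod (\<phi> t) \<le> (LINT w|lborel. cmod (fourier \<phi> w))"
proof -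
  have [measurable]: "\<phi> \<in> borel_measurable borel" using \<phi> by auto
  let ?E = "\<lambda>u::real. exp (- u\<^sup>2 / 2)"
  define C where "C = (LINT w|lborel. cmod (fourier \<phi> w))"
  define \<sigma> :: "nat \<Rightarrow> real" where "\<sigma> n = 1 / real (Suc n)" for n
  have \<sigma>: "\<sigma> n > 0" for n by (simp add: \<sigma>_def)
  have \<sigma>0: "\<sigma> \<longlonglongrightarrow> 0" unfolding \<sigma>_def by (rule LIMSEQ_Suc[OF lim_1_over_n])
  let ?I = "\<lambda>n u. indicator {-1..1} (\<sigma> n * u) :: real"
  have E: "integrable lborel ?E" "(LINT u|lborel. ?E u) = sqrt (2 * pi)"
  proof -
    have E: "?E u = sqrt (2 * pi) * std_normal_density u" for u by (simp add: std_normal_density_def)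
    show "integrable lborel ?E" unfolding E by simp
    show "(LINT u|lborel. ?E u) = sqrt (2 * pi)" unfolding E by simp
  qed
  define a where "a n = (LINT u|lborel. ?I n u *\<^sub>R (\<phi> (t + \<sigma> n * u) * complex_of_real (?E u)))" for n
  define b where "b n = (LINT u|lborel. (1 - ?I n u) *\<^sub>R (\<phi> (t + \<sigma> n * u) * complex_of_real (?E u)))" for n
  have int: "integrable lborel (\<lambda>u. cmod (\<phi> (t + \<sigma> n * u)))" for n
    using lborel_integrable_real_affine[OF \<phi>, of "\<sigma> n" t] \<sigma>[of n] by simp
  obtain B where B: "\<And>s. s \<in> {t - 1..t + 1} \<Longrightarrow> cmod (\<phi> s) \<le> B"
    using compact_imp_bounded[OF compact_continuous_image[OF continuous_on_subset[OF cont] compact_Icc[of "t - 1" "t + 1"]]]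
    unfolding bounded_iff by blast
  have "a \<longlonglongrightarrow> (LINT u|lborel. \<phi> t * complex_of_real (?E u))"
    unfolding a_def
  proof (rule integral_dominated_convergence)
    show "integrable lborel (\<lambda>u. B * ?E u)" using E by simp
    show "AE u in lborel. (\<lambda>n. ?I n u *\<^sub>R (\<phi> (t + \<sigma> n * u) * complex_of_real (?E u))) \<longlonglongrightarrow> \<phi> t * complex_of_real (?E u)"
    proof (rule AE_I2)
      fix u
      have lim: "(\<lambda>n. \<sigma> n * u) \<longlonglongrightarrow> 0" using tendsto_mult_left_zero[OF \<sigma>0] by simp
      have "eventually (\<lambda>n. \<bar>\<sigma> n * u\<bar> < 1) sequentially"
        using order_tendstoD(2)[OF tendsto_rabs[OF lim], of 1] by simp
      then have ev: "eventually (\<lambda>n. ?I n u *\<^sub>R (\<phi> (t + \<sigma> n * u) * complex_of_real (?E u)) = \<phi> (t + \<sigma> n * u) * complex_of_real (?E u)) sequentially"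
        by eventually_elim (auto simp: abs_less_iff)
      have "(\<lambda>n. \<phi> (t + \<sigma> n * u)) \<longlonglongrightarrow> \<phi> (t + 0)"
        using cont by (intro isCont_tendsto_compose[of _ \<phi>] tendsto_add lim tendsto_const)
           (simp add: continuous_on_eq_continuous_at)
      then have "(\<lambda>n. \<phi> (t + \<sigma> n * u) * complex_of_real (?E u)) \<longlonglongrightarrow> \<phi> t * complex_of_real (?E u)"
        by (intro tendsto_mult_right) simp
      with ev show "(\<lambda>n. ?I n u *\<^sub>R (\<phi> (t + \<sigma> n * u) * complex_of_real (?E u))) \<longlonglongrightarrow> \<phi> t * complex_of_real (?E u)"
        by (simp add: tendsto_cong)
    qed
    show "AE u in lborel. norm (?I n u *\<^sub>R (\<phi> (t + \<sigma> n * u) * complex_of_real (?E u))) \<le> B * ?E u" for n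
    proof (rule AE_I2)
      fix u
      have "cmod (\<phi> t) \<le> B" by (rule B) simp
      then have "0 \<le> B" using norm_ge_zero[of "\<phi> t"] by linarith
      then show "norm (?I n u *\<^sub>R (\<phi> (t + \<sigma> n * u) * complex_of_real (?E u))) \<le> B * ?E u"
        using B[of "t + \<sigma> n * u"] by (auto simp: indicator_def norm_mult)
    qed
  qed measurable
  moreover have "(LINT u|lborel. \<phi> t * complex_of_real (?E u)) = \<phi> t * sqrt (2 * pi)"
    using E(2) by (simp del: of_real_exp)
  ultimately have a: "(\<lambda>n. cmod (a n)) \<longlonglongrightarrow> cmod (\<phi> t) * sqrt (2 * pi)"
    using tendsto_norm[of a] by (fastforce simp: norm_mult)
  have "cmod (b n) \<le> 2 * \<sigma> n * (LINT s|lborel. cmod (\<phi> s))" for n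
  proof -
    \<comment> \<open>Away from the centre \<open>1 \<le> (\<sigma> n * u)\<^sup>2\<close>, while
      \<open>u\<^sup>2 * exp (- u\<^sup>2 / 2) \<le> 2\<close>; together they bound the Gaussian by
      \<open>2 * (\<sigma> n)\<^sup>2\<close>. The substitution loses one power of \<sigma> and
      leaves one.\<close>
    have "cmod (b n) \<le> (LINT u|lborel. 2 * (\<sigma> n)\<^sup>2 * cmod (\<phi> (t + \<sigma> n * u)))"
      unfolding b_def
    proof (rule order_trans[OF integral_norm_bound integral_mono_AE'])
      show "AE u in lborel. norm ((1 - ?I n u) *\<^sub>R (\<phi> (t + \<sigma> n * u) * complex_of_real (?E u))) \<le> 2 * (\<sigma> n)\<^sup>2 * cmod (\<phi> (t + \<sigma> n * u))"
      proof (rule AE_I2)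
        fix u
        show "norm ((1 - ?I n u) *\<^sub>R (\<phi> (t + \<sigma> n * u) * complex_of_real (?E u))) \<le> 2 * (\<sigma> n)\<^sup>2 * cmod (\<phi> (t + \<sigma> n * u))"
        proof (cases "\<bar>\<sigma> n * u\<bar> \<le> 1")
          case True then show ?thesis by (auto simp: indicator_def abs_le_iff)
        next
          case False
          then have "1 \<le> (\<sigma> n * u)\<^sup>2" by (simp add: abs_square_less_1 not_le flip: not_less) 
          then have 1: "1 \<le> (\<sigma> n)\<^sup>2 * u\<^sup>2" by (simp add: power_mult_distrib)
          have "u\<^sup>2 / 2 \<le> exp (u\<^sup>2 / 2)" using exp_ge_add_one_self[of "u\<^sup>2 / 2"] by linarith
          then have "u\<^sup>2 * ?E u \<le> 2" by (simp add: exp_minus field_simps)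
          then have "(\<sigma> n)\<^sup>2 * (u\<^sup>2 * ?E u) \<le> (\<sigma> n)\<^sup>2 * 2" by (intro mult_left_mono) auto
          moreover have "1 * ?E u \<le> (\<sigma> n)\<^sup>2 * u\<^sup>2 * ?E u" using 1 by (intro mult_right_mono) auto
          ultimately have "?E u \<le> 2 * (\<sigma> n)\<^sup>2"
            unfolding mult_1 mult.assoc by linarith
          then have "cmod (\<phi> (t + \<sigma> n * u)) * ?E u \<le> cmod (\<phi> (t + \<sigma> n * u)) * (2 * (\<sigma> n)\<^sup>2)"
            by (intro mult_left_mono) auto
          with False show ?thesis by (auto simp: indicator_def norm_mult algebra_simps)
        qed
      qed
    qed (use int in auto)
    also have "\<dots> = 2 * (\<sigma> n)\<^sup>2 * (LINT u|lborel. cmod (\<phi> (t + \<sigma> n * u)))"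
      by simp
    also have "(LINT u|lborel. cmod (\<phi> (t + \<sigma> n * u))) = (LINT s|lborel. cmod (\<phi> s)) / \<sigma> n"
      using \<sigma>[of n] lborel_integral_real_affine[of "\<sigma> n" "\<lambda>s. cmod (\<phi> s)" t] by simp
    also have "2 * (\<sigma> n)\<^sup>2 * ((LINT s|lborel. cmod (\<phi> s)) / \<sigma> n) = 2 * \<sigma> n * (LINT s|lborel. cmod (\<phi> s))"
      using \<sigma>[of n] by (simp add: power2_eq_square)
    finally show ?thesis .
  qed
  note b = this
  have "cmod (a n) \<le> sqrt (2 * pi) * C + 2 * \<sigma> n * (LINT s|lborel. cmod (\<phi> s))" for n
  proof -
    have 1: "integrable lborel (\<lambda>u. \<phi> (t + \<sigma> n * u) * complex_of_real (?E u))"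
      by (rule Bochner_Integration.integrable_bound[OF int[of n]]) (auto simp: norm_mult intro!: mult_right_le_one_le)
    have 2: "integrable lborel (\<lambda>u. ?I n u *\<^sub>R (\<phi> (t + \<sigma> n * u) * complex_of_real (?E u)))"
      "integrable lborel (\<lambda>u. (1 - ?I n u) *\<^sub>R (\<phi> (t + \<sigma> n * u) * complex_of_real (?E u)))"
      by (rule Bochner_Integration.integrable_bound[OF 1]; auto simp: indicator_def)+
    have "a n + b n = (LINT u|lborel. \<phi> (t + \<sigma> n * u) * complex_of_real (?E u))"
      unfolding a_def b_def
      by (subst Bochner_Integration.integral_add[OF 2, symmetric]) (simp flip: scaleR_left_distrib)
    then have "cmod (a n) \<le> cmod (LINT u|lborel. \<phi> (t + \<sigma> n * u) * complex_of_real (?E u)) + cmod (b n)"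
      by (metis add_diff_cancel_right' norm_triangle_ineq4)
    with norm_gauss_average_le[OF \<phi> F \<sigma>[of n], of t] b[of n] show ?thesis
      unfolding C_def by linarith
  qed
  moreover have "(\<lambda>n. sqrt (2 * pi) * C + 2 * \<sigma> n * (LINT s|lborel. cmod (\<phi> s))) \<longlonglongrightarrow> sqrt (2 * pi) * C + 2 * 0 * (LINT s|lborel. cmod (\<phi> s))"
    by (intro tendsto_intros \<sigma>0)
  ultimately have "cmod (\<phi> t) * sqrt (2 * pi) \<le> sqrt (2 * pi) * C"
    using LIMSEQ_le[OF a] by auto
  then show ?thesis by (simp add: C_def)
qed

lemma schwartz_square_integrable:
  assumes "schwartz f"
  shows "continuous_on UNIV f" "integrable lborel (\<lambda>x. (cmod (f x))\<^sup>2)"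
proof -
  from assms have "f differentiable (at x)" for x
    unfolding schwartz_def using nth_deriv.simps(1) by metis
  then show cont: "continuous_on UNIV f"
    by (simp add: continuous_on_eq_continuous_at differentiable_imp_continuous_within)
  obtain C0 where C0: "\<And>x. \<bar>x\<bar> ^ 0 * cmod (nth_deriv 0 f x) \<le> C0"
    using assms unfolding schwartz_def by blast
  obtain C2 where C2: "\<And>x. \<bar>x\<bar> ^ 1 * cmod (nth_deriv 0 f x) \<le> C2"
    using assms unfolding schwartz_def by blast
  \<comment> \<open>The bounds on \<open>f\<close> and on \<open>x * f\<close> add up to a bound on
    \<open>(1 + x\<^sup>2)\<close> times the square of the modulus of \<open>f\<close>.\<close>
  have "integrable lborel (\<lambda>x. (C0\<^sup>2 + C2\<^sup>2) * inverse (1 + x\<^sup>2))"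
    using integrable_inverse_1_plus_square by (simp add: set_integrable_def)
  then show "integrable lborel (\<lambda>x. (cmod (f x))\<^sup>2)"
  proof (rule Bochner_Integration.integrable_bound)
    show "(\<lambda>x. (cmod (f x))\<^sup>2) \<in> borel_measurable lborel"
      using borel_measurable_continuous_onI[OF cont] by measurable
    have "(cmod (f x))\<^sup>2 \<le> (C0\<^sup>2 + C2\<^sup>2) * inverse (1 + x\<^sup>2)" for x
    proof -
      have "(cmod (f x))\<^sup>2 \<le> C0\<^sup>2" "(\<bar>x\<bar> * cmod (f x))\<^sup>2 \<le> C2\<^sup>2"
        using C0[of x] C2[of x] by (auto intro!: power_mono)
      then have "(cmod (f x))\<^sup>2 * (1 + x\<^sup>2) \<le> C0\<^sup>2 + C2\<^sup>2"
        by (simp add: power_mult_distrib algebra_simps)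
      moreover have "1 + x\<^sup>2 > 0" by (simp add: add_pos_nonneg)
      ultimately show ?thesis by (simp add: field_simps)
    qed
    then show "AE x in lborel. norm ((cmod (f x))\<^sup>2) \<le> norm ((C0\<^sup>2 + C2\<^sup>2) * inverse (1 + x\<^sup>2))"
      by (auto simp: abs_mult)
  qed
qed

lemma integrable_mult_L2:
  fixes f h :: "real \<Rightarrow> complex"
  assumes [measurable]: "f \<in> borel_measurable borel" "h \<in> borel_measurable borel"
    and "integrable lborel (\<lambda>x. (cmod (f x))\<^sup>2)" "integrable lborel (\<lambda>x. (cmod (h x))\<^sup>2)"
  shows "integrable lborel (\<lambda>x. f x * h x)"
proof (rule Bochner_Integration.integrable_bound)
  show "integrable lborel (\<lambda>x. (cmod (f x))\<^sup>2 + (cmod (h x))\<^sup>2)" using assms by simp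
  have "cmod (f x) * cmod (h x) \<le> (cmod (f x))\<^sup>2 + (cmod (h x))\<^sup>2" for x
    using sum_squares_bound[of "cmod (f x)" "cmod (h x)"] mult_nonneg_nonneg[OF norm_ge_zero norm_ge_zero, of "f x" "h x"]
    by linarith
  then show "AE x in lborel. norm (f x * h x) \<le> norm ((cmod (f x))\<^sup>2 + (cmod (h x))\<^sup>2)"
    by (auto simp: norm_mult)
qed measurable

text \<open>For fixed \<open>x\<close>, \<open>stft f g x\<close> is the Fourier transform of the
  continuous function \<open>g t * f (x - t)\<close>, so inversion bounds this product by
  \<open>H x\<close>. Averaging over those \<open>x\<close> for which \<open>x - t\<close> stays
  near a point with \<open>f\<close> nonzero leaves a local average of \<open>H\<close> as a bound
  for \<open>g t\<close>.\<close>

lemma M1_imp_wiener: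
  assumes M1: "M1 g" and cont: "continuous_on UNIV g"
  shows "wiener g"
proof -
  obtain f where f: "schwartz f" "f \<noteq> (\<lambda>_. 0)"
    and V: "integrable lborel (\<lambda>z::real \<times> real. stft f g (fst z) (snd z))"
    using M1 unfolding M1_def by blast
  have g2: "integrable lborel (\<lambda>x. (cmod (g x))\<^sup>2)" using M1 by (simp add: M1_def L2_def)
  note fc = schwartz_square_integrable[OF f(1)]
  have [measurable]: "f \<in> borel_measurable borel" "g \<in> borel_measurable borel"
    using fc(1) cont by (auto intro: borel_measurable_continuous_onI)
  define H where "H x = (LINT w|lborel. cmod (stft f g x w))" for x
  have V': "integrable (lborel \<Otimes>\<^sub>M lborel) (\<lambda>z. stft f g (fst z) (snd z))"
    using V by (simp add: lborel_prod)
  have H: "integrable lborel H" unfolding H_def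
    using lborel_pair.integrable_fst'[OF integrable_norm[OF V']] by simp
  have H0: "H x \<ge> 0" for x unfolding H_def by simp
  \<comment> \<open>The order of quantifiers matters: the exceptional null set of \<open>x\<close>
    must not depend on \<open>t\<close>. Integrability of the slice can fail only for a null set of
    \<open>x\<close>, and for every other \<open>x\<close> the inversion bound holds at all
    \<open>t\<close>.\<close>
  have AE: "AE x in lborel. \<forall>t. cmod (g t) * cmod (f (x - t)) \<le> H x"
    using lborel_pair.AE_integrable_fst'[OF V']
  proof eventually_elim
    case (elim x)
    have "integrable lborel (\<lambda>t. (cmod (f (x + (-1) * t)))\<^sup>2)"
      by (rule lborel_integrable_real_affine[OF fc(2)]) simp
    then have "integrable lborel (\<lambda>t. g t * f (x - t))"
      by (intro integrable_mult_L2 g2) auto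
    moreover have "continuous_on UNIV (\<lambda>t. g t * f (x - t))"
      by (intro continuous_intros cont continuous_on_compose2[OF fc(1)]) auto
    ultimately have "cmod (g t * f (x - t)) \<le> H x" for t
      using norm_le_integral_fourier[of "\<lambda>t. g t * f (x - t)"] elim by (simp add: stft_def[abs_def] H_def fourier_def[abs_def])
    then show ?case by (simp add: norm_mult)
  qed
  obtain u0 where u0: "f u0 \<noteq> 0" using f(2) by auto
  define c where "c = cmod (f u0) / 2"
  have c: "c > 0" using u0 by (simp add: c_def)
  have "isCont (\<lambda>u. cmod (f u)) u0"
    using fc(1) by (intro continuous_intros) (simp add: continuous_on_eq_continuous_at)
  then have "eventually (\<lambda>u. c < cmod (f u)) (at u0)"
    using u0 by (intro order_tendstoD(1)[of _ "cmod (f u0)"]) (auto simp: c_def isCont_def)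
  then obtain \<delta>' where "\<delta>' > 0" "\<And>u. u \<noteq> u0 \<Longrightarrow> dist u u0 < \<delta>' \<Longrightarrow> c < cmod (f u)"
    by (auto simp: eventually_at)
  then have *: "\<And>u. \<bar>u - u0\<bar> < \<delta>' \<Longrightarrow> c \<le> cmod (f u)" "\<delta>' > 0"
    using u0 by (auto simp: dist_real_def c_def) (smt (verit) field_sum_of_halves norm_ge_zero)
  define \<delta> where "\<delta> = \<delta>' / 2"
  have \<delta>: "\<delta> > 0" "\<And>u. \<bar>u - u0\<bar> \<le> \<delta> \<Longrightarrow> c \<le> cmod (f u)" using * by (auto simp: \<delta>_def)
  \<comment> \<open>Large enough that the interval of radius \<delta> around \<open>t + u0\<close>
    lies within distance \<open>r\<close> of \<open>t\<close>.\<close>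
  define r where "r = \<bar>u0\<bar> + \<delta>"
  have "cmod (g t) \<le> (LINT s|lborel. indicator {t - r..t + r} s * (H s / (2 * \<delta> * c)))" for t
  proof -
    have "(LINT s|lborel. indicator {t + u0 - \<delta>..t + u0 + \<delta>} s * (cmod (g t) * c)) \<le> (LINT s|lborel. indicator {t - r..t + r} s * H s)"
    proof (rule integral_mono_AE)
      show "integrable lborel (\<lambda>s. indicator {t - r..t + r} s * H s)"
        using integrable_mult_indicator[OF _ H] by simp
      show "AE s in lborel. indicator {t + u0 - \<delta>..t + u0 + \<delta>} s * (cmod (g t) * c) \<le> indicator {t - r..t + r} s * H s"
        using AE
      proof eventually_elim
        case (elim s)
        show ?case
        proof (cases "s \<in> {t + u0 - \<delta>..t + u0 + \<delta>}")
          case True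
          then have "c \<le> cmod (f (s - t))" by (intro \<delta>(2)) auto
          then have "cmod (g t) * c \<le> cmod (g t) * cmod (f (s - t))" by (intro mult_left_mono) auto
          also have "\<dots> \<le> H s" using elim by blast
          finally show ?thesis using True by (auto simp: indicator_def r_def)
        qed (auto simp: H0)
      qed
    qed (auto intro!: integrable_mult_left integrable_real_indicator simp: emeasure_lborel_Icc_eq)
    moreover have "(LINT s|lborel. indicator {t + u0 - \<delta>..t + u0 + \<delta>} s * (cmod (g t) * c)) = 2 * \<delta> * c * cmod (g t)"
      using \<delta>(1) by simp
    ultimately show ?thesis using \<delta> c by (simp add: field_simps)
  qed
  then show ?thesis
    using \<delta>(1) c by (intro wienerI_integral[where H = "\<lambda>s. H s / (2 * \<delta> * c)" and r = r]) (auto simp: H H0)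
qed

section \<open>The fibers of the Gabor system\<close>

text \<open>Tonelli for sums: a finite subset of the dependent product splits into finite slices, so
  nonnegativity bounds all partial sums by \<open>S\<close> and joint summability need not be
  assumed.\<close>

lemma has_sum_Sigma_nonneg:
  fixes f :: "'a \<times> 'b \<Rightarrow> real"
  assumes f: "\<And>x. x \<in> A \<Longrightarrow> ((\<lambda>y. f (x, y)) has_sum s x) (B x)" and s: "(s has_sum S) A"
    and nonneg: "\<And>z. z \<in> Sigma A B \<Longrightarrow> f z \<ge> 0"
  shows "(f has_sum S) (Sigma A B)"
proof (rule has_sum_SigmaI[OF f s])
  show "f summable_on Sigma A B"
  proof (rule nonneg_bdd_above_summable_on)
    show "bdd_above (sum f ` {F. F \<subseteq> Sigma A B \<and> finite F})"
      unfolding bdd_above_def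
    proof (rule exI[of _ S], clarify)
      fix F assume F: "F \<subseteq> Sigma A B" "finite F"
      define G where "G x = {y. (x, y) \<in> F}" for x
      have G: "finite (G x)" "G x \<subseteq> B x" for x
      proof -
        have "G x \<subseteq> snd ` F" by (force simp: G_def)
        then show "finite (G x)" using F(2) by (meson finite_imageI finite_subset)
        show "G x \<subseteq> B x" using F(1) by (auto simp: G_def)
      qed
      have "F = Sigma (fst ` F) G" by (force simp: G_def)
      then have "sum f F = (\<Sum>x\<in>fst ` F. \<Sum>y\<in>G x. f (x, y))"
        using F(2) G(1) by (subst sum.Sigma) auto
      also have "\<dots> \<le> (\<Sum>x\<in>fst ` F. s x)"
        using F G(1) G(2) by (intro sum_mono finite_sum_le_has_sum[OF f]) (auto intro!: nonneg)
      also have "\<dots> \<le> S"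
        using F(1) by (intro finite_sum_le_has_sum[OF s]) (auto intro!: F(2) has_sum_nonneg[OF f] nonneg)
      finally show "sum f F \<le> S" .
    qed
  qed (rule nonneg)
qed

lemma summable_on_square:
  fixes M :: "'a \<Rightarrow> real"
  assumes M: "M summable_on UNIV" and nonneg: "\<And>x. M x \<ge> 0"
  shows "(\<lambda>x. (M x)\<^sup>2) summable_on UNIV"
proof (rule summable_on_comparison_test)
  show "(\<lambda>x. infsum M UNIV * M x) summable_on UNIV"
    using M by (intro summable_on_cmult_right)
  show "(M x)\<^sup>2 \<le> infsum M UNIV * M x" for x
    using finite_sum_le_infsum[OF M, of "{x}"] nonneg
    by (auto simp: power2_eq_square intro: mult_right_mono)
qed auto

lemma wiener_majorant:
  assumes "wiener g" "\<alpha> > 0"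
  obtains M :: "int \<Rightarrow> real" where "M summable_on UNIV" "\<And>k. M k \<ge> 0"
    "\<And>k x. \<bar>x\<bar> \<le> R \<Longrightarrow> cmod (g (x + \<alpha> * of_int k)) \<le> M k"
proof -
  \<comment> \<open>Replacing \<open>R\<close> by its absolute value keeps \<open>x = 0\<close>
    admissible, and the bound at that point shows the majorant to be nonnegative.\<close>
  obtain M :: "int \<Rightarrow> real" where M: "M summable_on UNIV"
    "\<And>k x. \<bar>x\<bar> \<le> \<bar>R\<bar> \<Longrightarrow> cmod (g (x + \<alpha> * of_int k)) \<le> M k"
    using assms(1)[unfolded wiener_def, rule_format, OF assms(2), of "\<bar>R\<bar>"] by blast
  have "M k \<ge> 0" for k by (rule order_trans[OF norm_ge_zero M(2)[of 0 k]]) simp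
  with M show ?thesis by (intro that[of M]) auto
qed

lemma wiener_abs_summable:
  assumes "wiener g" "\<alpha> > 0"
  shows "(\<lambda>k::int. cmod (g (y + \<alpha> * of_int k))) summable_on UNIV"
proof -
  obtain M :: "int \<Rightarrow> real" where M: "M summable_on UNIV"
    "\<And>k x. \<bar>x\<bar> \<le> \<bar>y\<bar> \<Longrightarrow> cmod (g (x + \<alpha> * of_int k)) \<le> M k"
    by (rule wiener_majorant[OF assms, where R = "\<bar>y\<bar>"]) blast
  show ?thesis by (rule summable_on_comparison_test[OF M(1)]) (use M(2) in auto)
qed

text \<open>Complete residue systems modulo \<open>p\<close>. On such an index set, coefficients
  become \<open>p\<close> trigonometric polynomials with the same frequency set \<open>J\<close>,
  one for each column of \<open>Phi\<close>.\<close>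

definition blocks :: "nat \<Rightarrow> int set \<Rightarrow> int set" where
  "blocks p J = (\<lambda>(n, m). int n + int p * m) ` ({..<p} \<times> J)"

lemma finite_blocks [simp]: "finite J \<Longrightarrow> finite (blocks p J)"
  by (simp add: blocks_def)

lemma sum_blocks:
  "(\<Sum>i\<in>blocks p J. F i) = (\<Sum>n<p. \<Sum>m\<in>J. F (int n + int p * m))"
proof -
  have "inj_on (\<lambda>(n, m). int n + int p * m) ({..<p} \<times> J)"
  proof (rule inj_onI, clarify)
    fix n m n' m' assume *: "n < p" "n' < p" "int n + int p * m = int n' + int p * m'"
    have "(int k + int p * l) div int p = l" if "k < p" for k l
      using that by (simp add: div_mult_self2)
    with * have "m = m'" by metis
    with * show "n = n' \<and> m = m'" by simp
  qed
  then show ?thesis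
    by (simp add: blocks_def sum.reindex sum.cartesian_product case_prod_unfold)
qed

text \<open>Division by \<open>p\<close>, which is at least 1, does not leave a window around 0;
  hence the finite windows of a periodization can be enlarged to complete blocks.\<close>

lemma interval_subset_blocks:
  assumes "p > 0" shows "{- int N..<int N} \<subseteq> blocks p {- int N..<int N}"
proof
  fix i assume i: "i \<in> {- int N..<int N}"
  define m n where "m = i div int p" and "n = nat (i mod int p)"
  have i': "i = int n + int p * m" "n < p"
    using assms by (auto simp: m_def n_def nat_less_iff)
  have "m \<in> {- int N..<int N}"
  proof -
    have "- int N \<le> m"
    proof (rule ccontr)
      assume "\<not> - int N \<le> m"
      then have "int p * (m + 1) \<le> int p * (- int N)" by (intro mult_left_mono) auto
      also have "\<dots> \<le> 1 * (- int N)" using assms by (simp only: mult_le_cancel_right) auto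
      finally show False using i i' by (simp add: algebra_simps)
    qed
    moreover have "m < int N"
    proof (rule ccontr)
      assume "\<not> m < int N"
      then have "int p * int N \<le> int p * m" by (intro mult_left_mono) auto
      moreover have "1 * int N \<le> int p * int N" using assms by (intro mult_right_mono) auto
      ultimately show False using i unfolding i'(1) atLeastLessThan_iff by linarith
    qed
    ultimately show ?thesis by simp
  qed
  with i' show "i \<in> blocks p {- int N..<int N}"
    unfolding blocks_def by (intro image_eqI[of _ _ "(n, m)"]) auto
qed

lemma integral_norm_trig_sum:
  assumes "finite J"
  shows "integral {w..w + 1} (\<lambda>t. (cmod (\<Sum>m\<in>J. d m * wave 1 m t))\<^sup>2) = (\<Sum>m\<in>J. (cmod (d m))\<^sup>2)"
proof -
  let ?d = "\<lambda>m. if m \<in> J then d m else 0"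
  have "((\<lambda>k. (cmod (?d k))\<^sup>2) has_sum integral {w..w + 1} (\<lambda>t. (cmod (\<Sum>m\<in>J. d m * wave 1 m t))\<^sup>2)) UNIV"
  proof (rule parseval_abs_summable(1))
    show "(\<lambda>k. cmod (?d k)) summable_on UNIV"
      by (rule has_sum_imp_summable[OF has_sum_finite_neutralI[OF assms]]) auto
    show "((\<lambda>k. ?d k * wave 1 k t) has_sum (\<Sum>m\<in>J. d m * wave 1 m t)) UNIV" for t
      by (rule has_sum_finite_neutralI[OF assms]) auto
  qed
  moreover have "((\<lambda>k. (cmod (?d k))\<^sup>2) has_sum (\<Sum>m\<in>J. (cmod (d m))\<^sup>2)) UNIV"
    by (rule has_sum_finite_neutralI[OF assms]) auto
  ultimately show ?thesis by (rule has_sum_unique)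
qed

locale rational_gabor =
  fixes g :: "real \<Rightarrow> complex" and a b :: real and p q :: nat
  assumes wiener: "wiener g" and cont: "continuous_on UNIV g"
    and a: "a > 0" and b: "b > 0" and p: "p > 0" and q: "q > 0" and ab: "a * b = real p / real q"
begin

text \<open>The two lattices share this step: \<open>p\<close> steps of length \<open>1 / b\<close>
  equal \<open>q\<close> steps of length \<open>a\<close>. It is the only source of the Toeplitz
  structure.\<close>

lemma p_div_b: "real p / b = a * real q"
  using ab b q by (simp add: field_simps)

lemma block_shift: "of_int (int n + int p * m) / b = real n / b + a * real q * of_int m"
  by (simp add: add_divide_distrib flip: p_div_b)

text \<open>Ensures that the infinite sum in \<open>Phi\<close> genuinely converges and is not the
  default value of \<open>infsum\<close>.\<close>

lemma Phi_has_sum: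
  "((\<lambda>k. g (x + a * real q * of_int k + a * real s - real n / b) * wave 1 k t) has_sum Phi g a b q x t s n) UNIV"
proof -
  have "(\<lambda>k. cmod (g (x + a * real s - real n / b + (a * real q) * of_int k))) summable_on UNIV"
    by (rule wiener_abs_summable[OF wiener]) (use a q in simp)
  moreover have "x + a * real s - real n / b + (a * real q) * of_int k = x + a * real q * of_int k + a * real s - real n / b" for k
    by simp
  ultimately have "(\<lambda>k. cmod (g (x + a * real q * of_int k + a * real s - real n / b) * wave 1 k t)) summable_on UNIV"
    by (simp only: norm_mult norm_wave mult_1_right)
  then have "(\<lambda>k. g (x + a * real q * of_int k + a * real s - real n / b) * wave 1 k t) summable_on UNIV"
    by (rule abs_summable_summable)
  then show ?thesis unfolding Phi_def by (simp add: wave_def mult_ac)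
qed

lemma cnj_Phi_has_sum:
  "((\<lambda>k. cnj (g (x + a * real q * of_int k + a * real s - real n / b)) * wave 1 k t) has_sum cnj (Phi g a b q x (- t) s n)) UNIV"
  using has_sum_cnj_iff[THEN iffD2, OF Phi_has_sum[of x s n "-t"]] by (simp add: wave_def cis_cnj)

lemma continuous_on_Phi: "continuous_on ({u..v} \<times> UNIV) (\<lambda>z. Phi g a b q (fst z) (snd z) s n)"
proof -
  define R where "R = \<bar>u\<bar> + \<bar>v\<bar> + \<bar>a * real s - real n / b\<bar>"
  obtain M :: "int \<Rightarrow> real" where M: "M summable_on UNIV"
    "\<And>k x. \<bar>x\<bar> \<le> R \<Longrightarrow> cmod (g (x + (a * real q) * of_int k)) \<le> M k"
    by (rule wiener_majorant[OF wiener, of "a * real q" R]) (use a q in auto)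
  show ?thesis
  proof (rule continuous_on_has_sum[OF _ _ M(1) Phi_has_sum])
    show "continuous_on ({u..v} \<times> UNIV) (\<lambda>z. g (fst z + a * real q * of_int k + a * real s - real n / b) * wave 1 k (snd z))" for k
      by (intro continuous_intros continuous_on_compose2[OF cont]) auto
    fix k :: int and z :: "real \<times> real" assume "z \<in> {u..v} \<times> UNIV"
    then have "\<bar>fst z + a * real s - real n / b\<bar> \<le> R" by (auto simp: R_def)
    from M(2)[OF this, of k]
    show "norm (g (fst z + a * real q * of_int k + a * real s - real n / b) * wave 1 k (snd z)) \<le> M k"
      by (simp add: norm_mult algebra_simps)
  qed
qed

text \<open>The translation index \<open>l\<close> is split as \<open>-(q k + s)\<close> and the fiber index \<open>i\<close> as \<open>n + p m\<close>; since
  \<open>p / b = a q\<close>, the fiber operator is then block Toeplitz in \<open>k - m\<close> with symbol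
  \<open>cnj (Phi x (-t))\<close>.\<close>
definition symbol_sum :: "(int \<Rightarrow> complex) \<Rightarrow> int set \<Rightarrow> real \<Rightarrow> real \<Rightarrow> real" where
  "symbol_sum c J x t = (\<Sum>s<q. (cmod (\<Sum>n<p. cnj (Phi g a b q x (- t) s n) *
      (\<Sum>m\<in>J. c (int n + int p * m) * wave 1 m t)))\<^sup>2)"

lemma continuous_on_Phi_t: "continuous_on S f \<Longrightarrow> continuous_on S (\<lambda>t. Phi g a b q x (f t) s n)"
  using continuous_on_compose2[OF continuous_on_Phi[of x x s n], of S "\<lambda>t. (x, f t)"]
  by (simp add: continuous_on_Pair image_subset_iff)

text \<open>For each residue \<open>s\<close> the sequence \<open>d s\<close> is a sum over
  \<open>n\<close> of convolutions of coefficient blocks with samples of \<open>g\<close>, so its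
  Fourier series is row \<open>s\<close> of the conjugated matrix applied to the block polynomials.
  Parseval for each row and summation over the \<open>q\<close> rows give the integral of the
  symbol.\<close>

lemma fiber_has_sum:
  assumes J: "finite J"
  shows "((\<lambda>l. (cmod (\<Sum>i\<in>blocks p J. c i * cnj (g (x - of_int i / b - a * of_int l))))\<^sup>2) has_sum
     integral {w..w + 1} (symbol_sum c J x)) UNIV"
proof -
  define G where "G s t = (\<Sum>n<p. cnj (Phi g a b q x (- t) s n) * (\<Sum>m\<in>J. c (int n + int p * m) * wave 1 m t))" for s t
  define y where "y s n m = x - a * real q * of_int m + a * real s - real n / b" for s n :: nat and m :: int
  define d where "d s k = (\<Sum>n<p. \<Sum>m\<in>J. c (int n + int p * m) * cnj (g (y s n m + (a * real q) * of_int k)))" for s k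
  have d: "(\<lambda>k. cmod (d s k)) summable_on UNIV" for s
  proof (rule summable_on_comparison_test)
    have h: "((\<lambda>k. cmod (c (int n + int p * m)) * cmod (g (y s n m + (a * real q) * of_int k))) has_sum
        cmod (c (int n + int p * m)) * (\<Sum>\<^sub>\<infinity>k. cmod (g (y s n m + (a * real q) * of_int k)))) UNIV" for n m
      using a q by (intro has_sum_cmult_right has_sum_infsum wiener_abs_summable[OF wiener]) simp
    show "(\<lambda>k. \<Sum>n<p. \<Sum>m\<in>J. cmod (c (int n + int p * m)) * cmod (g (y s n m + (a * real q) * of_int k))) summable_on UNIV"
      by (intro has_sum_imp_summable[OF has_sum_sum_left[where s = "\<lambda>n. \<Sum>m\<in>J. _ n m"], OF has_sum_sum_left, OF h])
    show "cmod (d s k) \<le> (\<Sum>n<p. \<Sum>m\<in>J. cmod (c (int n + int p * m)) * cmod (g (y s n m + (a * real q) * of_int k)))" for k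
      unfolding d_def by (intro sum_norm_le) (simp add: norm_mult)
  qed auto
  have hs: "((\<lambda>k. d s k * wave 1 k t) has_sum G s t) UNIV" for s t
  proof -
    \<comment> \<open>Writing \<open>wave 1 k\<close> as \<open>wave 1 m\<close> times
      \<open>wave 1 (k - m)\<close> turns the convolution into a product: shifting \<open>k\<close>
      by \<open>m\<close> leaves an entry of \<open>Phi\<close> that no longer depends on
      \<open>m\<close>.\<close>
    have "((\<lambda>k. c (int n + int p * m) * wave 1 m t * (cnj (g (y s n m + (a * real q) * of_int k)) * wave 1 (k - m) t)) has_sum
        c (int n + int p * m) * wave 1 m t * cnj (Phi g a b q x (- t) s n)) UNIV" for n m
    proof (intro has_sum_cmult_right)
      show "((\<lambda>k. cnj (g (y s n m + (a * real q) * of_int k)) * wave 1 (k - m) t) has_sum cnj (Phi g a b q x (- t) s n)) UNIV"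
        by (rule iffD2[OF has_sum_reindex_bij_witness[where i = "\<lambda>k. k + m" and j = "\<lambda>k. k - m"] cnj_Phi_has_sum])
           (auto simp: y_def algebra_simps)
    qed
    then have "((\<lambda>k. \<Sum>n<p. \<Sum>m\<in>J. c (int n + int p * m) * wave 1 m t * (cnj (g (y s n m + (a * real q) * of_int k)) * wave 1 (k - m) t)) has_sum
        (\<Sum>n<p. \<Sum>m\<in>J. c (int n + int p * m) * wave 1 m t * cnj (Phi g a b q x (- t) s n))) UNIV"
      by (intro has_sum_sum_left)
    moreover have "(\<Sum>n<p. \<Sum>m\<in>J. c (int n + int p * m) * wave 1 m t * (cnj (g (y s n m + (a * real q) * of_int k)) * wave 1 (k - m) t)) = d s k * wave 1 k t" for k
    proof -
      have w: "wave 1 k t = wave 1 m t * wave 1 (k - m) t" for m by (simp add: wave_mult)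
      have "c (int n + int p * m) * wave 1 m t * (cnj (g (y s n m + (a * real q) * of_int k)) * wave 1 (k - m) t) 
        = c (int n + int p * m) * cnj (g (y s n m + (a * real q) * of_int k)) * wave 1 k t" for n m
        by (simp add: w[of m] mult_ac)
      then show ?thesis by (simp only: d_def sum_distrib_right)
    qed
    moreover have "(\<Sum>n<p. \<Sum>m\<in>J. c (int n + int p * m) * wave 1 m t * cnj (Phi g a b q x (- t) s n)) = G s t"
      by (simp add: G_def sum_distrib_left mult_ac)
    ultimately show ?thesis by simp
  qed
  have *: "((\<lambda>k. (cmod (d s k))\<^sup>2) has_sum integral {w..w + 1} (\<lambda>t. (cmod (G s t))\<^sup>2)) UNIV" for s
    by (rule parseval_abs_summable(1)[OF d hs])
  have cG: "continuous_on UNIV (G s)" for s by (rule parseval_abs_summable(2)[OF d hs])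
  have "((\<lambda>z. (cmod (d (fst z) (snd z)))\<^sup>2) has_sum (\<Sum>s<q. integral {w..w + 1} (\<lambda>t. (cmod (G s t))\<^sup>2))) ({..<q} \<times> UNIV)"
    by (rule has_sum_Sigma_nonneg[where s = "\<lambda>s. integral {w..w + 1} (\<lambda>t. (cmod (G s t))\<^sup>2)"]) (use * in auto)
  also have "(\<Sum>s<q. integral {w..w + 1} (\<lambda>t. (cmod (G s t))\<^sup>2)) = integral {w..w + 1} (symbol_sum c J x)"
    unfolding symbol_sum_def[abs_def] G_def[symmetric]
    by (intro Henstock_Kurzweil_Integration.integral_sum[symmetric] integrable_continuous_real continuous_intros continuous_on_subset[OF cG]) auto
  finally have "((\<lambda>z. (cmod (d (fst z) (snd z)))\<^sup>2) has_sum integral {w..w + 1} (symbol_sum c J x)) ({..<q} \<times> UNIV)" .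
  \<comment> \<open>Division with remainder of \<open>- l\<close> by \<open>q\<close>. The minus
    sign matches the argument \<open>x - a * l\<close> with the \<open>x + a * (q * k + s)\<close>
    in \<open>Phi\<close>.\<close>
  moreover have "((\<lambda>z. (cmod (d (fst z) (snd z)))\<^sup>2) has_sum S) ({..<q} \<times> UNIV) \<longleftrightarrow>
     ((\<lambda>l. (cmod (\<Sum>i\<in>blocks p J. c i * cnj (g (x - of_int i / b - a * of_int l))))\<^sup>2) has_sum S) UNIV" for S
  proof (rule has_sum_reindex_bij_witness[of _ "\<lambda>l. (nat ((-l) mod int q), (-l) div int q)" "\<lambda>z. - (int q * snd z + int (fst z))"])
    fix z :: "nat \<times> int" assume z: "z \<in> {..<q} \<times> UNIV"
    then show "(nat ((- (- (int q * snd z + int (fst z)))) mod int q), (- (- (int q * snd z + int (fst z)))) div int q) = z"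
      by (cases z) (auto simp: mult.commute)
    have "d (fst z) (snd z) = (\<Sum>i\<in>blocks p J. c i * cnj (g (x - of_int i / b - a * of_int (- (int q * snd z + int (fst z))))))"
      unfolding d_def sum_blocks block_shift y_def by (simp add: algebra_simps)
    then show "(cmod (\<Sum>i\<in>blocks p J. c i * cnj (g (x - of_int i / b - a * of_int (- (int q * snd z + int (fst z)))))))\<^sup>2 = (cmod (d (fst z) (snd z)))\<^sup>2"
      by simp
  next
    fix l :: int
    have "int q * ((- l) div int q) + (-l) mod int q = - l" by simp
    then show "- (int q * snd (nat ((- l) mod int q), (- l) div int q) + int (fst (nat ((- l) mod int q), (- l) div int q))) = l"
      using q by simp
    show "(nat ((- l) mod int q), (- l) div int q) \<in> {..<q} \<times> UNIV"
      using q by (auto simp: nat_less_iff)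
  qed auto
  ultimately show ?thesis by blast
qed

end

section \<open>The frame sum as an integral of fiber sums\<close>

lemma periodize_mult_periodic:
  fixes h :: "real \<Rightarrow> complex"
  assumes "\<And>x n. e (x + T * of_int n) = e x"
  shows "periodize T (\<lambda>t. h t * e t) x = periodize T h x * e x"
proof -
  have "e (x - T * of_int n) = e x" for n
    using assms[of x "-n"] by simp
  then show ?thesis by (simp add: periodize_def infsum_cmult_left')
qed

lemma continuous_compact_support_bounded:
  fixes f :: "real \<Rightarrow> complex"
  assumes "continuous_on UNIV f" "\<And>y. R < \<bar>y\<bar> \<Longrightarrow> f y = 0"
  obtains B where "B \<ge> 0" "\<And>y. cmod (f y) \<le> B"
proof -
  have "bounded (f ` {-R..R})"
    by (intro compact_imp_bounded compact_continuous_image continuous_on_subset[OF assms(1)]) auto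
  then obtain B where B: "\<And>y. y \<in> {-R..R} \<Longrightarrow> cmod (f y) \<le> B" unfolding bounded_iff by blast
  have "cmod (f y) \<le> \<bar>B\<bar>" for y
  proof (cases "y \<in> {-R..R}")
    case True then show ?thesis using B by fastforce
  next
    case False then have "R < \<bar>y\<bar>" by auto
    then show ?thesis using assms(2) by simp
  qed
  then show ?thesis by (intro that[of "\<bar>B\<bar>"]) auto
qed

context rational_gabor
begin

text \<open>A function of period \<open>1 / b\<close> whose unnormalized Fourier coefficients are
  the inner products of \<open>f\<close> with the atoms of translation index
  \<open>l\<close>.\<close>

definition periodized_product :: "(real \<Rightarrow> complex) \<Rightarrow> int \<Rightarrow> real \<Rightarrow> complex" where
  "periodized_product f l = periodize (1 / b) (\<lambda>t. f t * cnj (g (t - a * of_int l)))"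

definition fiber_sum :: "(real \<Rightarrow> complex) \<Rightarrow> real \<Rightarrow> real" where
  "fiber_sum f x = (\<Sum>\<^sub>\<infinity>l. (cmod (periodized_product f l x))\<^sup>2)"

lemma periodized_product_eq_sum:
  assumes "\<And>y. R < \<bar>y\<bar> \<Longrightarrow> f y = 0" "finite I" "\<And>i. \<bar>x - of_int i / b\<bar> \<le> R \<Longrightarrow> i \<in> I"
  shows "periodized_product f l x = (\<Sum>i\<in>I. f (x - of_int i / b) * cnj (g (x - of_int i / b - a * of_int l)))"
  unfolding periodized_product_def by (subst periodize_eq_sum[where R = R and J = I]) (use assms in auto)

text \<open>Each nonzero term evaluates \<open>g\<close> at \<open>y - a * l\<close> with
  \<open>y\<close> bounded by \<open>R\<close>, where the amalgam majorant for step \<open>a\<close>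
  applies, and the number of terms is uniform over the window.\<close>

lemma periodized_product_bound:
  assumes f: "continuous_on UNIV f" "\<And>y. R < \<bar>y\<bar> \<Longrightarrow> f y = 0"
  obtains M :: "int \<Rightarrow> real" where "M summable_on UNIV" "\<And>l. M l \<ge> 0"
    "\<And>l x. x \<in> {w..w + 1 / b} \<Longrightarrow> cmod (periodized_product f l x) \<le> M l"
proof -
  obtain N where N: "\<And>x n. w \<le> x \<Longrightarrow> x \<le> w + 1 / b \<Longrightarrow> \<bar>x - 1 / b * of_int n\<bar> \<le> R \<Longrightarrow> n \<in> {- int N..<int N}"
    using ex_window[of "1 / b" w "w + 1 / b" R] b by (metis divide_pos_pos zero_less_one)
  obtain B where B: "B \<ge> 0" "\<And>y. cmod (f y) \<le> B"
    using continuous_compact_support_bounded[OF f] by blast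
  obtain M0 :: "int \<Rightarrow> real" where M0: "M0 summable_on UNIV" "\<And>k. M0 k \<ge> 0"
    "\<And>k x. \<bar>x\<bar> \<le> R \<Longrightarrow> cmod (g (x + a * of_int k)) \<le> M0 k"
    by (rule wiener_majorant[OF wiener a, of R]) blast
  have M0': "(\<lambda>l. M0 (- l)) summable_on UNIV"
    by (subst summable_on_reindex_bij_witness[of UNIV uminus uminus UNIV M0]) (use M0 in auto)
  have "cmod (periodized_product f l x) \<le> real (card {- int N..<int N}) * (B * M0 (- l))" if x: "x \<in> {w..w + 1 / b}" for l x
  proof -
    have "periodized_product f l x = (\<Sum>i\<in>{- int N..<int N}. f (x - of_int i / b) * cnj (g (x - of_int i / b - a * of_int l)))"
      by (rule periodized_product_eq_sum[OF f(2)]) (use N x in auto)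
    moreover have "cmod (f y * cnj (g (y - a * of_int l))) \<le> B * M0 (- l)" for y
    proof (cases "\<bar>y\<bar> \<le> R")
      case True
      from M0(3)[OF this, of "-l"] show ?thesis
        using B by (auto simp: norm_mult intro!: mult_mono)
    next
      case False then show ?thesis using f(2) B M0(2) by simp
    qed
    ultimately show ?thesis
      by (metis (no_types, lifting) sum_norm_bound)
  qed
  with M0' M0(2) B(1) show ?thesis
    by (intro that[of "\<lambda>l. real (card {- int N..<int N}) * (B * M0 (- l))"] summable_on_cmult_right) auto
qed

lemma continuous_on_periodized_product:
  assumes f: "continuous_on UNIV f" "\<And>y. R < \<bar>y\<bar> \<Longrightarrow> f y = 0"
  shows "continuous_on UNIV (periodized_product f l)"
  unfolding periodized_product_def
proof (rule continuous_on_periodize)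
  show "continuous_on UNIV (\<lambda>t. f t * cnj (g (t - a * of_int l)))"
    by (intro continuous_intros f continuous_on_compose2[OF cont]) auto
  show "R < \<bar>y\<bar> \<Longrightarrow> f y * cnj (g (y - a * of_int l)) = 0" for y using f(2) by simp
qed (use b in simp)

lemma fiber_sum_has_sum:
  assumes f: "continuous_on UNIV f" "\<And>y. R < \<bar>y\<bar> \<Longrightarrow> f y = 0"
  shows "((\<lambda>l. (cmod (periodized_product f l x))\<^sup>2) has_sum fiber_sum f x) UNIV"
    and "continuous_on {w..w + 1 / b} (fiber_sum f)"
    and "((\<lambda>l. integral {w..w + 1 / b} (\<lambda>x. (cmod (periodized_product f l x))\<^sup>2)) has_sum integral {w..w + 1 / b} (fiber_sum f)) UNIV"
proof -
  have K: "((\<lambda>l. (cmod (periodized_product f l z))\<^sup>2) has_sum fiber_sum f z) UNIV" for z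
  proof -
    obtain M :: "int \<Rightarrow> real" where M: "M summable_on UNIV" "\<And>l. M l \<ge> 0"
      "\<And>l y. y \<in> {z..z + 1 / b} \<Longrightarrow> cmod (periodized_product f l y) \<le> M l"
      proof (rule periodized_product_bound[OF f, where w = z])
      fix M :: "int \<Rightarrow> real"
      assume "M summable_on UNIV" "\<And>l. M l \<ge> 0" "\<And>l x. x \<in> {z..z + 1 / b} \<Longrightarrow> cmod (periodized_product f l x) \<le> M l"
      then show thesis by (rule that)
    qed
    have "(\<lambda>l. (cmod (periodized_product f l z))\<^sup>2) summable_on UNIV"
      by (rule summable_on_comparison_test[OF summable_on_square[OF M(1,2)]])
         (use M(3)[of z] b in \<open>auto intro!: power_mono\<close>)
    then show ?thesis by (simp add: fiber_sum_def)
  qed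
  then show "((\<lambda>l. (cmod (periodized_product f l x))\<^sup>2) has_sum fiber_sum f x) UNIV" .
  obtain M :: "int \<Rightarrow> real" where M: "M summable_on UNIV" "\<And>l. M l \<ge> 0"
    "\<And>l y. y \<in> {w..w + 1 / b} \<Longrightarrow> cmod (periodized_product f l y) \<le> M l"
    using periodized_product_bound[OF f, where w = w] by blast
  have bd: "norm ((cmod (periodized_product f l y))\<^sup>2) \<le> (M l)\<^sup>2" if "y \<in> {w..w + 1 / b}" for l y
    using M(3)[OF that, of l] by (auto intro!: power_mono)
  have c: "continuous_on {w..w + 1 / b} (\<lambda>x. (cmod (periodized_product f l x))\<^sup>2)" for l
    by (intro continuous_intros continuous_on_subset[OF continuous_on_periodized_product[OF f]]) auto
  show "continuous_on {w..w + 1 / b} (fiber_sum f)"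
    by (rule continuous_on_has_sum[OF c bd summable_on_square[OF M(1,2)] K])
  show "((\<lambda>l. integral {w..w + 1 / b} (\<lambda>x. (cmod (periodized_product f l x))\<^sup>2)) has_sum integral {w..w + 1 / b} (fiber_sum f)) UNIV"
    by (rule has_sum_integral[OF c bd summable_on_square[OF M(1,2)] K])
qed

lemma l2_inner_gabor:
  assumes f: "continuous_on UNIV f" "\<And>y. R < \<bar>y\<bar> \<Longrightarrow> f y = 0"
  shows "l2_inner f (gabor g a b (l, j)) = integral {w..w + 1 / b} (\<lambda>x. periodized_product f l x * cnj (wave (1 / b) j x))"
proof -
  let ?h = "\<lambda>t. f t * cnj (g (t - a * of_int l))"
  have "l2_inner f (gabor g a b (l, j)) = (LINT t|lborel. ?h t * cnj (wave (1 / b) j t))"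
    by (simp add: l2_inner_def gabor_def wave_def mult_ac)
  also have "\<dots> = integral {w..w + 1 / b} (periodize (1 / b) (\<lambda>t. ?h t * cnj (wave (1 / b) j t)))"
  proof (rule integral_periodize[symmetric])
    show "continuous_on UNIV (\<lambda>t. ?h t * cnj (wave (1 / b) j t))"
      by (intro continuous_intros f continuous_on_compose2[OF cont]) auto
    show "R < \<bar>y\<bar> \<Longrightarrow> ?h y * cnj (wave (1 / b) j y) = 0" for y using f(2) by simp
  qed (use b in simp)
  also have "periodize (1 / b) (\<lambda>t. ?h t * cnj (wave (1 / b) j t)) = (\<lambda>x. periodized_product f l x * cnj (wave (1 / b) j x))"
    unfolding periodized_product_def
  proof (intro ext periodize_mult_periodic)
    show "cnj (wave (1 / b) j (x + 1 / b * of_int n)) = cnj (wave (1 / b) j x)" for x n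
      using b by (subst wave_periodic) auto
  qed
  finally show ?thesis .
qed

text \<open>Parseval in the modulation index for each fixed \<open>l\<close>, whose period supplies
  the factor \<open>1 / b\<close>, and Tonelli for the double sum.\<close>

theorem frame_sum:
  assumes f: "continuous_on UNIV f" "\<And>y. R < \<bar>y\<bar> \<Longrightarrow> f y = 0"
  shows "((\<lambda>i. (cmod (l2_inner f (gabor g a b i)))\<^sup>2) has_sum (1 / b) * integral {w..w + 1 / b} (fiber_sum f)) UNIV"
proof -
  have "((\<lambda>i. (cmod (l2_inner f (gabor g a b i)))\<^sup>2) has_sum (1 / b) * integral {w..w + 1 / b} (fiber_sum f)) (UNIV \<times> UNIV)"
  proof (rule has_sum_Sigma_nonneg)
    show "((\<lambda>l. (1 / b) * integral {w..w + 1 / b} (\<lambda>x. (cmod (periodized_product f l x))\<^sup>2)) has_sum (1 / b) * integral {w..w + 1 / b} (fiber_sum f)) UNIV"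
      by (intro has_sum_cmult_right fiber_sum_has_sum(3)[OF f])
    fix l
    have "((\<lambda>j. (cmod (integral {w..w + 1 / b} (\<lambda>x. periodized_product f l x * cnj (wave (1 / b) j x))))\<^sup>2) has_sum
        (1 / b) * integral {w..w + 1 / b} (\<lambda>x. (cmod (periodized_product f l x))\<^sup>2)) UNIV"
    proof (rule parseval)
      show "periodized_product f l (t + 1 / b) = periodized_product f l t" for t unfolding periodized_product_def by (rule periodize_periodic)
    qed (use b continuous_on_periodized_product[OF f] in auto)
    moreover have "l2_inner f (gabor g a b (l, j)) = integral {w..w + 1 / b} (\<lambda>x. periodized_product f l x * cnj (wave (1 / b) j x))" for j
      by (rule l2_inner_gabor[OF f])
    ultimately show "((\<lambda>j. (cmod (l2_inner f (gabor g a b (l, j))))\<^sup>2) has_sum (1 / b) * integral {w..w + 1 / b} (\<lambda>x. (cmod (periodized_product f l x))\<^sup>2)) UNIV"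
      by (simp only:)
  qed auto
  then show ?thesis by simp
qed

lemma norm2_periodize:
  assumes f: "continuous_on UNIV f" "\<And>y. R < \<bar>y\<bar> \<Longrightarrow> f y = 0"
  shows "l2_norm2 f = integral {w..w + 1 / b} (periodize (1 / b) (\<lambda>t. (cmod (f t))\<^sup>2))"
  unfolding l2_norm2_def
  by (rule integral_periodize[symmetric, where R = R]) (use b f in \<open>auto intro!: continuous_intros\<close>)

end

section \<open>Frame bounds on a dense subspace\<close>

definition clip :: "real \<Rightarrow> complex \<Rightarrow> complex" where
  "clip k z = of_real (k / max k (cmod z)) * z"

lemma norm_clip: "k > 0 \<Longrightarrow> cmod (clip k z) \<le> k"
  by (auto simp: clip_def norm_mult norm_divide max_def field_simps)

lemma clip_eq: "cmod z \<le> k \<Longrightarrow> k > 0 \<Longrightarrow> clip k z = z"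
  by (simp add: clip_def max_def)

lemma isCont_clip: "k > 0 \<Longrightarrow> isCont (clip k) z"
  unfolding clip_def[abs_def] by (intro continuous_intros) (auto simp: max_def)

text \<open>Cutting off and clipping multiply \<open>z\<close> by one number in
  \<open>[0, 1]\<close>, so the error never exceeds \<open>z\<close> in modulus. This is the
  domination needed for the truncations of an L2 function.\<close>

lemma norm_diff_clip: 
  assumes "k > 0" "0 \<le> r" "r \<le> 1"
  shows "cmod (z - of_real r * clip k z) \<le> cmod z"
proof -
  define s where "s = r * (k / max k (cmod z))"
  have "0 \<le> k / max k (cmod z)" "k / max k (cmod z) \<le> 1" using assms by (auto simp: max_def divide_simps)
  then have s: "0 \<le> s" "s \<le> 1" unfolding s_def using assms by (intro mult_nonneg_nonneg mult_le_one; simp)+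
  have "z - of_real r * clip k z = of_real (1 - s) * z"
    by (simp add: clip_def s_def algebra_simps)
  then have "cmod (z - of_real r * clip k z) = (1 - s) * cmod z"
    using abs_of_nonneg[of "1 - s"] s by (simp only: norm_mult norm_of_real diff_ge_0_iff_ge)
  also have "\<dots> \<le> 1 * cmod z" using s by (intro mult_right_mono) auto
  finally show ?thesis by simp
qed

text \<open>The free weight \<open>e\<close> keeps the factor of the main term close to 1, so
  approximation costs nothing in the frame constants.\<close>

lemma norm_add_sqr_le:
  fixes x y :: complex
  assumes "e > 0"
  shows "(cmod (x + y))\<^sup>2 \<le> (1 + e) * (cmod x)\<^sup>2 + (1 + 1 / e) * (cmod y)\<^sup>2"
proof -
  have "(cmod (x + y))\<^sup>2 \<le> (cmod x + cmod y)\<^sup>2" by (intro power_mono norm_triangle_ineq) auto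
  also have "\<dots> = (cmod x)\<^sup>2 + (cmod y)\<^sup>2 + 2 * (cmod x * cmod y)" by (simp add: power2_sum)
  also have "2 * (cmod x * cmod y) \<le> e * (cmod x)\<^sup>2 + (cmod y)\<^sup>2 / e"
  proof -
    have "0 \<le> (e * cmod x - cmod y)\<^sup>2 / e" using assms by simp
    also have "\<dots> = e * (cmod x)\<^sup>2 + (cmod y)\<^sup>2 / e - 2 * (cmod x * cmod y)"
      using assms by (simp add: power2_eq_square field_simps)
    finally show ?thesis by simp
  qed
  finally show ?thesis by (simp add: algebra_simps)
qed

lemma L2_diff:
  assumes "L2 f" "L2 h" shows "L2 (\<lambda>x. f x - h x)"
proof -
  have [measurable]: "f \<in> borel_measurable borel" "h \<in> borel_measurable borel"
    using assms by (auto simp: L2_def)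
  have "integrable lborel (\<lambda>x. (cmod (f x - h x))\<^sup>2)"
  proof (rule Bochner_Integration.integrable_bound)
    show "integrable lborel (\<lambda>x. (1 + 1) * (cmod (f x))\<^sup>2 + (1 + 1 / 1) * (cmod (h x))\<^sup>2)"
      using assms by (intro Bochner_Integration.integrable_add integrable_mult_right) (auto simp: L2_def)
    show "AE x in lborel. norm ((cmod (f x - h x))\<^sup>2) \<le> norm ((1 + 1) * (cmod (f x))\<^sup>2 + (1 + 1 / 1) * (cmod (h x))\<^sup>2)"
      using norm_add_sqr_le[of 1 "f _" "- h _"] by (intro AE_I2) simp
  qed measurable
  then show ?thesis by (simp add: L2_def)
qed

lemma L2_norm_add_le:
  assumes "L2 f" "L2 h" "e > 0"
  shows "l2_norm2 f \<le> (1 + e) * l2_norm2 h + (1 + 1 / e) * l2_norm2 (\<lambda>x. f x - h x)"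
proof -
  have "integrable lborel (\<lambda>x. (1 + e) * (cmod (h x))\<^sup>2)" "integrable lborel (\<lambda>x. (1 + 1 / e) * (cmod (f x - h x))\<^sup>2)"
    using assms(2) L2_diff[OF assms(1,2)] by (auto simp: L2_def)
  note int = this
  have "l2_norm2 f \<le> (LINT x|lborel. (1 + e) * (cmod (h x))\<^sup>2 + (1 + 1 / e) * (cmod (f x - h x))\<^sup>2)"
    unfolding l2_norm2_def
  proof (rule integral_mono)
    show "(cmod (f x))\<^sup>2 \<le> (1 + e) * (cmod (h x))\<^sup>2 + (1 + 1 / e) * (cmod (f x - h x))\<^sup>2" for x
      using norm_add_sqr_le[OF assms(3), of "h x" "f x - h x"] by simp
  qed (use assms(1) int in \<open>auto simp: L2_def intro!: Bochner_Integration.integrable_add\<close>)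
  also have "\<dots> = (1 + e) * l2_norm2 h + (1 + 1 / e) * l2_norm2 (\<lambda>x. f x - h x)"
    by (subst Bochner_Integration.integral_add[OF int]) (simp add: l2_norm2_def)
  finally show ?thesis .
qed

lemma L2_compact_support:
  fixes h :: "real \<Rightarrow> complex"
  assumes "continuous_on UNIV h" "\<And>y. R < \<bar>y\<bar> \<Longrightarrow> h y = 0"
  shows "L2 h"
proof -
  have "integrable lborel (\<lambda>x. (cmod (h x))\<^sup>2)"
    by (rule integral_compact_support(1)[where u = "-R" and v = R]) (use assms in \<open>auto intro!: continuous_intros\<close>)
  then show ?thesis using assms(1) by (auto simp: L2_def intro: borel_measurable_continuous_onI)
qed

text \<open>\<open>F k\<close> truncates \<open>f\<close> in space and in height. Continuous
  functions \<open>h n\<close> converge to \<open>f\<close> almost everywhere, but without any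
  domination; applying the same truncation to them yields the continuous \<open>G n\<close>, and now
  a bounded majorant of compact support is available.\<close>

lemma L2_approx_compact_support:
  assumes f: "L2 f" and \<eta>: "\<eta> > 0"
  obtains h R where "continuous_on UNIV h" "\<And>y. R < \<bar>y\<bar> \<Longrightarrow> h y = 0" "l2_norm2 (\<lambda>x. f x - h x) < \<eta>"
proof -
  have fm [measurable]: "f \<in> borel_measurable borel" and f2: "integrable lborel (\<lambda>x. (cmod (f x))\<^sup>2)"
    using f by (auto simp: L2_def)
  \<comment> \<open>A continuous cutoff, equal to 1 up to distance \<open>k + 1\<close> from 0 and
    vanishing beyond \<open>k + 2\<close>.\<close>
  define \<theta> :: "nat \<Rightarrow> real \<Rightarrow> real" where "\<theta> k x = max 0 (min 1 (real k + 2 - \<bar>x\<bar>))" for k x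
  have \<theta>: "0 \<le> \<theta> k x" "\<theta> k x \<le> 1" for k x by (auto simp: \<theta>_def)
  have \<theta>0: "\<theta> k x = 0" if "real k + 2 < \<bar>x\<bar>" for k x using that by (auto simp: \<theta>_def)
  have \<theta>c: "continuous_on UNIV (\<theta> k)" for k unfolding \<theta>_def[abs_def] by (intro continuous_intros)
  then have [measurable]: "\<theta> k \<in> borel_measurable borel" for k by (rule borel_measurable_continuous_onI)
  have clip_m [measurable]: "clip (real k + 1) \<in> borel_measurable borel" for k
    by (intro borel_measurable_continuous_onI continuous_at_imp_continuous_on) (auto intro: isCont_clip)
  define F where "F k x = of_real (\<theta> k x) * clip (real k + 1) (f x)" for k x
  have [measurable]: "F k \<in> borel_measurable borel" for k unfolding F_def[abs_def] by measurable
  have "(\<lambda>k. LINT x|lborel. (cmod (f x - F k x))\<^sup>2) \<longlonglongrightarrow> integral\<^sup>L lborel (\<lambda>x::real. 0::real)"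
  proof (rule integral_dominated_convergence)
    show "integrable lborel (\<lambda>x. (cmod (f x))\<^sup>2)" by fact
    show "AE x in lborel. norm ((cmod (f x - F k x))\<^sup>2) \<le> (cmod (f x))\<^sup>2" for k
      using norm_diff_clip[OF _ \<theta>] by (intro AE_I2) (auto simp: F_def intro!: power_mono)
    show "AE x in lborel. (\<lambda>k. (cmod (f x - F k x))\<^sup>2) \<longlonglongrightarrow> 0"
    proof (intro AE_I2)
      fix x
      obtain k0 :: nat where k0: "max \<bar>x\<bar> (cmod (f x)) \<le> real k0" using real_arch_simple by blast
      have "eventually (\<lambda>k. (cmod (f x - F k x))\<^sup>2 = 0) sequentially"
        using eventually_ge_at_top[of k0]
      proof eventually_elim
        case (elim k)
        then have "\<bar>x\<bar> \<le> real k" "cmod (f x) \<le> real k" using k0 by auto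
        then show ?case by (simp add: F_def \<theta>_def clip_eq)
      qed
      then show "(\<lambda>k. (cmod (f x - F k x))\<^sup>2) \<longlonglongrightarrow> 0" by (simp add: tendsto_eventually)
    qed
  qed auto
  then have "eventually (\<lambda>k. (LINT x|lborel. (cmod (f x - F k x))\<^sup>2) < \<eta> / 4) sequentially"
    using \<eta> by (intro order_tendstoD(2)) auto
  then obtain k where k: "(LINT x|lborel. (cmod (f x - F k x))\<^sup>2) < \<eta> / 4"
    by (auto simp: eventually_sequentially)
  have "f \<in> borel_measurable lebesgue" using f by (simp add: L2_def measurable_completion)
  then have "f measurable_on UNIV" by (simp add: measurable_on_iff_borel_measurable)
  then obtain N h where N: "negligible N" and hc: "\<And>n::nat. continuous_on UNIV (h n)"
    and lim: "\<And>x. x \<notin> N \<Longrightarrow> (\<lambda>n. h n x) \<longlonglongrightarrow> f x"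
    unfolding measurable_on_def by auto
  define G where "G n x = of_real (\<theta> k x) * clip (real k + 1) (h n x)" for n x
  have Gc: "continuous_on UNIV (G n)" for n
  proof -
    have "continuous_on UNIV (\<lambda>x. clip (real k + 1) (h n x))"
      by (rule continuous_on_compose2[OF _ hc, of UNIV])
         (auto intro!: continuous_at_imp_continuous_on isCont_clip)
    then show ?thesis unfolding G_def[abs_def] by (intro continuous_intros \<theta>c)
  qed
  have G0: "G n y = 0" if "real k + 2 < \<bar>y\<bar>" for n y using \<theta>0[OF that] by (simp add: G_def)
  have [measurable]: "G n \<in> borel_measurable borel" for n using Gc by (rule borel_measurable_continuous_onI)
  let ?w = "\<lambda>x. (2 * (real k + 1))\<^sup>2 * indicator {- (real k + 2)..real k + 2} x :: real"
  have wint: "integrable lborel ?w"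
    by (intro integrable_mult_right integrable_real_indicator) (auto simp: emeasure_lborel_Icc_eq)
  have FG: "(cmod (F k x - G n x))\<^sup>2 \<le> ?w x" for n x
  proof (cases "\<bar>x\<bar> \<le> real k + 2")
    case True
    have "cmod (F k x - G n x) = \<theta> k x * cmod (clip (real k + 1) (f x) - clip (real k + 1) (h n x))"
      using \<theta>(1)[of k x] by (simp add: F_def G_def norm_mult flip: right_diff_distrib)
    also have "\<dots> \<le> 1 * (cmod (clip (real k + 1) (f x)) + cmod (clip (real k + 1) (h n x)))"
      using \<theta> by (intro mult_mono norm_triangle_ineq4) auto
    also have "\<dots> \<le> 2 * (real k + 1)"
      using norm_clip[of "real k + 1" "f x"] norm_clip[of "real k + 1" "h n x"] by simp
    finally have "(cmod (F k x - G n x))\<^sup>2 \<le> (2 * (real k + 1))\<^sup>2" by (intro power_mono) auto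
    with True show ?thesis by (auto simp: indicator_def abs_le_iff)
  next
    case False then show ?thesis using \<theta>0[of k x] by (simp add: F_def G_def)
  qed
  have "(\<lambda>n. LINT x|lborel. (cmod (F k x - G n x))\<^sup>2) \<longlonglongrightarrow> integral\<^sup>L lborel (\<lambda>x::real. 0::real)"
  proof (rule integral_dominated_convergence[OF _ _ wint])
    show "AE x in lborel. norm ((cmod (F k x - G n x))\<^sup>2) \<le> ?w x" for n
      using FG by (intro AE_I2) simp
    have "AE x in lebesgue. x \<notin> N" using N by (simp add: negligible_iff_null_sets AE_not_in)
    then have "AE x in lborel. x \<notin> N" by (simp add: AE_completion_iff)
    then show "AE x in lborel. (\<lambda>n. (cmod (F k x - G n x))\<^sup>2) \<longlonglongrightarrow> 0"
    proof eventually_elim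
      case (elim x)
      have "(\<lambda>n. clip (real k + 1) (h n x)) \<longlonglongrightarrow> clip (real k + 1) (f x)"
        by (rule isCont_tendsto_compose[OF isCont_clip lim[OF elim]]) simp
      then have "(\<lambda>n. (cmod (F k x - G n x))\<^sup>2) \<longlonglongrightarrow> (cmod (F k x - of_real (\<theta> k x) * clip (real k + 1) (f x)))\<^sup>2"
        unfolding G_def by (intro tendsto_intros)
      then show ?case by (simp add: F_def)
    qed
  qed auto
  then have "eventually (\<lambda>n. (LINT x|lborel. (cmod (F k x - G n x))\<^sup>2) < \<eta> / 4) sequentially"
    using \<eta> by (intro order_tendstoD(2)) auto
  then obtain n where n: "(LINT x|lborel. (cmod (F k x - G n x))\<^sup>2) < \<eta> / 4"
    by (auto simp: eventually_sequentially)
  have Gn: "L2 (G n)" by (rule L2_compact_support[OF Gc G0])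
  have LF: "L2 (F k)"
  proof -
    have "integrable lborel (\<lambda>x. (cmod (F k x))\<^sup>2)"
    proof (rule Bochner_Integration.integrable_bound[OF wint])
      have "(cmod (F k x))\<^sup>2 \<le> ?w x" for x
      proof (cases "\<bar>x\<bar> \<le> real k + 2")
        case True
        have "cmod (F k x) \<le> 1 * (real k + 1)"
          unfolding F_def norm_mult using \<theta>[of k x] norm_clip[of "real k + 1" "f x"] by (intro mult_mono) auto
        then have "(cmod (F k x))\<^sup>2 \<le> (2 * (real k + 1))\<^sup>2" by (intro power_mono) auto
        with True show ?thesis by (auto simp: indicator_def abs_le_iff)
      next
        case False then show ?thesis using \<theta>0[of k x] by (simp add: F_def)
      qed
      then show "AE x in lborel. norm ((cmod (F k x))\<^sup>2) \<le> norm (?w x)" by (intro AE_I2) simp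
    qed measurable
    then show ?thesis by (simp add: L2_def)
  qed
  \<comment> \<open>Weight \<open>e = 1\<close> doubles both squared errors, hence the tolerance of
    a quarter of \<eta> for each.\<close>
  have "l2_norm2 (\<lambda>x. f x - G n x) \<le> (1 + 1) * l2_norm2 (\<lambda>x. f x - F k x) + (1 + 1 / 1) * l2_norm2 (\<lambda>x. f x - G n x - (f x - F k x))"
    by (rule L2_norm_add_le) (use f Gn LF in \<open>auto intro!: L2_diff\<close>)
  also have "\<dots> < \<eta>" using k n by (simp add: l2_norm2_def)
  finally show ?thesis by (intro that[OF Gc G0])
qed

section \<open>Extending frame bounds from a dense subspace\<close>

lemma L2_integrable_inner:
  assumes "L2 f" "L2 h" shows "integrable lborel (\<lambda>x. f x * cnj (h x))"
proof -
  have [measurable]: "f \<in> borel_measurable borel" "h \<in> borel_measurable borel"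
    using assms by (auto simp: L2_def)
  have "(\<lambda>x. cnj (h x)) \<in> borel_measurable borel"
    by (rule measurable_compose[OF _ borel_measurable_continuous_onI]) (auto intro!: continuous_intros)
  then show ?thesis
    using assms by (intro integrable_mult_L2) (auto simp: L2_def)
qed

lemma l2_inner_diff:
  assumes "L2 f" "L2 h" "L2 u" shows "l2_inner (\<lambda>x. f x - h x) u = l2_inner f u - l2_inner h u"
  unfolding l2_inner_def left_diff_distrib
  by (rule Bochner_Integration.integral_diff; intro L2_integrable_inner assms)

lemma l2_inner_bound:
  assumes "L2 f" "L2 h" shows "(cmod (l2_inner f h))\<^sup>2 \<le> l2_norm2 f * l2_norm2 h"
proof -
  define X where "X = cmod (l2_inner f h)"
  define A where "A = l2_norm2 f"
  define B where "B = l2_norm2 h"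
  have nn: "A \<ge> 0" "B \<ge> 0" "X \<ge> 0" by (auto simp: A_def B_def X_def l2_norm2_def)
  \<comment> \<open>Cauchy-Schwarz by the weighted arithmetic-geometric mean inequality, with
    \<open>s\<close> to be chosen afterwards: \<open>(B + 1) / X\<close> refutes
    \<open>A = 0\<close>, and \<open>X / A\<close> makes the first summand equal to
    \<open>X\<close>.\<close>
  have *: "2 * X \<le> s * A + B / s" if s: "s > 0" for s
  proof -
    have "2 * X \<le> 2 * (LINT x|lborel. cmod (f x * cnj (h x)))"
      unfolding X_def l2_inner_def by simp
    also have "\<dots> = (LINT x|lborel. 2 * cmod (f x * cnj (h x)))" by simp
    also have "\<dots> \<le> (LINT x|lborel. s * (cmod (f x))\<^sup>2 + (cmod (h x))\<^sup>2 / s)"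
    proof (rule integral_mono)
      show "integrable lborel (\<lambda>x. 2 * cmod (f x * cnj (h x)))"
        using L2_integrable_inner[OF assms] by (intro integrable_mult_right integrable_norm)
      show "integrable lborel (\<lambda>x. s * (cmod (f x))\<^sup>2 + (cmod (h x))\<^sup>2 / s)"
        using assms by (auto simp: L2_def)
      fix x
      have "0 \<le> (s * cmod (f x) - cmod (h x))\<^sup>2 / s" using s by simp
      also have "\<dots> = s * (cmod (f x))\<^sup>2 + (cmod (h x))\<^sup>2 / s - 2 * (cmod (f x) * cmod (h x))"
        using s by (simp add: power2_eq_square field_simps)
      finally show "2 * cmod (f x * cnj (h x)) \<le> s * (cmod (f x))\<^sup>2 + (cmod (h x))\<^sup>2 / s"
        by (simp add: norm_mult)
    qed
    also have "\<dots> = s * A + B / s"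
      using assms by (simp add: L2_def A_def B_def l2_norm2_def)
    finally show ?thesis .
  qed
  have "X\<^sup>2 \<le> A * B"
  proof (cases "X = 0")
    case False
    then have X: "X > 0" using nn by simp
    have "A \<noteq> 0"
    proof
      assume "A = 0"
      with *[of "(B + 1) / X"] X nn have "2 * X \<le> B * X / (B + 1)" by simp
      then have "2 * X * (B + 1) \<le> B * X" using nn by (simp add: field_simps)
      then have "X * (B + 2) \<le> 0" by (simp add: algebra_simps)
      moreover have "X * (B + 2) > 0" using X nn by simp
      ultimately show False by linarith
    qed
    then have "A > 0" using nn by simp
    with *[of "X / A"] X have "2 * X \<le> X + B * A / X" by simp
    then have "X \<le> B * A / X" by simp
    then have "X * X \<le> B * A" using X by (simp add: field_simps)
    then show ?thesis by (simp add: power2_eq_square mult.commute)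
  qed (use nn in simp)
  then show ?thesis by (simp add: X_def A_def B_def)
qed

text \<open>The limits must be taken in this order, \<eta> to 0 at fixed \<open>e\<close> and only
  afterwards \<open>e\<close> to 0, because of the factor \<open>1 / e\<close> in front of
  \<eta>.\<close>

lemma le_of_eps_eta:
  fixes X Y c d :: real
  assumes "\<And>e \<eta>. e > 0 \<Longrightarrow> \<eta> > 0 \<Longrightarrow> X \<le> (1 + e) * ((1 + e) * Y + (1 + 1 / e) * (c * \<eta>)) + (1 + 1 / e) * (d * \<eta>)"
  shows "X \<le> Y"
proof -
  have 1: "X \<le> (1 + e) * ((1 + e) * Y)" if e: "e > 0" for e
  proof -
    have "((\<lambda>\<eta>. (1 + e) * ((1 + e) * Y + (1 + 1 / e) * (c * \<eta>)) + (1 + 1 / e) * (d * \<eta>)) \<longlongrightarrow>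
        (1 + e) * ((1 + e) * Y + (1 + 1 / e) * (c * 0)) + (1 + 1 / e) * (d * 0)) (at_right 0)"
      by (intro tendsto_intros)
    moreover have "eventually (\<lambda>\<eta>. X \<le> (1 + e) * ((1 + e) * Y + (1 + 1 / e) * (c * \<eta>)) + (1 + 1 / e) * (d * \<eta>)) (at_right 0)"
      using eventually_at_right_less[of 0] by eventually_elim (rule assms[OF e])
    ultimately show ?thesis using tendsto_lowerbound by fastforce
  qed
  have "((\<lambda>e. (1 + e) * ((1 + e) * Y)) \<longlongrightarrow> (1 + 0) * ((1 + 0) * Y)) (at_right 0)"
    by (intro tendsto_intros)
  moreover have "eventually (\<lambda>e. X \<le> (1 + e) * ((1 + e) * Y)) (at_right 0)"
    using eventually_at_right_less[of 0] by eventually_elim (rule 1)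
  ultimately show ?thesis using tendsto_lowerbound by fastforce
qed

text \<open>The constants survive unchanged. The upper bound is obtained on finite index sets, where
  summability is not an issue, and it supplies summability for every L2 function; the lower bound
  then uses the upper one to control the approximation error.\<close>

lemma is_frame_dense:
  fixes F :: "'i \<Rightarrow> real \<Rightarrow> complex"
  assumes F: "\<And>i. L2 (F i)" and AB: "0 < A" "A \<le> B"
    and dense: "\<And>f R. continuous_on UNIV f \<Longrightarrow> (\<And>y. R < \<bar>y\<bar> \<Longrightarrow> f y = 0) \<Longrightarrow>
      (\<lambda>i. (cmod (l2_inner f (F i)))\<^sup>2) summable_on UNIV \<and>
      A * l2_norm2 f \<le> (\<Sum>\<^sub>\<infinity>i. (cmod (l2_inner f (F i)))\<^sup>2) \<and>
      (\<Sum>\<^sub>\<infinity>i. (cmod (l2_inner f (F i)))\<^sup>2) \<le> B * l2_norm2 f"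
  shows "is_frame F"
proof -
  have split: "(cmod (l2_inner f (F i)))\<^sup>2 \<le> (1 + e) * (cmod (l2_inner h (F i)))\<^sup>2 + (1 + 1 / e) * (cmod (l2_inner (\<lambda>x. f x - h x) (F i)))\<^sup>2"
    if "L2 f" "L2 h" "e > 0" for f h e i
    using norm_add_sqr_le[OF that(3), of "l2_inner h (F i)" "l2_inner (\<lambda>x. f x - h x) (F i)"]
    by (simp add: l2_inner_diff[OF that(1,2) F])
  have upper: "(\<Sum>i\<in>I. (cmod (l2_inner f (F i)))\<^sup>2) \<le> B * l2_norm2 f" if f: "L2 f" and I: "finite I" for f I
  proof (rule le_of_eps_eta)
    fix e \<eta> :: real assume e: "e > 0" and \<eta>: "\<eta> > 0"
    obtain h R where h: "continuous_on UNIV h" "\<And>y. R < \<bar>y\<bar> \<Longrightarrow> h y = 0" "l2_norm2 (\<lambda>x. f x - h x) < \<eta>"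
      using L2_approx_compact_support[OF f \<eta>] by blast
    have Lh: "L2 h" by (rule L2_compact_support[OF h(1,2)])
    have hh: "l2_norm2 (\<lambda>x. h x - f x) < \<eta>"
      using h(3) by (simp add: l2_norm2_def norm_minus_commute)
    have "(\<Sum>i\<in>I. (cmod (l2_inner f (F i)))\<^sup>2) \<le> (\<Sum>i\<in>I. (1 + e) * (cmod (l2_inner h (F i)))\<^sup>2 + (1 + 1 / e) * (cmod (l2_inner (\<lambda>x. f x - h x) (F i)))\<^sup>2)"
      by (intro sum_mono split f Lh e)
    also have "\<dots> = (1 + e) * (\<Sum>i\<in>I. (cmod (l2_inner h (F i)))\<^sup>2) + (1 + 1 / e) * (\<Sum>i\<in>I. (cmod (l2_inner (\<lambda>x. f x - h x) (F i)))\<^sup>2)"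
      by (simp only: sum.distrib sum_distrib_left)
    also have "(\<Sum>i\<in>I. (cmod (l2_inner h (F i)))\<^sup>2) \<le> (1 + e) * (B * l2_norm2 f) + (1 + 1 / e) * (B * \<eta>)"
    proof -
      have "(\<Sum>i\<in>I. (cmod (l2_inner h (F i)))\<^sup>2) \<le> (\<Sum>\<^sub>\<infinity>i. (cmod (l2_inner h (F i)))\<^sup>2)"
        using dense[OF h(1,2)] I by (intro finite_sum_le_infsum) auto
      also have "\<dots> \<le> B * l2_norm2 h" using dense[OF h(1,2)] by blast
      also have "\<dots> \<le> B * ((1 + e) * l2_norm2 f + (1 + 1 / e) * \<eta>)"
      proof (rule mult_left_mono)
        have "l2_norm2 h \<le> (1 + e) * l2_norm2 f + (1 + 1 / e) * l2_norm2 (\<lambda>x. h x - f x)"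
          by (rule L2_norm_add_le[OF Lh f e])
        also have "\<dots> \<le> (1 + e) * l2_norm2 f + (1 + 1 / e) * \<eta>"
          using hh e by (intro add_left_mono mult_left_mono) auto
        finally show "l2_norm2 h \<le> (1 + e) * l2_norm2 f + (1 + 1 / e) * \<eta>" .
      qed (use AB in simp)
      also have "\<dots> = (1 + e) * (B * l2_norm2 f) + (1 + 1 / e) * (B * \<eta>)"
        by (simp only: distrib_left mult.left_commute)
      finally show ?thesis .
    qed
    \<comment> \<open>Crude and dependent on \<open>I\<close>, but \<open>I\<close> is fixed while
      \<eta> tends to 0.\<close>
    also have "(\<Sum>i\<in>I. (cmod (l2_inner (\<lambda>x. f x - h x) (F i)))\<^sup>2) \<le> (\<Sum>i\<in>I. l2_norm2 (F i)) * \<eta>"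
      unfolding sum_distrib_right
    proof (rule sum_mono)
      fix i
      have "(cmod (l2_inner (\<lambda>x. f x - h x) (F i)))\<^sup>2 \<le> l2_norm2 (\<lambda>x. f x - h x) * l2_norm2 (F i)"
        by (intro l2_inner_bound L2_diff f Lh F)
      also have "\<dots> \<le> \<eta> * l2_norm2 (F i)"
        using h(3) by (intro mult_right_mono) (auto simp: l2_norm2_def)
      finally show "(cmod (l2_inner (\<lambda>x. f x - h x) (F i)))\<^sup>2 \<le> l2_norm2 (F i) * \<eta>" by (simp add: mult.commute)
    qed
    finally show "(\<Sum>i\<in>I. (cmod (l2_inner f (F i)))\<^sup>2) \<le> (1 + e) * ((1 + e) * (B * l2_norm2 f) + (1 + 1 / e) * (B * \<eta>)) + (1 + 1 / e) * ((\<Sum>i\<in>I. l2_norm2 (F i)) * \<eta>)"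
      using e by (simp add: mult_left_mono add_mono)
  qed
  have summable: "(\<lambda>i. (cmod (l2_inner f (F i)))\<^sup>2) summable_on UNIV" if f: "L2 f" for f
  proof (rule nonneg_bdd_above_summable_on)
    show "bdd_above (sum (\<lambda>i. (cmod (l2_inner f (F i)))\<^sup>2) ` {I. I \<subseteq> UNIV \<and> finite I})"
      unfolding bdd_above_def by (rule exI[of _ "B * l2_norm2 f"]) (auto intro: upper[OF f])
  qed auto
  have upper': "(\<Sum>\<^sub>\<infinity>i. (cmod (l2_inner f (F i)))\<^sup>2) \<le> B * l2_norm2 f" if f: "L2 f" for f
    by (rule infsum_le_finite_sums[OF summable[OF f]]) (rule upper[OF f])
  have lower: "A * l2_norm2 f \<le> (\<Sum>\<^sub>\<infinity>i. (cmod (l2_inner f (F i)))\<^sup>2)" (is "_ \<le> ?S f") if f: "L2 f" for f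
  proof (rule le_of_eps_eta)
    fix e \<eta> :: real assume e: "e > 0" and \<eta>: "\<eta> > 0"
    obtain h R where h: "continuous_on UNIV h" "\<And>y. R < \<bar>y\<bar> \<Longrightarrow> h y = 0" "l2_norm2 (\<lambda>x. f x - h x) < \<eta>"
      using L2_approx_compact_support[OF f \<eta>] by blast
    have Lh: "L2 h" by (rule L2_compact_support[OF h(1,2)])
    have hh: "l2_norm2 (\<lambda>x. h x - f x) < \<eta>"
      using h(3) by (simp add: l2_norm2_def norm_minus_commute)
    have "A * l2_norm2 f \<le> A * ((1 + e) * l2_norm2 h + (1 + 1 / e) * l2_norm2 (\<lambda>x. f x - h x))"
      using AB by (intro mult_left_mono L2_norm_add_le f Lh e) auto
    also have "\<dots> \<le> A * ((1 + e) * l2_norm2 h + (1 + 1 / e) * \<eta>)"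
      using AB e h(3) by (intro mult_left_mono add_left_mono) auto
    also have "\<dots> = (1 + e) * (A * l2_norm2 h) + (1 + 1 / e) * (A * \<eta>)"
      by (simp only: distrib_left mult.left_commute)
    also have "A * l2_norm2 h \<le> (1 + e) * ?S f + (1 + 1 / e) * (B * \<eta>)"
    proof -
      note s1 = summable_on_cmult_right[OF summable[OF f], of "1 + e"]
      note s2 = summable_on_cmult_right[OF summable[OF L2_diff[OF Lh f]], of "1 + 1 / e"]
      have "A * l2_norm2 h \<le> ?S h" using dense[OF h(1,2)] by blast
      also have "?S h \<le> (\<Sum>\<^sub>\<infinity>i. (1 + e) * (cmod (l2_inner f (F i)))\<^sup>2 + (1 + 1 / e) * (cmod (l2_inner (\<lambda>x. h x - f x) (F i)))\<^sup>2)"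
        by (rule infsum_mono[OF summable[OF Lh] summable_on_add[OF s1 s2] split[OF Lh f e]])
      also have "\<dots> = (1 + e) * ?S f + (1 + 1 / e) * ?S (\<lambda>x. h x - f x)"
        by (simp only: infsum_add[OF s1 s2] infsum_cmult_right')
      \<comment> \<open>The difference lies outside the dense class, so the upper bound on all of L2
        is needed here.\<close>
      also have "?S (\<lambda>x. h x - f x) \<le> B * l2_norm2 (\<lambda>x. h x - f x)" by (intro upper' L2_diff f Lh)
      also have "\<dots> \<le> B * \<eta>" using AB hh by (intro mult_left_mono) auto
      finally show ?thesis using e by (simp add: mult_left_mono add_mono)
    qed
    finally show "A * l2_norm2 f \<le> (1 + e) * ((1 + e) * ?S f + (1 + 1 / e) * (B * \<eta>)) + (1 + 1 / e) * (A * \<eta>)"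
      using e by (simp add: mult_left_mono)
  qed
  show ?thesis unfolding is_frame_def
    using F AB summable upper' lower by blast
qed

section \<open>The frame property and the symbol\<close>

lemma continuous_on_coordinate: "continuous_on S (\<lambda>v::'a \<Rightarrow> 'b::topological_space. v i)"
  by (rule continuous_on_product_then_coordinatewise[OF continuous_on_id])

text \<open>Since \<open>p\<close> is a variable, vectors are functions on \<open>nat\<close>
  vanishing from \<open>p\<close> on. The sphere is then a closed subset of a product of compact
  discs and points, compact by Tychonoff.\<close>

lemma compact_unit_sphere_fun:
  "compact {v :: nat \<Rightarrow> complex. (\<forall>n\<ge>p. v n = 0) \<and> (\<Sum>n<p. (cmod (v n))\<^sup>2) = 1}"
proof -
  let ?B = "\<lambda>n. if n < p then cball 0 1 else {0 :: complex}"
  have "compactin (product_topology (\<lambda>i. euclidean) UNIV) (PiE UNIV ?B)"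
    by (subst compactin_PiE) (auto simp: compactin_euclidean_iff)
  then have "compact (PiE UNIV ?B)"
    by (simp only: euclidean_product_topology compactin_euclidean_iff)
  moreover have "closed {v :: nat \<Rightarrow> complex. (\<Sum>n<p. (cmod (v n))\<^sup>2) = 1}"
    by (intro closed_Collect_eq continuous_intros continuous_on_coordinate)
  ultimately have "compact (PiE UNIV ?B \<inter> {v. (\<Sum>n<p. (cmod (v n))\<^sup>2) = 1})"
    by (rule compact_Int_closed)
  also have "PiE UNIV ?B \<inter> {v. (\<Sum>n<p. (cmod (v n))\<^sup>2) = 1} = {v. (\<forall>n\<ge>p. v n = 0) \<and> (\<Sum>n<p. (cmod (v n))\<^sup>2) = 1}"
  proof (intro equalityI subsetI)
    fix v assume v: "v \<in> {v :: nat \<Rightarrow> complex. (\<forall>n\<ge>p. v n = 0) \<and> (\<Sum>n<p. (cmod (v n))\<^sup>2) = 1}"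
    have "cmod (v n) \<le> 1" if "n < p" for n
    proof -
      have "(cmod (v n))\<^sup>2 \<le> (\<Sum>n<p. (cmod (v n))\<^sup>2)" by (rule member_le_sum) (use that in auto)
      with v have "(cmod (v n))\<^sup>2 \<le> 1\<^sup>2" by simp
      then show ?thesis by (rule power2_le_imp_le) simp
    qed
    with v show "v \<in> PiE UNIV ?B \<inter> {v. (\<Sum>n<p. (cmod (v n))\<^sup>2) = 1}"
      by (auto simp: PiE_def Pi_def)
  next
    fix v assume v: "v \<in> PiE UNIV ?B \<inter> {v. (\<Sum>n<p. (cmod (v n))\<^sup>2) = 1}"
    have "v n = 0" if "n \<ge> p" for n
    proof -
      have "v n \<in> ?B n" using v by blast
      with that show ?thesis by simp
    qed
    with v show "v \<in> {v. (\<forall>n\<ge>p. v n = 0) \<and> (\<Sum>n<p. (cmod (v n))\<^sup>2) = 1}" by auto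
  qed
  finally show ?thesis .
qed

context rational_gabor
begin

text \<open>Extreme values of a continuous function on a compact set of points, frequencies and unit
  vectors, extended by homogeneity; independence makes the minimum positive. The frequency range is
  \<open>[-1, 0]\<close> because the symbol at \<open>t\<close> in \<open>[0, 1]\<close> involves
  \<open>Phi\<close> at \<open>- t\<close>.\<close>

lemma Phi_bounds:
  assumes indep: "\<And>x t. lin_indep_columns q p (Phi g a b q x t)" and uv: "u \<le> v"
  obtains A B where "0 < A" "A \<le> B"
    "\<And>x t c. x \<in> {u..v} \<Longrightarrow> t \<in> {-1..0} \<Longrightarrow> A * (\<Sum>n<p. (cmod (c n))\<^sup>2) \<le> (\<Sum>s<q. (cmod (\<Sum>n<p. Phi g a b q x t s n * c n))\<^sup>2)"
    "\<And>x t c. x \<in> {u..v} \<Longrightarrow> t \<in> {-1..0} \<Longrightarrow> (\<Sum>s<q. (cmod (\<Sum>n<p. Phi g a b q x t s n * c n))\<^sup>2) \<le> B * (\<Sum>n<p. (cmod (c n))\<^sup>2)"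
proof -
  define V where "V = {v :: nat \<Rightarrow> complex. (\<forall>n\<ge>p. v n = 0) \<and> (\<Sum>n<p. (cmod (v n))\<^sup>2) = 1}"
  define D where "D = ({u..v} \<times> {-1..0::real}) \<times> V"
  define F where "F z = (\<Sum>s<q. (cmod (\<Sum>n<p. Phi g a b q (fst (fst z)) (snd (fst z)) s n * snd z n))\<^sup>2)" for z :: "(real \<times> real) \<times> (nat \<Rightarrow> complex)"
  have "compact D" unfolding D_def V_def by (intro compact_Times compact_Icc compact_unit_sphere_fun)
  have "(cmod (if n = 0 then 1 else 0))\<^sup>2 = (if n = 0 then 1 else 0)" for n :: nat by simp
  then have "(\<lambda>n. if n = 0 then 1 else 0) \<in> V"
    using p by (simp add: V_def)
  then have "((u, 0), \<lambda>n. if n = 0 then 1 else 0) \<in> D" using uv by (simp add: D_def)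
  then have "D \<noteq> {}" by blast
  have cF: "continuous_on D F" unfolding F_def
  proof (intro continuous_intros)
    fix s n
    show "continuous_on D (\<lambda>z. Phi g a b q (fst (fst z)) (snd (fst z)) s n)"
      by (rule continuous_on_compose2[OF continuous_on_Phi[of u v s n]]) (auto simp: D_def intro!: continuous_intros)
    show "continuous_on D (\<lambda>z. snd z n)"
      by (rule continuous_on_product_then_coordinatewise) (intro continuous_intros)
  qed
  obtain zA where zA: "zA \<in> D" "\<And>z. z \<in> D \<Longrightarrow> F zA \<le> F z"
    using continuous_attains_inf[OF \<open>compact D\<close> \<open>D \<noteq> {}\<close> cF] by blast
  obtain zB where zB: "zB \<in> D" "\<And>z. z \<in> D \<Longrightarrow> F z \<le> F zB"
    using continuous_attains_sup[OF \<open>compact D\<close> \<open>D \<noteq> {}\<close> cF] by blast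
  have hom: "F zA * (\<Sum>n<p. (cmod (c n))\<^sup>2) \<le> (\<Sum>s<q. (cmod (\<Sum>n<p. Phi g a b q x t s n * c n))\<^sup>2)
     \<and> (\<Sum>s<q. (cmod (\<Sum>n<p. Phi g a b q x t s n * c n))\<^sup>2) \<le> F zB * (\<Sum>n<p. (cmod (c n))\<^sup>2)"
    if xt: "x \<in> {u..v}" "t \<in> {-1..0}" for x t and c :: "nat \<Rightarrow> complex"
  proof -
    define r where "r = sqrt (\<Sum>n<p. (cmod (c n))\<^sup>2)"
    have r2: "r\<^sup>2 = (\<Sum>n<p. (cmod (c n))\<^sup>2)" by (simp add: r_def sum_nonneg)
    show ?thesis
    proof (cases "r = 0")
      case True
      then have "(\<Sum>n<p. (cmod (c n))\<^sup>2) = 0" using r2 by simp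
      then have "\<forall>n<p. c n = 0" by (simp add: sum_nonneg_eq_0_iff)
      then show ?thesis by simp
    next
      case False
      define v where "v n = (if n < p then c n / of_real r else 0)" for n
      have "(\<Sum>n<p. (cmod (v n))\<^sup>2) = (\<Sum>n<p. (cmod (c n))\<^sup>2) / r\<^sup>2"
        by (simp add: v_def norm_divide power_divide sum_divide_distrib)
      then have "v \<in> V" using False by (simp add: V_def v_def flip: r2)
      then have z: "((x, t), v) \<in> D" using xt by (simp add: D_def)
      have "(\<Sum>n<p. Phi g a b q x t s n * v n) = (\<Sum>n<p. Phi g a b q x t s n * c n) / of_real r" for s
        by (simp add: v_def flip: sum_divide_distrib)
      then have "F ((x, t), v) = (\<Sum>s<q. (cmod (\<Sum>n<p. Phi g a b q x t s n * c n))\<^sup>2) / r\<^sup>2"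
        by (simp add: F_def norm_divide power_divide flip: sum_divide_distrib)
      then have "(\<Sum>s<q. (cmod (\<Sum>n<p. Phi g a b q x t s n * c n))\<^sup>2) = F ((x, t), v) * r\<^sup>2"
        using False by simp
      then show ?thesis
        unfolding r2[symmetric] using zA(2)[OF z] zB(2)[OF z] by (simp add: mult_right_mono)
    qed
  qed
  have "F zA \<noteq> 0"
  proof
    assume "F zA = 0"
    then have "\<forall>s<q. (\<Sum>n<p. Phi g a b q (fst (fst zA)) (snd (fst zA)) s n * snd zA n) = 0"
      by (simp add: F_def sum_nonneg_eq_0_iff)
    then have "\<forall>n<p. snd zA n = 0"
      using indep[of "fst (fst zA)" "snd (fst zA)"] unfolding lin_indep_columns_def by blast
    then show False using zA(1) by (auto simp: D_def V_def)
  qed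
  moreover have "F zA \<ge> 0" by (simp add: F_def sum_nonneg)
  ultimately show ?thesis
    using hom zB(2)[OF zA(1)] by (intro that[of "F zA" "F zB"]) auto
qed

lemma continuous_on_symbol_sum: "continuous_on S (symbol_sum c J x)"
  unfolding symbol_sum_def[abs_def] by (intro continuous_intros continuous_on_Phi_t)

text \<open>The matrix bounds are applied at each \<open>t\<close> to the vector of block
  polynomials and integrated; Parseval turns the integrated square norms of these polynomials into
  the square sum of the coefficients.\<close>

lemma symbol_sum_bounds:
  assumes A: "\<And>t v. t \<in> {-1..0} \<Longrightarrow> A * (\<Sum>n<p. (cmod (v n))\<^sup>2) \<le> (\<Sum>s<q. (cmod (\<Sum>n<p. Phi g a b q x t s n * v n))\<^sup>2)"
    and B: "\<And>t v. t \<in> {-1..0} \<Longrightarrow> (\<Sum>s<q. (cmod (\<Sum>n<p. Phi g a b q x t s n * v n))\<^sup>2) \<le> B * (\<Sum>n<p. (cmod (v n))\<^sup>2)"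
    and J: "finite J"
  shows "A * (\<Sum>i\<in>blocks p J. (cmod (c i))\<^sup>2) \<le> integral {0..0 + 1} (symbol_sum c J x)"
    "integral {0..0 + 1} (symbol_sum c J x) \<le> B * (\<Sum>i\<in>blocks p J. (cmod (c i))\<^sup>2)"
proof -
  define C where "C n t = (\<Sum>m\<in>J. c (int n + int p * m) * wave 1 m t)" for n t
  have contC: "continuous_on S (C n)" for S n unfolding C_def by (intro continuous_intros)
  have "integral {0..0 + 1} (\<lambda>t. \<Sum>n<p. (cmod (C n t))\<^sup>2) = (\<Sum>n<p. integral {0..0 + 1} (\<lambda>t. (cmod (C n t))\<^sup>2))"
    by (intro Henstock_Kurzweil_Integration.integral_sum integrable_continuous_real continuous_intros contC) auto
  also have "\<dots> = (\<Sum>i\<in>blocks p J. (cmod (c i))\<^sup>2)"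
    unfolding sum_blocks C_def by (intro sum.cong refl integral_norm_trig_sum J)
  finally have I: "integral {0..0 + 1} (\<lambda>t. \<Sum>n<p. (cmod (C n t))\<^sup>2) = (\<Sum>i\<in>blocks p J. (cmod (c i))\<^sup>2)" .
  have int: "(\<lambda>t. k * (\<Sum>n<p. (cmod (C n t))\<^sup>2)) integrable_on {0..0 + 1}" for k
    by (intro integrable_continuous_real continuous_intros contC)
  \<comment> \<open>Taking conjugates under the modulus moves the conjugation from
    \<open>Phi\<close> to the vector, the form in which the hypotheses apply.\<close>
  have Qeq: "symbol_sum c J x t = (\<Sum>s<q. (cmod (\<Sum>n<p. Phi g a b q x (- t) s n * cnj (C n t)))\<^sup>2)" for t
  proof -
    have "cmod (\<Sum>n<p. cnj (Phi g a b q x (- t) s n) * C n t) = cmod (\<Sum>n<p. Phi g a b q x (- t) s n * cnj (C n t))" for s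
      by (subst complex_mod_cnj[symmetric]) simp
    then show ?thesis by (simp add: symbol_sum_def C_def[symmetric])
  qed
  have "A * (\<Sum>n<p. (cmod (C n t))\<^sup>2) \<le> symbol_sum c J x t" "symbol_sum c J x t \<le> B * (\<Sum>n<p. (cmod (C n t))\<^sup>2)" if "t \<in> {0..0 + 1}" for t
    using A[of "-t" "\<lambda>n. cnj (C n t)"] B[of "-t" "\<lambda>n. cnj (C n t)"] that by (auto simp: Qeq)
  then have "integral {0..0 + 1} (\<lambda>t. A * (\<Sum>n<p. (cmod (C n t))\<^sup>2)) \<le> integral {0..0 + 1} (symbol_sum c J x)"
    "integral {0..0 + 1} (symbol_sum c J x) \<le> integral {0..0 + 1} (\<lambda>t. B * (\<Sum>n<p. (cmod (C n t))\<^sup>2))"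
    by (intro integral_le int integrable_continuous_real continuous_on_symbol_sum; simp)+
  then show "A * (\<Sum>i\<in>blocks p J. (cmod (c i))\<^sup>2) \<le> integral {0..0 + 1} (symbol_sum c J x)"
    "integral {0..0 + 1} (symbol_sum c J x) \<le> B * (\<Sum>i\<in>blocks p J. (cmod (c i))\<^sup>2)"
    by (simp_all only: Henstock_Kurzweil_Integration.integral_mult_right I)
qed

lemma L2_gabor:
  assumes "L2 g" shows "L2 (gabor g a b i)"
proof -
  obtain l j where i: "i = (l, j)" by force
  have "integrable lborel (\<lambda>t. (cmod (g (- a * of_int l + 1 * t)))\<^sup>2)"
    by (rule lborel_integrable_real_affine) (use assms in \<open>auto simp: L2_def\<close>)
  then have "integrable lborel (\<lambda>t. (cmod (gabor g a b i t))\<^sup>2)"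
    by (simp add: i gabor_def norm_mult)
  moreover have "continuous_on UNIV (gabor g a b i)"
    unfolding i gabor_def prod.case cis_conv_exp
    by (intro continuous_intros continuous_on_compose2[OF cont]) auto
  ultimately show ?thesis by (auto simp: L2_def intro: borel_measurable_continuous_onI)
qed

lemma frame_if_lin_indep:
  assumes g2: "L2 g" and indep: "\<And>x t. lin_indep_columns q p (Phi g a b q x t)"
  shows "is_frame (gabor g a b)"
proof -
  have "0 \<le> 0 + 1 / b" using b by simp
  from Phi_bounds[OF indep this] obtain A B where AB: "0 < A" "A \<le> B"
    and A: "\<And>x t c. x \<in> {0..0 + 1 / b} \<Longrightarrow> t \<in> {-1..0} \<Longrightarrow> A * (\<Sum>n<p. (cmod (c n))\<^sup>2) \<le> (\<Sum>s<q. (cmod (\<Sum>n<p. Phi g a b q x t s n * c n))\<^sup>2)"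
    and B: "\<And>x t c. x \<in> {0..0 + 1 / b} \<Longrightarrow> t \<in> {-1..0} \<Longrightarrow> (\<Sum>s<q. (cmod (\<Sum>n<p. Phi g a b q x t s n * c n))\<^sup>2) \<le> B * (\<Sum>n<p. (cmod (c n))\<^sup>2)"
    by blast
  show ?thesis
  proof (rule is_frame_dense)
    show "L2 (gabor g a b i)" for i by (rule L2_gabor[OF g2])
    show "0 < A / b" using AB b by simp
    show "A / b \<le> B / b" using AB b by (simp add: divide_right_mono)
    fix f :: "real \<Rightarrow> complex" and R :: real
    assume f: "continuous_on UNIV f" "\<And>y. R < \<bar>y\<bar> \<Longrightarrow> f y = 0"
    let ?w = "{0..0 + 1 / b}"
    let ?h = "periodize (1 / b) (\<lambda>t. (cmod (f t))\<^sup>2)"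
    obtain N where N: "\<And>x n. 0 \<le> x \<Longrightarrow> x \<le> 0 + 1 / b \<Longrightarrow> \<bar>x - 1 / b * of_int n\<bar> \<le> R \<Longrightarrow> n \<in> {- int N..<int N}"
      using ex_window[of "1 / b" 0 "0 + 1 / b" R] b by (metis divide_pos_pos zero_less_one)
    have K: "A * ?h x \<le> fiber_sum f x \<and> fiber_sum f x \<le> B * ?h x" if x: "x \<in> ?w" for x
    proof -
      let ?J = "{- int N..<int N}"
      \<comment> \<open>Every sample of \<open>f\<close> that can be nonzero on this fiber has its
        index in complete blocks; the additional indices only contribute zeros.\<close>
      have sub: "i \<in> blocks p ?J" if "\<bar>x - of_int i / b\<bar> \<le> R" for i
        using N[of x i] that x interval_subset_blocks[OF p, of N] by auto
      define c where "c i = f (x - of_int i / b)" for i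
      have "periodized_product f l x = (\<Sum>i\<in>blocks p ?J. c i * cnj (g (x - of_int i / b - a * of_int l)))" for l
        unfolding c_def by (rule periodized_product_eq_sum[OF f(2)]) (use sub in auto)
      then have "((\<lambda>l. (cmod (periodized_product f l x))\<^sup>2) has_sum integral {0..0 + 1} (symbol_sum c ?J x)) UNIV"
        using fiber_has_sum[of ?J c x 0] by simp
      then have KQ: "fiber_sum f x = integral {0..0 + 1} (symbol_sum c ?J x)"
        using has_sum_unique[OF fiber_sum_has_sum(1)[OF f]] by blast
      have "?h x = (\<Sum>i\<in>blocks p ?J. (cmod (c i))\<^sup>2)"
        unfolding c_def by (subst periodize_eq_sum[where R = R and J = "blocks p ?J"]) (use f(2) sub in auto)
      then show ?thesis
        using symbol_sum_bounds[of A x B ?J c] A[OF x] B[OF x] KQ by simp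
    qed
    have hc: "continuous_on UNIV ?h"
      by (rule continuous_on_periodize[where R = R]) (use b f in \<open>auto intro!: continuous_intros\<close>)
    have int: "(\<lambda>x. k * ?h x) integrable_on ?w" for k
      by (intro integrable_continuous_real continuous_intros continuous_on_subset[OF hc]) auto
    have Kint: "fiber_sum f integrable_on ?w"
      by (intro integrable_continuous_real fiber_sum_has_sum(2)[OF f])
    have "integral ?w (\<lambda>x. A * ?h x) \<le> integral ?w (fiber_sum f)" "integral ?w (fiber_sum f) \<le> integral ?w (\<lambda>x. B * ?h x)"
      using K by (intro integral_le int Kint; blast)+
    moreover have "l2_norm2 f = integral ?w ?h"
      by (rule norm2_periodize[OF f])
    ultimately have le: "A * l2_norm2 f \<le> integral ?w (fiber_sum f)" "integral ?w (fiber_sum f) \<le> B * l2_norm2 f"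
      by (simp_all only: Henstock_Kurzweil_Integration.integral_mult_right)
    have "((\<lambda>i. (cmod (l2_inner f (gabor g a b i)))\<^sup>2) has_sum (1 / b) * integral ?w (fiber_sum f)) UNIV"
      by (rule frame_sum[OF f])
    then have hs: "(\<lambda>i. (cmod (l2_inner f (gabor g a b i)))\<^sup>2) summable_on UNIV"
      "(\<Sum>\<^sub>\<infinity>i. (cmod (l2_inner f (gabor g a b i)))\<^sup>2) = (1 / b) * integral ?w (fiber_sum f)"
      by (simp_all only: has_sum_iff)
    show "(\<lambda>i. (cmod (l2_inner f (gabor g a b i)))\<^sup>2) summable_on UNIV \<and>
      A / b * l2_norm2 f \<le> (\<Sum>\<^sub>\<infinity>i. (cmod (l2_inner f (gabor g a b i)))\<^sup>2) \<and>
      (\<Sum>\<^sub>\<infinity>i. (cmod (l2_inner f (gabor g a b i)))\<^sup>2) \<le> B / b * l2_norm2 f"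
      unfolding hs(2) using hs(1) le b by (simp add: divide_right_mono)
  qed
qed

end

section \<open>Localizing the lower frame bound at a point and at a frequency\<close>

definition bump :: "real \<Rightarrow> real \<Rightarrow> real" where
  "bump \<epsilon> u = max 0 (\<epsilon> - \<bar>u\<bar>)"

lemma integral_less_zero:
  fixes F :: "real \<Rightarrow> real"
  assumes F: "continuous_on {u..v} F" "\<And>x. x \<in> {u..v} \<Longrightarrow> F x \<le> 0" and x: "x \<in> {u..v}" "F x < 0" and uv: "u < v"
  shows "integral {u..v} F < 0"
proof (rule ccontr)
  assume "\<not> integral {u..v} F < 0"
  moreover have "integral {u..v} F \<le> integral {u..v} (\<lambda>_. 0)"
    by (rule integral_le) (use F in \<open>auto intro: integrable_continuous_real\<close>)
  ultimately have "integral {u..v} F = 0" by simp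
  then have "integral {u..v} (\<lambda>x. - F x) = 0" by simp
  moreover have "continuous_on {u..v} (\<lambda>x. - F x)" by (intro continuous_intros F)
  ultimately have "- F x = 0"
    using integral_eq_0_iff[of u v "\<lambda>x. - F x"] F(2) x(1) uv by auto
  with x show False by simp
qed

context rational_gabor
begin

lemma continuous_fiber:
  assumes I: "finite I"
  shows "continuous_on {u..v} (\<lambda>x. \<Sum>\<^sub>\<infinity>l. (cmod (\<Sum>i\<in>I. c i * cnj (g (x - of_int i / b - a * of_int l))))\<^sup>2)"
    and "((\<lambda>l. (cmod (\<Sum>i\<in>I. c i * cnj (g (x - of_int i / b - a * of_int l))))\<^sup>2) has_sum
       (\<Sum>\<^sub>\<infinity>l. (cmod (\<Sum>i\<in>I. c i * cnj (g (x - of_int i / b - a * of_int l))))\<^sup>2)) UNIV"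
proof -
  let ?G = "\<lambda>l x. \<Sum>i\<in>I. c i * cnj (g (x - of_int i / b - a * of_int l))"
  have ex: "\<exists>M. M summable_on UNIV \<and> (\<forall>l. \<forall>x\<in>{u..v}. (cmod (?G l x))\<^sup>2 \<le> M l)" for u v
  proof -
    define R where "R = \<bar>u\<bar> + \<bar>v\<bar> + (\<Sum>i\<in>I. \<bar>of_int i / b\<bar>)"
    obtain M0 :: "int \<Rightarrow> real" where M0: "M0 summable_on UNIV" "\<And>k. M0 k \<ge> 0"
      "\<And>k x. \<bar>x\<bar> \<le> R \<Longrightarrow> cmod (g (x + a * of_int k)) \<le> M0 k"
      by (rule wiener_majorant[OF wiener a, of R]) blast
    define M where "M l = (\<Sum>i\<in>I. cmod (c i)) * M0 (- l)" for l
    have "(\<lambda>l. M0 (- l)) summable_on UNIV"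
      by (subst summable_on_reindex_bij_witness[of UNIV uminus uminus UNIV M0]) (use M0 in auto)
    then have M: "M summable_on UNIV" unfolding M_def by (rule summable_on_cmult_right)
    have "M l \<ge> 0" for l using M0(2) by (simp add: M_def sum_nonneg)
    then have sq: "(\<lambda>l. (M l)\<^sup>2) summable_on UNIV" by (rule summable_on_square[OF M])
    have "(cmod (?G l x))\<^sup>2 \<le> (M l)\<^sup>2" if x: "x \<in> {u..v}" for l x
    proof -
      have "cmod (?G l x) \<le> (\<Sum>i\<in>I. cmod (c i) * M0 (- l))"
      proof (rule sum_norm_le)
        fix i assume i: "i \<in> I"
        have "\<bar>of_int i / b\<bar> \<le> (\<Sum>i\<in>I. \<bar>of_int i / b\<bar>)" by (rule member_le_sum[OF i]) (use I in auto)
        then have "\<bar>x - of_int i / b\<bar> \<le> R" using x unfolding R_def atLeastAtMost_iff by linarith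
        from M0(3)[OF this, of "- l"]
        show "cmod (c i * cnj (g (x - of_int i / b - a * of_int l))) \<le> cmod (c i) * M0 (- l)"
          by (simp add: norm_mult mult_left_mono)
      qed
      then show ?thesis unfolding M_def sum_distrib_right by (intro power_mono) auto
    qed
    with sq show ?thesis by blast
  qed
  have hs: "((\<lambda>l. (cmod (?G l x))\<^sup>2) has_sum (\<Sum>\<^sub>\<infinity>l. (cmod (?G l x))\<^sup>2)) UNIV" for x
  proof -
    obtain M where M: "M summable_on UNIV" "\<forall>l. \<forall>y\<in>{x..x}. (cmod (?G l y))\<^sup>2 \<le> M l" using ex by blast
    have "(\<lambda>l. (cmod (?G l x))\<^sup>2) summable_on UNIV"
      by (rule summable_on_comparison_test[OF M(1)]) (use M(2) in auto)
    then show ?thesis by simp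
  qed
  then show "((\<lambda>l. (cmod (?G l x))\<^sup>2) has_sum (\<Sum>\<^sub>\<infinity>l. (cmod (?G l x))\<^sup>2)) UNIV" .
  obtain M where M: "M summable_on UNIV" "\<forall>l. \<forall>y\<in>{u..v}. (cmod (?G l y))\<^sup>2 \<le> M l" using ex by blast
  have c: "continuous_on {u..v} (\<lambda>x. (cmod (?G l x))\<^sup>2)" for l
    by (intro continuous_intros continuous_on_compose2[OF cont]) auto
  show "continuous_on {u..v} (\<lambda>x. \<Sum>\<^sub>\<infinity>l. (cmod (?G l x))\<^sup>2)"
    by (rule continuous_on_has_sum[OF c _ M(1) hs]) (use M(2) in auto)
qed

text \<open>The test function places a copy of one narrow tent, scaled by \<open>c i\<close>, at
  each point \<open>x0 - i / b\<close>. On the period around \<open>x0\<close> its samples are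
  \<open>c i\<close> times the same tent value, so the frame inequality becomes nonnegativity of an
  integral of \<open>Kc x - A * b * S\<close> against the squared tent. A negative value at
  \<open>x0\<close> would persist nearby and contradict this.\<close>

lemma frame_imp_fiber_bound:
  assumes frame: "\<And>f. L2 f \<Longrightarrow> A * l2_norm2 f \<le> (\<Sum>\<^sub>\<infinity>i. (cmod (l2_inner f (gabor g a b i)))\<^sup>2)"
    and I: "finite I"
  shows "A * b * (\<Sum>i\<in>I. (cmod (c i))\<^sup>2) \<le> (\<Sum>\<^sub>\<infinity>l. (cmod (\<Sum>i\<in>I. c i * cnj (g (x0 - of_int i / b - a * of_int l))))\<^sup>2)"
proof (rule ccontr)
  define S where "S = (\<Sum>i\<in>I. (cmod (c i))\<^sup>2)"
  define Kc where "Kc x = (\<Sum>\<^sub>\<infinity>l. (cmod (\<Sum>i\<in>I. c i * cnj (g (x - of_int i / b - a * of_int l))))\<^sup>2)" for x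
  assume "\<not> A * b * (\<Sum>i\<in>I. (cmod (c i))\<^sup>2) \<le> (\<Sum>\<^sub>\<infinity>l. (cmod (\<Sum>i\<in>I. c i * cnj (g (x0 - of_int i / b - a * of_int l))))\<^sup>2)"
  then have neg: "Kc x0 - A * b * S < 0" by (simp add: Kc_def S_def)
  have cK: "continuous_on {u..v} Kc" for u v unfolding Kc_def by (rule continuous_fiber(1)[OF I])
  have "isCont Kc x0"
    using cK[of "x0 - 1" "x0 + 1"] by (rule continuous_on_interior) simp
  then have "eventually (\<lambda>x. Kc x < A * b * S) (at x0)"
    using neg by (intro order_tendstoD(2)[of _ "Kc x0"]) (auto simp: isCont_def)
  then obtain e where e: "e > 0" "\<And>x. x \<noteq> x0 \<Longrightarrow> dist x x0 < e \<Longrightarrow> Kc x < A * b * S"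
    by (auto simp: eventually_at)
  \<comment> \<open>At most half the spacing \<open>1 / b\<close>, so that distinct tents do not
    overlap and a period centred at \<open>x0\<close> sees one sample per index.\<close>
  define \<epsilon> where "\<epsilon> = min e (1 / (2 * b))"
  have \<epsilon>: "\<epsilon> > 0" "\<epsilon> \<le> 1 / (2 * b)" using e b by (auto simp: \<epsilon>_def)
  have small: "Kc x - A * b * S < 0" if "\<bar>x - x0\<bar> < \<epsilon>" for x
    using e(2)[of x] neg that by (cases "x = x0") (auto simp: dist_real_def \<epsilon>_def)
  have cb: "continuous_on V (\<lambda>x. bump \<epsilon> (h x))" if "continuous_on V h" for V and h :: "real \<Rightarrow> real"
    unfolding bump_def by (intro continuous_intros that)
  define f where "f t = (\<Sum>i\<in>I. c i * of_real (bump \<epsilon> (t - x0 + of_int i / b)))" for t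
  define R where "R = \<bar>x0\<bar> + (\<Sum>i\<in>I. \<bar>of_int i / b\<bar>) + \<epsilon>"
  have f: "continuous_on UNIV f" unfolding f_def by (intro continuous_intros cb)
  have f0: "f y = 0" if y: "R < \<bar>y\<bar>" for y
  proof -
    have "bump \<epsilon> (y - x0 + of_int i / b) = 0" if i: "i \<in> I" for i
    proof -
      have "\<bar>of_int i / b\<bar> \<le> (\<Sum>i\<in>I. \<bar>of_int i / b\<bar>)" by (rule member_le_sum[OF i]) (use I in auto)
      then have "\<epsilon> \<le> \<bar>y - x0 + of_int i / b\<bar>" using y unfolding R_def by linarith
      then show ?thesis by (simp add: bump_def)
    qed
    then show ?thesis by (simp add: f_def)
  qed
  define w where "w = x0 - 1 / (2 * b)"
  let ?W = "{w..w + 1 / b}"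
  have fW: "f (x - of_int j / b) = (if j \<in> I then c j * of_real (bump \<epsilon> (x - x0)) else 0)" if x: "x \<in> ?W" for x j
  proof -
    have x': "\<bar>x - x0\<bar> \<le> 1 / (2 * b)" using x b by (auto simp: w_def abs_le_iff field_simps)
    have "c i * of_real (bump \<epsilon> (x - of_int j / b - x0 + of_int i / b)) = (if i = j then c j * of_real (bump \<epsilon> (x - x0)) else 0)" for i
    proof (cases "i = j")
      case False
      then have "1 \<le> \<bar>of_int (i - j) :: real\<bar>" by linarith
      then have "1 / b \<le> \<bar>of_int (i - j)\<bar> / b" using b by (simp add: divide_right_mono)
      also have "\<dots> = \<bar>of_int (i - j) / b\<bar>" using b by simp
      also have "of_int (i - j) / b = of_int i / b - of_int j / b" by (simp add: diff_divide_distrib)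
      finally have "1 / b \<le> \<bar>of_int i / b - of_int j / b\<bar>" .
      moreover have "1 / b = 1 / (2 * b) + 1 / (2 * b)" by (simp add: field_simps)
      ultimately have "\<epsilon> \<le> \<bar>x - of_int j / b - x0 + of_int i / b\<bar>"
        using x' \<epsilon>(2) by linarith
      with False show ?thesis by (simp add: bump_def)
    qed simp
    then show ?thesis using I by (simp add: f_def)
  qed
  have P: "periodized_product f l x = of_real (bump \<epsilon> (x - x0)) * (\<Sum>i\<in>I. c i * cnj (g (x - of_int i / b - a * of_int l)))" if x: "x \<in> ?W" for l x
  proof -
    have "periodized_product f l x = (\<Sum>\<^sub>\<infinity>i. f (x - of_int i / b) * cnj (g (x - of_int i / b - a * of_int l)))"
      by (simp add: periodized_product_def periodize_def)
    also have "\<dots> = (\<Sum>\<^sub>\<infinity>i\<in>I. of_real (bump \<epsilon> (x - x0)) * (c i * cnj (g (x - of_int i / b - a * of_int l))))"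
      by (rule infsum_cong_neutral) (auto simp: fW[OF x])
    finally show ?thesis using I by (simp add: sum_distrib_left)
  qed
  have K: "fiber_sum f x = (bump \<epsilon> (x - x0))\<^sup>2 * Kc x" if x: "x \<in> ?W" for x
  proof -
    have "((\<lambda>l. (bump \<epsilon> (x - x0))\<^sup>2 * (cmod (\<Sum>i\<in>I. c i * cnj (g (x - of_int i / b - a * of_int l))))\<^sup>2) has_sum (bump \<epsilon> (x - x0))\<^sup>2 * Kc x) UNIV"
      unfolding Kc_def by (intro has_sum_cmult_right continuous_fiber(2)[OF I])
    then have "((\<lambda>l. (cmod (periodized_product f l x))\<^sup>2) has_sum (bump \<epsilon> (x - x0))\<^sup>2 * Kc x) UNIV"
      by (simp add: P[OF x] norm_mult power_mult_distrib)
    with fiber_sum_has_sum(1)[OF f f0] show ?thesis by (rule has_sum_unique)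
  qed
  have h: "periodize (1 / b) (\<lambda>t. (cmod (f t))\<^sup>2) x = (bump \<epsilon> (x - x0))\<^sup>2 * S" if x: "x \<in> ?W" for x
  proof -
    have "periodize (1 / b) (\<lambda>t. (cmod (f t))\<^sup>2) x = (\<Sum>\<^sub>\<infinity>i. (cmod (f (x - of_int i / b)))\<^sup>2)"
      by (simp add: periodize_def)
    also have "\<dots> = (\<Sum>\<^sub>\<infinity>i\<in>I. (bump \<epsilon> (x - x0))\<^sup>2 * (cmod (c i))\<^sup>2)"
      by (rule infsum_cong_neutral) (auto simp: fW[OF x] norm_mult power_mult_distrib)
    finally show ?thesis using I by (simp add: sum_distrib_left S_def)
  qed
  have "A * l2_norm2 f \<le> (\<Sum>\<^sub>\<infinity>i. (cmod (l2_inner f (gabor g a b i)))\<^sup>2)"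
    by (rule frame[OF L2_compact_support[OF f f0]])
  also have "\<dots> = (1 / b) * integral ?W (fiber_sum f)"
    by (rule infsumI[OF frame_sum[OF f f0]])
  also have "integral ?W (fiber_sum f) = integral ?W (\<lambda>x. (bump \<epsilon> (x - x0))\<^sup>2 * Kc x)"
    by (rule Henstock_Kurzweil_Integration.integral_cong) (rule K)
  finally have 1: "A * b * l2_norm2 f \<le> integral ?W (\<lambda>x. (bump \<epsilon> (x - x0))\<^sup>2 * Kc x)"
    using b by (simp add: field_simps)
  have "l2_norm2 f = integral ?W (\<lambda>x. (bump \<epsilon> (x - x0))\<^sup>2 * S)"
  proof (rule trans)
    show "l2_norm2 f = integral ?W (periodize (1 / b) (\<lambda>t. (cmod (f t))\<^sup>2))"
      by (rule norm2_periodize[OF f f0])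
  qed (rule Henstock_Kurzweil_Integration.integral_cong, rule h)
  then have 2: "A * b * l2_norm2 f = integral ?W (\<lambda>x. A * b * ((bump \<epsilon> (x - x0))\<^sup>2 * S))"
    by simp
  have i1: "(\<lambda>x. (bump \<epsilon> (x - x0))\<^sup>2 * Kc x) integrable_on ?W"
    "(\<lambda>x. A * b * ((bump \<epsilon> (x - x0))\<^sup>2 * S)) integrable_on ?W"
    by (intro integrable_continuous_real continuous_intros cb cK)+
  have "0 \<le> integral ?W (\<lambda>x. (bump \<epsilon> (x - x0))\<^sup>2 * Kc x - A * b * ((bump \<epsilon> (x - x0))\<^sup>2 * S))"
    using 1 2 by (simp add: Henstock_Kurzweil_Integration.integral_diff[OF i1])
  also have "\<dots> = integral ?W (\<lambda>x. (bump \<epsilon> (x - x0))\<^sup>2 * (Kc x - A * b * S))"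
    by (simp add: algebra_simps)
  also have "\<dots> < 0"
  proof (rule integral_less_zero)
    show "continuous_on ?W (\<lambda>x. (bump \<epsilon> (x - x0))\<^sup>2 * (Kc x - A * b * S))"
      by (intro continuous_intros cb cK)
    show "(bump \<epsilon> (x - x0))\<^sup>2 * (Kc x - A * b * S) \<le> 0" for x
      using small[of x] by (cases "\<bar>x - x0\<bar> < \<epsilon>") (auto simp: bump_def mult_nonneg_nonpos)
    show "x0 \<in> ?W" using b by (auto simp: w_def field_simps)
    show "(bump \<epsilon> (x0 - x0))\<^sup>2 * (Kc x0 - A * b * S) < 0"
      using neg \<epsilon> by (intro mult_pos_neg) (auto simp: bump_def)
    show "w < w + 1 / b" using b by simp
  qed
  finally show False by simp
qed

end

text \<open>A continuous weight concentrated at \<tau> would detect a negative value of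
  \<open>H\<close>, but only squares of trigonometric polynomials may be tested. Uniform
  approximation of such a weight changes the integral by less than its distance from 0.\<close>

lemma trig_poly_weight_nonneg:
  fixes H :: "real \<Rightarrow> real"
  assumes H: "continuous_on UNIV H"
    and nonneg: "\<And>D. trig_poly 1 D \<Longrightarrow> 0 \<le> integral {\<tau> - 1/2..\<tau> - 1/2 + 1} (\<lambda>t. (cmod (D t))\<^sup>2 * H t)"
  shows "0 \<le> H \<tau>"
proof (rule ccontr)
  assume "\<not> 0 \<le> H \<tau>"
  then have neg: "H \<tau> < 0" by simp
  let ?W = "{\<tau> - 1/2..\<tau> - 1/2 + 1}"
  have "isCont H \<tau>" using H by (simp add: continuous_on_eq_continuous_at)
  then have "eventually (\<lambda>x. H x < 0) (at \<tau>)"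
    using neg by (intro order_tendstoD(2)[of _ "H \<tau>"]) (auto simp: isCont_def)
  then obtain e where e: "e > 0" "\<And>x. x \<noteq> \<tau> \<Longrightarrow> dist x \<tau> < e \<Longrightarrow> H x < 0"
    by (auto simp: eventually_at)
  define \<epsilon> where "\<epsilon> = min e (1 / 2)"
  have \<epsilon>: "\<epsilon> > 0" "\<epsilon> \<le> 1 / 2" using e by (auto simp: \<epsilon>_def)
  have small: "H x < 0" if "\<bar>x - \<tau>\<bar> < \<epsilon>" for x
    using e(2)[of x] neg that by (cases "x = \<tau>") (auto simp: dist_real_def \<epsilon>_def)
  \<comment> \<open>The part of a cosine above a threshold: continuous, of period 1 and, within the
    window, vanishing outside distance \<epsilon> from \<tau>.\<close>
  define D0 where "D0 t = max 0 (cos (2 * pi * (t - \<tau>)) - cos (2 * pi * \<epsilon>))" for t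
  have D0c: "continuous_on V D0" for V unfolding D0_def by (intro continuous_intros)
  have D0p: "D0 (t + 1) = D0 t" for t
  proof -
    have "2 * pi * (t + 1 - \<tau>) = 2 * pi * (t - \<tau>) + 2 * pi" by (simp add: algebra_simps)
    then show ?thesis by (simp add: D0_def)
  qed
  have D0b: "0 \<le> D0 t" "D0 t \<le> 2" for t
    using cos_le_one[of "2 * pi * (t - \<tau>)"] cos_ge_minus_one[of "2 * pi * \<epsilon>"] unfolding D0_def by linarith+
  have D0z: "D0 t = 0" if t: "t \<in> ?W" "\<not> \<bar>t - \<tau>\<bar> < \<epsilon>" for t
  proof -
    have "\<bar>t - \<tau>\<bar> \<le> 1 / 2" using t(1) unfolding atLeastAtMost_iff by linarith
    then have "2 * pi * \<bar>t - \<tau>\<bar> \<le> pi" by simp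
    then have "cos (2 * pi * \<bar>t - \<tau>\<bar>) \<le> cos (2 * pi * \<epsilon>)"
      using t \<epsilon> by (intro cos_monotone_0_pi_le) auto
    also have "cos (2 * pi * \<bar>t - \<tau>\<bar>) = cos (2 * pi * (t - \<tau>))"
      using cos_abs_real[of "2 * pi * (t - \<tau>)"] by (simp add: abs_mult)
    finally show ?thesis by (simp add: D0_def)
  qed
  have D0\<tau>: "D0 \<tau> > 0"
  proof -
    have "cos (2 * pi * \<epsilon>) < cos 0" using \<epsilon> by (intro cos_monotone_0_pi) auto
    then show ?thesis by (simp add: D0_def)
  qed
  define I0 where "I0 = integral ?W (\<lambda>t. (D0 t)\<^sup>2 * H t)"
  have I0: "I0 < 0" unfolding I0_def
  proof (rule integral_less_zero)
    show "continuous_on ?W (\<lambda>t. (D0 t)\<^sup>2 * H t)"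
      by (intro continuous_intros D0c continuous_on_subset[OF H]) auto
    show "(D0 t)\<^sup>2 * H t \<le> 0" if "t \<in> ?W" for t
      using small[of t] D0z[OF that] by (cases "\<bar>t - \<tau>\<bar> < \<epsilon>") (auto simp: mult_nonneg_nonpos)
    show "(D0 \<tau>)\<^sup>2 * H \<tau> < 0" using neg D0\<tau> by (intro mult_pos_neg) auto
  qed auto
  define L where "L = integral ?W (\<lambda>t. \<bar>H t\<bar>)"
  have L: "L \<ge> 0" unfolding L_def
    by (intro integral_nonneg integrable_continuous_real continuous_intros continuous_on_subset[OF H]) auto
  \<comment> \<open>The factor 5 bounds \<open>cmod (D t) + D0 t\<close>, as \<open>D0\<close> is at
    most 2 and \<delta> at most 1; dividing by \<open>L + 1\<close> gives
    \<open>5 * \<delta> * L < - I0\<close> even when \<open>L\<close> is 0.\<close>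
  define \<delta> where "\<delta> = min 1 (- I0 / (5 * (L + 1)))"
  have "0 < - I0 / (5 * (L + 1))" using I0 L by (intro divide_pos_pos) auto
  then have \<delta>: "\<delta> > 0" "\<delta> \<le> 1" "\<delta> \<le> - I0 / (5 * (L + 1))" by (auto simp: \<delta>_def)
  have "5 * (L + 1) > 0" using L by simp
  then have "\<delta> * (5 * (L + 1)) \<le> - I0"
    using \<delta>(3) by (simp only: pos_le_divide_eq)
  then have \<delta>L: "5 * \<delta> * L < - I0" using \<delta>(1) by (simp add: algebra_simps)
  obtain D where D: "trig_poly 1 D" "\<And>t. cmod (complex_of_real (D0 t) - D t) < \<delta>"
    using trig_approximation[of 1 "\<lambda>t. complex_of_real (D0 t)" \<delta>] \<delta>(1) D0p
    by (auto intro!: continuous_intros D0c)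
  then have Dc: "continuous_on V D" for V
    by (auto simp: trig_poly_def intro!: continuous_intros)
  have "0 \<le> integral ?W (\<lambda>t. (cmod (D t))\<^sup>2 * H t)" by (rule nonneg[OF D(1)])
  also have "\<dots> \<le> integral ?W (\<lambda>t. (D0 t)\<^sup>2 * H t + 5 * \<delta> * \<bar>H t\<bar>)"
  proof (rule integral_le)
    fix t
    have 1: "\<bar>cmod (D t) - D0 t\<bar> \<le> \<delta>"
      using norm_triangle_ineq3[of "D t" "complex_of_real (D0 t)"] D(2)[of t] D0b[of t]
      by (simp add: norm_minus_commute)
    have "\<bar>(cmod (D t))\<^sup>2 - (D0 t)\<^sup>2\<bar> = \<bar>cmod (D t) - D0 t\<bar> * (cmod (D t) + D0 t)"
      using D0b[of t] by (simp add: power2_eq_square square_diff_square_factored abs_mult)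
    also have "\<dots> \<le> \<delta> * 5"
      using 1 D0b[of t] \<delta> by (intro mult_mono) auto
    finally have "\<bar>(cmod (D t))\<^sup>2 - (D0 t)\<^sup>2\<bar> \<le> 5 * \<delta>" by simp
    then have "\<bar>(cmod (D t))\<^sup>2 - (D0 t)\<^sup>2\<bar> * \<bar>H t\<bar> \<le> 5 * \<delta> * \<bar>H t\<bar>"
      by (rule mult_right_mono) simp
    then have "((cmod (D t))\<^sup>2 - (D0 t)\<^sup>2) * H t \<le> 5 * \<delta> * \<bar>H t\<bar>"
      unfolding abs_mult[symmetric] by linarith
    then show "(cmod (D t))\<^sup>2 * H t \<le> (D0 t)\<^sup>2 * H t + 5 * \<delta> * \<bar>H t\<bar>"
      by (simp add: left_diff_distrib)
  qed (intro integrable_continuous_real continuous_intros Dc D0c continuous_on_subset[OF H] subset_UNIV)+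
  also have "\<dots> = I0 + 5 * \<delta> * L"
    unfolding I0_def L_def
    by (subst Henstock_Kurzweil_Integration.integral_add)
       (auto intro!: integrable_continuous_real continuous_intros D0c continuous_on_subset[OF H])
  also have "\<dots> < 0" using \<delta>L by simp
  finally show False by simp
qed

context rational_gabor
begin

text \<open>For product coefficients \<open>v n * d m\<close> the symbol factors into the squared
  modulus of the polynomial \<open>D\<close> with coefficients \<open>d\<close> and the quadratic
  form \<open>r\<close> of the conjugated matrix at \<open>v\<close>. Varying \<open>d\<close>
  localizes the integrated fiber bound to one frequency, so a kernel vector of \<open>Phi\<close>
  must be 0.\<close>

lemma lin_indep_if_frame:
  assumes "is_frame (gabor g a b)"
  shows "lin_indep_columns q p (Phi g a b q x t)"
proof -
  obtain A where A: "A > 0" and frame: "\<And>f. L2 f \<Longrightarrow> A * l2_norm2 f \<le> (\<Sum>\<^sub>\<infinity>i. (cmod (l2_inner f (gabor g a b i)))\<^sup>2)"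
    using assms unfolding is_frame_def by blast
  have fiber: "A * b * (\<Sum>i\<in>blocks p J. (cmod (c i))\<^sup>2) \<le> integral {w..w + 1} (symbol_sum c J x)" if J: "finite J" for J c w
  proof (rule order_trans)
    show "A * b * (\<Sum>i\<in>blocks p J. (cmod (c i))\<^sup>2) \<le> (\<Sum>\<^sub>\<infinity>l. (cmod (\<Sum>i\<in>blocks p J. c i * cnj (g (x - of_int i / b - a * of_int l))))\<^sup>2)"
      by (rule frame_imp_fiber_bound[OF frame finite_blocks[OF J]])
  qed (simp only: infsumI[OF fiber_has_sum[OF J, where w = w]])
  show ?thesis unfolding lin_indep_columns_def
  proof (intro allI impI)
    fix u :: "nat \<Rightarrow> complex" and n
    assume zero: "\<forall>s<q. (\<Sum>n<p. Phi g a b q x t s n * u n) = 0" and n: "n < p"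
    \<comment> \<open>The symbol contains conjugated entries, so a kernel vector of
      \<open>Phi\<close> enters as its conjugate; for the same reason the frequency to test is
      \<open>- t\<close>.\<close>
    define v where "v n = cnj (u n)" for n
    define V where "V = (\<Sum>n<p. (cmod (v n))\<^sup>2)"
    define r where "r \<tau> = (\<Sum>s<q. (cmod (\<Sum>n<p. cnj (Phi g a b q x (- \<tau>) s n) * v n))\<^sup>2)" for \<tau>
    have rc: "continuous_on S r" for S
      unfolding r_def by (intro continuous_intros continuous_on_Phi_t)
    have "0 \<le> r (- t) - A * b * V"
    proof (rule trig_poly_weight_nonneg[where \<tau> = "- t"])
      show "continuous_on UNIV (\<lambda>\<tau>. r \<tau> - A * b * V)" by (intro continuous_intros rc)
      fix D assume "trig_poly 1 D"
      then obtain J d where J: "finite J" and D: "D = (\<lambda>\<tau>. \<Sum>m\<in>J. d m * wave 1 m \<tau>)"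
        unfolding trig_poly_def by blast
      let ?w = "- t - 1/2"
      \<comment> \<open>Quotient and remainder by \<open>p\<close> recover \<open>m\<close> and
        \<open>n\<close>, so this is \<open>v n * d m\<close> on every block.\<close>
      define c where "c i = v (nat (i mod int p)) * d (i div int p)" for i
      have c: "c (int n + int p * m) = v n * d m" if "n < p" for n m
        using that by (simp add: c_def)
      have Dc: "continuous_on S D" for S unfolding D by (intro continuous_intros)
      have "(\<Sum>i\<in>blocks p J. (cmod (c i))\<^sup>2) = V * (\<Sum>m\<in>J. (cmod (d m))\<^sup>2)"
        by (simp add: sum_blocks c norm_mult power_mult_distrib V_def sum_product)
      also have "\<dots> = V * integral {?w..?w + 1} (\<lambda>\<tau>. (cmod (D \<tau>))\<^sup>2)"
        unfolding D by (simp only: integral_norm_trig_sum[OF J])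
      finally have S: "(\<Sum>i\<in>blocks p J. (cmod (c i))\<^sup>2) = V * integral {?w..?w + 1} (\<lambda>\<tau>. (cmod (D \<tau>))\<^sup>2)" .
      have "symbol_sum c J x \<tau> = (cmod (D \<tau>))\<^sup>2 * r \<tau>" for \<tau>
      proof -
        have "(\<Sum>n<p. cnj (Phi g a b q x (- \<tau>) s n) * (\<Sum>m\<in>J. c (int n + int p * m) * wave 1 m \<tau>)) =
          D \<tau> * (\<Sum>n<p. cnj (Phi g a b q x (- \<tau>) s n) * v n)" for s
        proof -
          have "(\<Sum>m\<in>J. c (int n + int p * m) * wave 1 m \<tau>) = v n * D \<tau>" if "n < p" for n
            unfolding D c[OF that] by (simp add: sum_distrib_left mult.assoc)
          then show ?thesis by (simp add: sum_distrib_left mult_ac)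
        qed
        then show ?thesis
          by (simp only: symbol_sum_def r_def norm_mult power_mult_distrib sum_distrib_left[of "(cmod (D \<tau>))\<^sup>2"])
      qed
      then have "symbol_sum c J x = (\<lambda>\<tau>. (cmod (D \<tau>))\<^sup>2 * r \<tau>)" by blast
      with fiber[OF J, of c ?w]
      have "A * b * V * integral {?w..?w + 1} (\<lambda>\<tau>. (cmod (D \<tau>))\<^sup>2) \<le> integral {?w..?w + 1} (\<lambda>\<tau>. (cmod (D \<tau>))\<^sup>2 * r \<tau>)"
        unfolding S by (simp add: mult.assoc)
      then have "0 \<le> integral {?w..?w + 1} (\<lambda>\<tau>. (cmod (D \<tau>))\<^sup>2 * r \<tau>) - integral {?w..?w + 1} (\<lambda>\<tau>. A * b * V * (cmod (D \<tau>))\<^sup>2)"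
        by simp
      also have "\<dots> = integral {?w..?w + 1} (\<lambda>\<tau>. (cmod (D \<tau>))\<^sup>2 * r \<tau> - A * b * V * (cmod (D \<tau>))\<^sup>2)"
        by (intro Henstock_Kurzweil_Integration.integral_diff[symmetric] integrable_continuous_real continuous_intros Dc rc)
      finally show "0 \<le> integral {?w..?w + 1} (\<lambda>\<tau>. (cmod (D \<tau>))\<^sup>2 * (r \<tau> - A * b * V))"
        by (simp add: algebra_simps)
    qed
    moreover have "r (- t) = 0"
    proof -
      have "(\<Sum>n<p. cnj (Phi g a b q x t s n) * v n) = 0" if "s < q" for s
      proof -
        have "(\<Sum>n<p. cnj (Phi g a b q x t s n) * v n) = cnj (\<Sum>n<p. Phi g a b q x t s n * u n)"
          by (simp add: v_def)
        also have "\<dots> = 0" using zero that by simp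
        finally show ?thesis .
      qed
      then show ?thesis by (simp add: r_def)
    qed
    ultimately have "A * b * V \<le> 0" by simp
    moreover have "V \<ge> 0" by (simp add: V_def sum_nonneg)
    ultimately have "V = 0" using A b by (simp add: mult_le_0_iff)
    then show "u n = 0" using n by (simp add: V_def v_def sum_nonneg_eq_0_iff)
  qed
qed

end

theorem theorem2p4:
  fixes g :: "real \<Rightarrow> complex" and a b :: real and p q :: nat
  assumes "M1 g" and "continuous_on UNIV g"
    and "a > 0" and "b > 0" and "p > 0" and "q > 0"
    and "a * b = real p / real q" and "coprime p q"
    and "stable_generator g (1 / b)"
  shows "is_frame (gabor g a b) \<longleftrightarrow>
         (\<forall>x t. lin_indep_columns q p (Phi g a b q x t))"
proof -
  interpret rational_gabor g a b p q
    using assms M1_imp_wiener by unfold_locales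
  have "L2 g" using assms(1) by (simp add: M1_def)
  then show ?thesis using frame_if_lin_indep lin_indep_if_frame by blast
qed

end
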